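(* Let $(u_n)_n$ be a minimizing sequence for $E$ in $\mathcal{A}_{nc}$. Assume that $u_n\rightharpoonup u$ weakly in $W^{1,2}(\Omega,\mathbb{R}^3)$, that $G_{u_n}\rightharpoonup G_u+S$ in the sense of currents in $\Omega\times\mathbb{R}^3$, and that $|Du_n|^2\rightharpoonup|Du|^2+\mu$ in the sense of measures in $\Omega$. Then $$\operatorname{supp}S\subseteq\operatorname{supp}\mu\times\mathbb{R}^3.$$
   Context: $\Omega,\Omega'\subset\mathbb{R}^3$ are smooth bounded domains, $g:\overline{\Omega}\to\overline{\Omega'}$ is a $C^1$-diffeomorphism, $M>0$, and $H:(0,\infty)\to[0,\infty)$ is a (smooth) convex function with $\lim_{t\to+\infty}H(t)/t=\lim_{s\to0^+}H(s)=+\infty$. $E(u)=\int_\Omega|Du|^2+H(\det Du)\,dx$. For $u\in W^{1,2}(\Omega,\mathbb{R}^3)$ with $\det Du\in L^1(\Omega)$ and $f\in C^\infty_c(\Omega\times\mathbb{R}^3,\mathbb{R}^3)$ set $$\mathcal{E}_u(f)=\int_\Omega \langle\operatorname{cof}Du(x),D_xf(x,u(x))\rangle+\det Du(x)\,\operatorname{div}_yf(x,u(x))\,dx,\qquad \mathcal{E}(u)=\sup\{\mathcal{E}_u(f): \|f\|_\infty\le1\},$$ where $\langle A,B\rangle=\operatorname{tr}(A^TB)$ and $A^T\operatorname{cof}A=(\det A)I$. $\mathcal{A}$ is the set of $u\in W^{1,2}\cap L^\infty(\Omega,\mathbb{R}^3)$ with $u|_{\partial\Omega}=g|_{\partial\Omega}$,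 $\|u\|_\infty\le M$, $\det Du>0$ a.e. and $u$ one-to-one a.e.; $\mathcal{A}_{nc}=\{u\in\mathcal{A}:\mathcal{E}(u)=0\}$. A minimizing sequence is a sequence $u_n\in\mathcal{A}_{nc}$ with $E(u_n)\to\inf_{\mathcal{A}_{nc}}E$, where the infimum is assumed finite. $3$-currents in $\Omega\times\mathbb{R}^3$ are linear forms on smooth compactly supported $3$-forms; convergence in the sense of currents is pointwise convergence on such forms. The support of a current $T$ is the smallest relatively closed $K\subset\Omega\times\mathbb{R}^3$ such that $\langle T,\omega\rangle=0$ whenever $\operatorname{supp}\omega\subset(\Omega\times\mathbb{R}^3)\setminus K$. For $u\in W^{1,2}(\Omega,\mathbb{R}^3)$ with $\det Du\in L^1$, the graph current is $$\langle G_u,\omega\rangle=\int_\Omega\langle\omega(x,u(x)),M(Du)(x)\rangle\,dx,\qquad M(Du)=(e_1,Du\,e_1)\wedge(e_2,Du\,e_2)\wedge(e_3,Du\,e_3).$$ *)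

theory Defs
  imports "HOL-Analysis.Analysis"
begin

section \<open>Smooth functions, domains and diffeomorphisms\<close>

primrec Ck_on :: "nat \<Rightarrow> ('a::real_normed_vector \<Rightarrow> 'b::real_normed_vector) \<Rightarrow> 'a set \<Rightarrow> bool" where
  "Ck_on 0 f U \<longleftrightarrow> continuous_on U f"
| "Ck_on (Suc k) f U \<longleftrightarrow>
     (\<forall>x\<in>U. f differentiable (at x)) \<and> (\<forall>v. Ck_on k (\<lambda>x. frechet_derivative f (at x) v) U)"

text \<open>Both notions are meant for open \<open>U\<close>.\<close>

definition smooth_on :: "('a::real_normed_vector \<Rightarrow> 'b::real_normed_vector) \<Rightarrow> 'a set \<Rightarrow> bool" where
  "smooth_on f U \<longleftrightarrow> (\<forall>k. Ck_on k f U)"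

text \<open>The boundary of a smooth bounded domain is locally the zero set of a smooth defining function
  without critical points, with the domain on its negative side.\<close>

definition smooth_bounded_domain :: "'a::euclidean_space set \<Rightarrow> bool" where
  "smooth_bounded_domain \<Omega> \<longleftrightarrow>
     open \<Omega> \<and> connected \<Omega> \<and> \<Omega> \<noteq> {} \<and> bounded \<Omega> \<and>
     (\<forall>p\<in>frontier \<Omega>. \<exists>U (\<rho>::'a \<Rightarrow> real). open U \<and> p \<in> U \<and> smooth_on \<rho> U \<and>
        (\<forall>x\<in>U. frechet_derivative \<rho> (at x) \<noteq> (\<lambda>_. 0)) \<and> \<Omega> \<inter> U = {x\<in>U. \<rho> x < 0})"

text \<open>On a set that need not be open, \<open>C\<^sup>1\<close> means: restriction of a \<open>C\<^sup>1\<close> map on an open neighbourhood.\<close>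

definition C1_map_on :: "('a::real_normed_vector \<Rightarrow> 'b::real_normed_vector) \<Rightarrow> 'a set \<Rightarrow> bool" where
  "C1_map_on f A \<longleftrightarrow>
     (\<exists>U F. open U \<and> A \<subseteq> U \<and> Ck_on 1 F U \<and> (\<forall>x\<in>A. F x = f x))"

definition C1_diffeomorphism ::
  "('a::real_normed_vector \<Rightarrow> 'b::real_normed_vector) \<Rightarrow> 'a set \<Rightarrow> 'b set \<Rightarrow> bool" where
  "C1_diffeomorphism g A B \<longleftrightarrow>
     bij_betw g A B \<and> C1_map_on g A \<and> C1_map_on (the_inv_into A g) B"

definition supp :: "('a::topological_space \<Rightarrow> 'b::zero) \<Rightarrow> 'a set" where
  "supp f = closure {x. f x \<noteq> 0}"

text \<open>\<open>C\<^sub>c\<^sup>\<infinity>(U)\<close>; its members are functions on the whole space, extended by zero.\<close>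

definition test_functions ::
  "'a::real_normed_vector set \<Rightarrow> ('a \<Rightarrow> 'b::real_normed_vector) set" where
  "test_functions U = {f. smooth_on f UNIV \<and> compact (supp f) \<and> supp f \<subseteq> U}"

section \<open>The Sobolev space \<open>W\<^sup>1\<^sup>,\<^sup>2(\<Omega>,\<real>\<^sup>3)\<close>\<close>

text \<open>Functions are not identified almost everywhere; only their values on \<open>\<Omega>\<close> matter. The norms on
  \<open>real^3\<close> and \<open>real^3^3\<close> are the Euclidean and the Frobenius norm.\<close>

definition L2 :: "(real^3) set \<Rightarrow> (real^3 \<Rightarrow> 'b::euclidean_space) set" where
  "L2 \<Omega> = {f. f \<in> borel_measurable (lebesgue_on \<Omega>) \<and>
              integrable (lebesgue_on \<Omega>) (\<lambda>x. (norm (f x))\<^sup>2)}"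

text \<open>\<open>D x $ i $ j\<close> is the partial derivative of the \<open>i\<close>-th component in the \<open>j\<close>-th direction.\<close>

definition has_weak_gradient ::
  "(real^3 \<Rightarrow> real^3) \<Rightarrow> (real^3 \<Rightarrow> real^3^3) \<Rightarrow> (real^3) set \<Rightarrow> bool" where
  "has_weak_gradient u D \<Omega> \<longleftrightarrow>
     D \<in> borel_measurable (lebesgue_on \<Omega>) \<and>
     (\<forall>K. compact K \<and> K \<subseteq> \<Omega> \<longrightarrow> integrable (lebesgue_on K) D) \<and>
     (\<forall>\<phi>\<in>test_functions \<Omega>. \<forall>i j.
        (LINT x|lebesgue_on \<Omega>. u x $ i * frechet_derivative \<phi> (at x) (axis j 1)) =
        - (LINT x|lebesgue_on \<Omega>. D x $ i $ j * \<phi> x))"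

definition W12 :: "(real^3) set \<Rightarrow> (real^3 \<Rightarrow> real^3) set" where
  "W12 \<Omega> = {u. u \<in> L2 \<Omega> \<and> (\<exists>D\<in>L2 \<Omega>. has_weak_gradient u D \<Omega>)}"

text \<open>The weak gradient is unique up to null sets; everything below depends only on its class.\<close>

definition wgrad :: "(real^3) set \<Rightarrow> (real^3 \<Rightarrow> real^3) \<Rightarrow> real^3 \<Rightarrow> real^3^3" where
  "wgrad \<Omega> u = (SOME D. has_weak_gradient u D \<Omega>)"

definition W12_norm :: "(real^3) set \<Rightarrow> (real^3 \<Rightarrow> real^3) \<Rightarrow> real" where
  "W12_norm \<Omega> u = sqrt ((LINT x|lebesgue_on \<Omega>. (norm (u x))\<^sup>2) +
                        (LINT x|lebesgue_on \<Omega>. (norm (wgrad \<Omega> u x))\<^sup>2))"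

definition W12_dual :: "(real^3) set \<Rightarrow> ((real^3 \<Rightarrow> real^3) \<Rightarrow> real) set" where
  "W12_dual \<Omega> = {l.
     (\<forall>v\<in>W12 \<Omega>. \<forall>w\<in>W12 \<Omega>. l (\<lambda>x. v x + w x) = l v + l w) \<and>
     (\<forall>c. \<forall>v\<in>W12 \<Omega>. l (\<lambda>x. c *\<^sub>R v x) = c * l v) \<and>
     (\<exists>C. \<forall>v\<in>W12 \<Omega>. \<bar>l v\<bar> \<le> C * W12_norm \<Omega> v)}"

definition weakly_converges_W12 ::
  "(real^3) set \<Rightarrow> (nat \<Rightarrow> real^3 \<Rightarrow> real^3) \<Rightarrow> (real^3 \<Rightarrow> real^3) \<Rightarrow> bool" where
  "weakly_converges_W12 \<Omega> u v \<longleftrightarrow>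
     (\<forall>n. u n \<in> W12 \<Omega>) \<and> v \<in> W12 \<Omega> \<and> (\<forall>l\<in>W12_dual \<Omega>. (\<lambda>n. l (u n)) \<longlonglongrightarrow> l v)"

text \<open>The closure of \<open>C\<^sub>c\<^sup>\<infinity>(\<Omega>,\<real>\<^sup>3)\<close> in the Sobolev norm.\<close>

definition W12_0 :: "(real^3) set \<Rightarrow> (real^3 \<Rightarrow> real^3) set" where
  "W12_0 \<Omega> = {v\<in>W12 \<Omega>. \<exists>\<phi>::nat \<Rightarrow> real^3 \<Rightarrow> real^3. (\<forall>k. \<phi> k \<in> test_functions \<Omega>) \<and>
                (\<lambda>k. W12_norm \<Omega> (\<lambda>x. v x - \<phi> k x)) \<longlonglongrightarrow> 0}"

section \<open>The surface energy and the admissible maps\<close>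

text \<open>The cofactor in position \<open>(i,j)\<close> is the determinant of \<open>A\<close> with its \<open>j\<close>-th column replaced by the
  \<open>i\<close>-th unit vector.\<close>

definition cof :: "real^3^3 \<Rightarrow> real^3^3" where
  "cof A = (\<chi> i j. det (\<chi> k l. if l = j then axis i 1 $ k else A $ k $ l))"

lemma transpose_mult_cof: "transpose A ** cof A = mat (det A)"
proof -
  have "(\<Sum>i\<in>UNIV. A $ i $ l * cof A $ i $ j) = (if l = j then det A else 0)" for l j
    using exhaust_3[of l] exhaust_3[of j]
    by (auto simp: cof_def det_3 sum_3 axis_def algebra_simps)
  then show ?thesis
    by (simp add: vec_eq_iff matrix_matrix_mult_def transpose_def mat_def)
qed

definition surface_energy_at ::
  "(real^3) set \<Rightarrow> (real^3 \<Rightarrow> real^3) \<Rightarrow> ((real^3) \<times> (real^3) \<Rightarrow> real^3) \<Rightarrow> real" where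
  "surface_energy_at \<Omega> u f = (LINT x|lebesgue_on \<Omega>.
     trace (transpose (cof (wgrad \<Omega> u x)) **
            (\<chi> i j. frechet_derivative f (at (x, u x)) (axis j 1, 0) $ i)) +
     det (wgrad \<Omega> u x) *
       (\<Sum>i\<in>UNIV. frechet_derivative f (at (x, u x)) (0, axis i 1) $ i))"

definition surface_energy :: "(real^3) set \<Rightarrow> (real^3 \<Rightarrow> real^3) \<Rightarrow> ereal" where
  "surface_energy \<Omega> u =
     (SUP f\<in>{f\<in>test_functions (\<Omega> \<times> UNIV). \<forall>z. norm (f z) \<le> 1}. ereal (surface_energy_at \<Omega> u f))"

definition one_to_one_ae :: "(real^3 \<Rightarrow> real^3) \<Rightarrow> (real^3) set \<Rightarrow> bool" where
  "one_to_one_ae u \<Omega> \<longleftrightarrow> (\<exists>N\<in>null_sets lebesgue. inj_on u (\<Omega> - N))"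

text \<open>The boundary condition \<open>u = g\<close> on \<open>\<partial>\<Omega>\<close> is the usual Sobolev one, \<open>u - g \<in> W\<^sub>0\<^sup>1\<^sup>,\<^sup>2\<close>.\<close>

definition admissible ::
  "(real^3) set \<Rightarrow> (real^3 \<Rightarrow> real^3) \<Rightarrow> real \<Rightarrow> (real^3 \<Rightarrow> real^3) set" where
  "admissible \<Omega> g M = {u\<in>W12 \<Omega>.
     (\<lambda>x. u x - g x) \<in> W12_0 \<Omega> \<and>
     (AE x in lebesgue_on \<Omega>. norm (u x) \<le> M) \<and>
     (AE x in lebesgue_on \<Omega>. 0 < det (wgrad \<Omega> u x)) \<and>
     one_to_one_ae u \<Omega>}"

text \<open>Integrability of the Jacobian is what makes the surface energy well defined.\<close>

definition admissible_nc ::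
  "(real^3) set \<Rightarrow> (real^3 \<Rightarrow> real^3) \<Rightarrow> real \<Rightarrow> (real^3 \<Rightarrow> real^3) set" where
  "admissible_nc \<Omega> g M = {u\<in>admissible \<Omega> g M.
     integrable (lebesgue_on \<Omega>) (\<lambda>x. det (wgrad \<Omega> u x)) \<and> surface_energy \<Omega> u = 0}"

text \<open>\<open>H\<close> is a function on \<open>(0,\<infinity>)\<close>; its values elsewhere play no role for maps with positive Jacobian.\<close>

definition energy :: "(real^3) set \<Rightarrow> (real \<Rightarrow> real) \<Rightarrow> (real^3 \<Rightarrow> real^3) \<Rightarrow> ennreal" where
  "energy \<Omega> H u =
     (\<integral>\<^sup>+x. ennreal ((norm (wgrad \<Omega> u x))\<^sup>2 + H (det (wgrad \<Omega> u x))) \<partial>lebesgue_on \<Omega>)"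

definition minimizing_sequence ::
  "('b \<Rightarrow> ennreal) \<Rightarrow> 'b set \<Rightarrow> (nat \<Rightarrow> 'b) \<Rightarrow> bool" where
  "minimizing_sequence E A u \<longleftrightarrow>
     (INF v\<in>A. E v) < \<infinity> \<and> (\<forall>n. u n \<in> A) \<and> (\<lambda>n. E (u n)) \<longlonglongrightarrow> (INF v\<in>A. E v)"

section \<open>Currents\<close>

text \<open>A \<open>3\<close>-covector is an alternating trilinear form, so that its pairing with a simple \<open>3\<close>-vector
  \<open>a \<and> b \<and> c\<close> is evaluation at \<open>(a,b,c)\<close>. A \<open>3\<close>-form is a field of \<open>3\<close>-covectors.\<close>

type_synonym 'a covector3 = "'a \<Rightarrow> 'a \<Rightarrow> 'a \<Rightarrow> real"
type_synonym 'a form3 = "'a \<Rightarrow> 'a covector3"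

definition alternating3 :: "'a::real_vector covector3 \<Rightarrow> bool" where
  "alternating3 \<alpha> \<longleftrightarrow>
     (\<forall>b c. linear (\<lambda>a. \<alpha> a b c)) \<and> (\<forall>a c. linear (\<lambda>b. \<alpha> a b c)) \<and> (\<forall>a b. linear (\<lambda>c. \<alpha> a b c)) \<and>
     (\<forall>a b. \<alpha> a a b = 0 \<and> \<alpha> a b b = 0 \<and> \<alpha> a b a = 0)"

definition form_supp :: "'a::topological_space form3 \<Rightarrow> 'a set" where
  "form_supp \<omega> = closure {z. \<omega> z \<noteq> (\<lambda>a b c. 0)}"

definition test_forms3 :: "'a::real_normed_vector set \<Rightarrow> 'a form3 set" where
  "test_forms3 U = {\<omega>. (\<forall>z. alternating3 (\<omega> z)) \<and> (\<forall>a b c. smooth_on (\<lambda>z. \<omega> z a b c) UNIV) \<and>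
                       compact (form_supp \<omega>) \<and> form_supp \<omega> \<subseteq> U}"

definition current3 :: "'a::real_normed_vector set \<Rightarrow> ('a form3 \<Rightarrow> real) \<Rightarrow> bool" where
  "current3 U T \<longleftrightarrow>
     (\<forall>\<omega>\<in>test_forms3 U. \<forall>\<eta>\<in>test_forms3 U. T (\<lambda>z a b c. \<omega> z a b c + \<eta> z a b c) = T \<omega> + T \<eta>) \<and>
     (\<forall>r. \<forall>\<omega>\<in>test_forms3 U. T (\<lambda>z a b c. r * \<omega> z a b c) = r * T \<omega>)"

definition current_converges ::
  "'a::real_normed_vector set \<Rightarrow> (nat \<Rightarrow> 'a form3 \<Rightarrow> real) \<Rightarrow> ('a form3 \<Rightarrow> real) \<Rightarrow> bool" where
  "current_converges U T T' \<longleftrightarrow> (\<forall>\<omega>\<in>test_forms3 U. (\<lambda>n. T n \<omega>) \<longlonglongrightarrow> T' \<omega>)"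

text \<open>The smallest relatively closed set off which \<open>T\<close> vanishes, as an intersection.\<close>

definition current_supp :: "'a::real_normed_vector set \<Rightarrow> ('a form3 \<Rightarrow> real) \<Rightarrow> 'a set" where
  "current_supp U T = \<Inter>{K. closedin (top_of_set U) K \<and>
     (\<forall>\<omega>\<in>test_forms3 U. form_supp \<omega> \<subseteq> U - K \<longrightarrow> T \<omega> = 0)}"

text \<open>Well defined if \<open>u\<close> is in \<open>W\<^sup>1\<^sup>,\<^sup>2\<close> and its Jacobian is integrable.\<close>

definition graph_current ::
  "(real^3) set \<Rightarrow> (real^3 \<Rightarrow> real^3) \<Rightarrow> ((real^3) \<times> (real^3)) form3 \<Rightarrow> real" where
  "graph_current \<Omega> u \<omega> = (LINT x|lebesgue_on \<Omega>. \<omega> (x, u x)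
     (axis 1 1, wgrad \<Omega> u x *v axis 1 1)
     (axis 2 1, wgrad \<Omega> u x *v axis 2 1)
     (axis 3 1, wgrad \<Omega> u x *v axis 3 1))"

section \<open>Measures\<close>

definition radon_measure_on :: "(real^3) set \<Rightarrow> (real^3) measure \<Rightarrow> bool" where
  "radon_measure_on \<Omega> \<mu> \<longleftrightarrow> sets \<mu> = sets (restrict_space borel \<Omega>) \<and>
     (\<forall>K. compact K \<and> K \<subseteq> \<Omega> \<longrightarrow> emeasure \<mu> K < \<infinity>)"

definition measure_supp :: "(real^3) set \<Rightarrow> (real^3) measure \<Rightarrow> (real^3) set" where
  "measure_supp \<Omega> \<mu> = {x\<in>\<Omega>. \<forall>U. open U \<and> x \<in> U \<longrightarrow> emeasure \<mu> (U \<inter> \<Omega>) > 0}"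

text \<open>Vague convergence of the measures with densities \<open>h n\<close> to the sum of the one with density \<open>h'\<close>
  and \<open>\<mu>\<close>.\<close>

definition densities_converge ::
  "(real^3) set \<Rightarrow> (nat \<Rightarrow> real^3 \<Rightarrow> real) \<Rightarrow> (real^3 \<Rightarrow> real) \<Rightarrow> (real^3) measure \<Rightarrow> bool" where
  "densities_converge \<Omega> h h' \<mu> \<longleftrightarrow>
     (\<forall>\<phi>::real^3 \<Rightarrow> real. continuous_on UNIV \<phi> \<and> compact (supp \<phi>) \<and> supp \<phi> \<subseteq> \<Omega> \<longrightarrow>
        (\<lambda>n. LINT x|lebesgue_on \<Omega>. \<phi> x * h n x) \<longlonglongrightarrow>
          (LINT x|lebesgue_on \<Omega>. \<phi> x * h' x) + (LINT x|\<mu>. \<phi> x))"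

end

theory Submission
  imports Defs
begin

text \<open>Let \<open>V\<close> be the complement of \<open>supp \<mu>\<close> in \<open>\<Omega>\<close>, and let \<open>\<omega>\<close> be a form supported in \<open>V \<times> \<real>\<^sup>3\<close>. On
  \<open>V\<close> the measures \<open>|Du\<^sub>n|\<^sup>2\<close> converge to \<open>|Du|\<^sup>2\<close>, so the weakly convergent gradients converge strongly in
  \<open>L\<^sup>2\<close> on compact subsets of \<open>V\<close>; an estimate for translations turns this into strong convergence of the
  maps. The Jacobians are equiintegrable because \<open>H\<close> is superlinear and the energies are bounded. The
  integrand of \<open>G(u\<^sub>n)(\<omega>)\<close> is bounded by a multiple of \<open>1 + |Du\<^sub>n|\<^sup>2 + |det Du\<^sub>n|\<close> on the projection of
  \<open>supp \<omega>\<close> and converges almost everywhere along a subsequence, whence \<open>G(u\<^sub>n)(\<omega>)\<close> tends to \<open>G(u)(\<omega>)\<close>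
  along it by Vitali's theorem. Thus \<open>S(\<omega>) = 0\<close>.\<close>

section \<open>Smooth functions and test functions\<close>

text \<open>The obstacle is the cubic term. Strong \<open>L^2\<close> convergence of the gradients
  on compact sets controls the 2x2 minors, but the determinant is cubic in the gradient and is
  bounded only in \<open>L^1\<close>. No product estimate handles it. It converges almost everywhere
  because the gradients do, and its concentration is excluded by the superlinear growth of
  \<open>H\<close>; positivity of the Jacobian lets the energy bound its absolute value. Almost
  everywhere convergence of the maps themselves is needed as well, because the forms are evaluated
  at \<open>(x, u n x)\<close>. Weak gradients are accessible only through integrals against test
  functions, so the translation estimate works by duality: the translation is moved onto the test
  function, and the sign of the difference is approximated by test functions. These are obtained as
  a fixed bump times polynomials, without convolution; the price is a constant in their uniform
  bound. Passing to a subsequence costs nothing: the currents of the whole sequence converge, so any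
  subsequence identifies the limit.\<close>

lemma Ck_on_SucI:
  assumes "\<And>x. (f has_derivative f' x) (at x)" and "\<And>v. Ck_on k (\<lambda>x. f' x v) UNIV"
  shows "Ck_on (Suc k) f UNIV"
proof -
  have "frechet_derivative f (at x) = f' x" for x
    using assms(1) frechet_derivative_at by metis
  then show ?thesis using assms by (auto simp: differentiable_def)
qed

lemma Ck_on_Suc_has_derivative:
  "Ck_on (Suc k) f U \<Longrightarrow> x \<in> U \<Longrightarrow> (f has_derivative frechet_derivative f (at x)) (at x)"
  by (auto simp: frechet_derivative_works[symmetric])

lemma Ck_on_Suc_imp: "Ck_on (Suc k) f U \<Longrightarrow> Ck_on k f U"
proof (induction k arbitrary: f)
  case 0
  then show ?case
    by (auto intro!: continuous_at_imp_continuous_on differentiable_imp_continuous_within)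
next
  case (Suc k)
  have "f differentiable (at x)" if "x \<in> U" for x using Suc.prems that by simp
  moreover have "Ck_on k (\<lambda>x. frechet_derivative f (at x) v) U" for v
    by (rule Suc.IH) (use Suc.prems in \<open>simp del: Ck_on.simps(2) add: Ck_on.simps(2)[of "Suc k"]\<close>)
  ultimately show ?case by simp
qed

lemma Ck_on_const: "Ck_on k (\<lambda>x. c) UNIV"
proof (induction k arbitrary: c)
  case (Suc k)
  show ?case by (rule Ck_on_SucI[where f' = "\<lambda>x v. 0"]) (auto intro: Suc)
qed auto

lemma Ck_on_bounded_linear:
  assumes "bounded_linear f"
  shows "Ck_on k f UNIV"
proof (cases k)
  case 0
  then show ?thesis using assms by (simp add: linear_continuous_on)
next
  case (Suc j)
  have "Ck_on (Suc j) f UNIV"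
    by (rule Ck_on_SucI[where f' = "\<lambda>x. f"])
       (auto intro: Ck_on_const bounded_linear_imp_has_derivative assms)
  with Suc show ?thesis by (simp del: Ck_on.simps)
qed

lemma Ck_on_add:
  "Ck_on k f UNIV \<Longrightarrow> Ck_on k g UNIV \<Longrightarrow> Ck_on k (\<lambda>x. f x + g x) UNIV"
proof (induction k arbitrary: f g)
  case (Suc k)
  show ?case
    by (rule Ck_on_SucI[OF has_derivative_add[OF Suc.prems[THEN Ck_on_Suc_has_derivative]]])
       (use Suc in auto)
qed (auto intro: continuous_intros)

text \<open>The product rule keeps the undifferentiated factors, so the induction step also needs
  that order \<open>Suc k\<close> includes order \<open>k\<close>.\<close>

lemma Ck_on_mult:
  fixes f g :: "'a::real_normed_vector \<Rightarrow> real"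
  shows "Ck_on k f UNIV \<Longrightarrow> Ck_on k g UNIV \<Longrightarrow> Ck_on k (\<lambda>x. f x * g x) UNIV"
proof (induction k arbitrary: f g)
  case (Suc k)
  show ?case
    by (rule Ck_on_SucI[OF has_derivative_mult[OF Suc.prems[THEN Ck_on_Suc_has_derivative]]])
       (use Suc Suc.prems[THEN Ck_on_Suc_imp] in \<open>auto intro!: Ck_on_add\<close>)
qed (auto intro: continuous_intros)

lemma Ck_on_shift:
  fixes f :: "'a::real_normed_vector \<Rightarrow> 'b::real_normed_vector"
  shows "Ck_on k f UNIV \<Longrightarrow> Ck_on k (\<lambda>x. f (x - c)) UNIV"
proof (induction k arbitrary: f)
  case 0
  then show ?case
    using continuous_on_compose2[of UNIV f UNIV "\<lambda>x. x - c"] by (simp add: continuous_on_diff)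
next
  case (Suc k)
  have "((\<lambda>x. f (x - c)) has_derivative (\<lambda>h. frechet_derivative f (at (x - c)) h)) (at x)" for x
    by (rule has_derivative_compose[of "\<lambda>x. x - c" "\<lambda>h. h" x UNIV f, simplified])
       (use Ck_on_Suc_has_derivative[OF Suc.prems] in \<open>auto intro!: derivative_eq_intros\<close>)
  then show ?case by (rule Ck_on_SucI) (use Suc in auto)
qed

text \<open>Polynomials are the smooth approximants that Stone-Weierstrass supplies in
  \<open>test_function_approx\<close>.\<close>

lemma Ck_on_real_polynomial_function:
  "real_polynomial_function p \<Longrightarrow> Ck_on k p UNIV"
  by (induction rule: real_polynomial_function.induct)
     (auto intro: Ck_on_bounded_linear Ck_on_const Ck_on_add Ck_on_mult)

text \<open>The derivative of a member of this family is a linear combination of members, so that smoothness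
  follows by induction on the order of differentiation.\<close>

definition flat_exp :: "nat \<Rightarrow> real \<Rightarrow> real" where
  "flat_exp m t = (if t > 0 then exp (- inverse t) * inverse t ^ m else 0)"

text \<open>With s = 1/t the limit from the right becomes that of s^m / exp s at infinity; on the
  left the function is identically 0.\<close>

lemma flat_exp_tendsto_0: "(flat_exp m \<longlongrightarrow> 0) (at 0)"
proof -
  have "((\<lambda>x::real. x ^ m / exp x) \<longlongrightarrow> 0) at_top" by (rule tendsto_power_div_exp_0)
  then have "((\<lambda>t::real. inverse t ^ m / exp (inverse t)) \<longlongrightarrow> 0) (at_right 0)"
    by (rule filterlim_compose) (rule filterlim_inverse_at_top_right)
  then have "(flat_exp m \<longlongrightarrow> 0) (at_right 0)"
    by (rule Lim_transform_eventually)
       (auto simp: flat_exp_def eventually_at_filter exp_minus field_simps)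
  moreover have "(flat_exp m \<longlongrightarrow> 0) (at_left 0)"
    by (rule tendsto_eventually) (auto simp: flat_exp_def eventually_at_filter)
  ultimately show ?thesis by (simp add: filterlim_at_split)
qed

lemma flat_exp_has_real_derivative:
  "(flat_exp m has_real_derivative flat_exp (m + 2) t - m * flat_exp (m + 1) t) (at t)"
proof -
  consider "t > 0" | "t < 0" | "t = 0" by linarith
  then show ?thesis
  proof cases
    case 1
    \<comment> \<open>For \<open>m = 0\<close> the truncated exponent \<open>m - 1\<close> does no
      harm, since it is multiplied by \<open>m\<close>.\<close>
    have "((\<lambda>s. exp (- s) * s ^ m) has_real_derivative
        exp (- inverse t) * (m * inverse t ^ (m - 1)) - exp (- inverse t) * inverse t ^ m) (at (inverse t))"
      by (auto intro!: derivative_eq_intros)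
    from DERIV_chain2[OF this DERIV_inverse] 1
    have "((\<lambda>t. exp (- inverse t) * inverse t ^ m) has_real_derivative
        (exp (- inverse t) * (m * inverse t ^ (m - 1)) - exp (- inverse t) * inverse t ^ m)
          * - (inverse t ^ Suc (Suc 0))) (at t)" by simp
    also have "(exp (- inverse t) * (m * inverse t ^ (m - 1)) - exp (- inverse t) * inverse t ^ m)
          * - (inverse t ^ Suc (Suc 0)) = flat_exp (m + 2) t - m * flat_exp (m + 1) t"
      using 1 by (cases m) (simp_all add: flat_exp_def algebra_simps)
    finally have "((\<lambda>t. exp (- inverse t) * inverse t ^ m) has_real_derivative
             flat_exp (m + 2) t - m * flat_exp (m + 1) t) (at t)" .
    moreover have "eventually (\<lambda>s. s \<in> {0<..}) (nhds t)"
      using 1 by (intro eventually_nhds_in_open) auto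
    then have "eventually (\<lambda>s. exp (- inverse s) * inverse s ^ m = flat_exp m s) (nhds t)"
      by eventually_elim (simp add: flat_exp_def)
    ultimately show ?thesis by (subst (asm) DERIV_cong_ev[OF refl _ refl])
  next
    case 2
    have "eventually (\<lambda>s. s \<in> {..<0}) (nhds t)"
      using 2 by (intro eventually_nhds_in_open) auto
    then have "eventually (\<lambda>s. 0 = flat_exp m s) (nhds t)"
      by eventually_elim (simp add: flat_exp_def)
    moreover have "((\<lambda>s. 0) has_real_derivative 0) (at t)" by simp
    ultimately have "(flat_exp m has_real_derivative 0) (at t)"
      by (subst (asm) DERIV_cong_ev[OF refl _ refl])
    then show ?thesis using 2 by (simp add: flat_exp_def)
  next
    case 3
    \<comment> \<open>As \<open>flat_exp m 0\<close> is 0, the difference quotient at 0 is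
      \<open>flat_exp (Suc m)\<close>, which tends to 0.\<close>
    have "((\<lambda>h. (flat_exp m (0 + h) - flat_exp m 0) / h) \<longlongrightarrow> 0) (at 0)"
      by (rule Lim_transform_eventually[OF flat_exp_tendsto_0[of "Suc m"]])
         (auto simp: flat_exp_def eventually_at_filter field_simps)
    then have "(flat_exp m has_real_derivative 0) (at 0)" by (simp add: DERIV_def)
    then show ?thesis using 3 by (simp add: flat_exp_def)
  qed
qed

lemma Ck_on_flat_exp_compose:
  assumes "\<And>k. Ck_on k q UNIV"
  shows "Ck_on k (\<lambda>x. flat_exp m (q x)) UNIV"
\<comment> \<open>\<open>m\<close> is generalized because differentiation raises it by one or
  two.\<close>
proof (induction k arbitrary: m)
  case 0
  have "continuous_on UNIV (flat_exp m)"
    by (rule DERIV_continuous_on) (rule has_field_derivative_at_within[OF flat_exp_has_real_derivative])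
  with assms[of 0] show ?case by (auto intro: continuous_on_compose2)
next
  case (Suc k)
  have d: "(q has_derivative frechet_derivative q (at x)) (at x)" for x
    using assms[of "Suc 0"] by (rule Ck_on_Suc_has_derivative) simp
  have "((\<lambda>x. flat_exp m (q x)) has_derivative
      (\<lambda>v. (flat_exp (m+2) (q x) + (- real m) * flat_exp (m+1) (q x)) * frechet_derivative q (at x) v)) (at x)" for x
    using has_derivative_compose[OF d flat_exp_has_real_derivative[unfolded has_field_derivative_def]]
    by simp
  moreover have "Ck_on k (\<lambda>x. (flat_exp (m+2) (q x) + (- real m) * flat_exp (m+1) (q x))
      * frechet_derivative q (at x) v) UNIV" for v
    using Suc assms[of "Suc k"] by (intro Ck_on_mult Ck_on_add Ck_on_const) auto
  ultimately show ?case by (rule Ck_on_SucI)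
qed

lemma smooth_on_imp_continuous_on: "smooth_on f U \<Longrightarrow> continuous_on U f"
  unfolding smooth_on_def by (drule spec[of _ 0]) simp

lemma smooth_on_has_derivative:
  "smooth_on f U \<Longrightarrow> x \<in> U \<Longrightarrow> (f has_derivative frechet_derivative f (at x)) (at x)"
  unfolding smooth_on_def by (drule spec[of _ "Suc 0"]) (rule Ck_on_Suc_has_derivative)

lemma smooth_on_frechet_derivative:
  "smooth_on f U \<Longrightarrow> smooth_on (\<lambda>x. frechet_derivative f (at x) v) U"
  unfolding smooth_on_def by (metis Ck_on.simps(2))

section \<open>Supports, translates, products and bumps of test functions\<close>

lemma test_functions_eq_0: "f \<in> test_functions U \<Longrightarrow> x \<notin> supp f \<Longrightarrow> f x = 0"
  using closure_subset[of "{x. f x \<noteq> 0}"] by (auto simp: supp_def)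

lemma test_functionsI:
  assumes "smooth_on f UNIV" "compact K" "K \<subseteq> U" "\<And>x. x \<notin> K \<Longrightarrow> f x = 0"
  shows "f \<in> test_functions U" and "supp f \<subseteq> K"
proof -
  have "supp f \<subseteq> K"
    unfolding supp_def using assms by (intro closure_minimal compact_imp_closed) auto
  moreover have "closed (supp f)" by (simp add: supp_def)
  ultimately show "f \<in> test_functions U" "supp f \<subseteq> K"
    using assms compact_Int_closed[of K "supp f"]
    by (auto simp: test_functions_def Int_absorb1)
qed

lemma test_functions_shift:
  assumes "f \<in> test_functions U" "(\<lambda>x. x + c) ` supp f \<subseteq> V"
  shows "(\<lambda>x. f (x - c)) \<in> test_functions V"
proof (rule test_functionsI(1))
  show "smooth_on (\<lambda>x. f (x - c)) UNIV"
    using assms(1) by (auto simp: test_functions_def smooth_on_def intro!: Ck_on_shift)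
  show "compact ((\<lambda>x. x + c) ` supp f)"
    using assms by (intro compact_continuous_image continuous_intros) (auto simp: test_functions_def)
  show "f (x - c) = 0" if "x \<notin> (\<lambda>x. x + c) ` supp f" for x
  proof (rule test_functions_eq_0[OF assms(1)])
    show "x - c \<notin> supp f" using that by (metis diff_add_cancel imageI)
  qed
qed (use assms in auto)

lemma test_functions_mult_smooth:
  fixes f g :: "'a::real_normed_vector \<Rightarrow> real"
  assumes "f \<in> test_functions U" "smooth_on g UNIV"
  shows "(\<lambda>x. f x * g x) \<in> test_functions U" and "supp (\<lambda>x. f x * g x) \<subseteq> supp f"
proof -
  have "smooth_on (\<lambda>x. f x * g x) UNIV"
    using assms by (auto simp: test_functions_def smooth_on_def intro!: Ck_on_mult)
  moreover have "compact (supp f)" "supp f \<subseteq> U" using assms by (auto simp: test_functions_def)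
  ultimately show "(\<lambda>x. f x * g x) \<in> test_functions U" "supp (\<lambda>x. f x * g x) \<subseteq> supp f"
    using test_functionsI[of "\<lambda>x. f x * g x" "supp f" U] test_functions_eq_0[OF assms(1)] by auto
qed

text \<open>The classical bump exp(-1/(r^2 - |x - a|^2)), extended by 0; the squared distance keeps
  the inner function smooth at a. Compactness of the ball is a hypothesis because the type is a
  general inner product space.\<close>

lemma test_function_bump:
  fixes a :: "'a::real_inner"
  assumes "r > 0" "cball a r \<subseteq> U" "compact (cball a r)"
  obtains f :: "'a \<Rightarrow> real" where "f \<in> test_functions U" "\<And>x. f x \<ge> 0" "\<And>x. x \<in> ball a r \<Longrightarrow> f x > 0"
proof
  define q where "q = (\<lambda>x. r\<^sup>2 - (x - a) \<bullet> (x - a))"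
  have "Ck_on k q UNIV" for k
  proof (cases k)
    case 0
    then show ?thesis by (auto simp: q_def intro!: continuous_intros)
  next
    case (Suc j)
    have "(q has_derivative (\<lambda>h. (-2) * ((x - a) \<bullet> h))) (at x)" for x
      unfolding q_def by (auto intro!: derivative_eq_intros simp: inner_commute algebra_simps)
    moreover have "Ck_on j (\<lambda>x. (-2) * ((x - a) \<bullet> h)) UNIV" for h
      by (intro Ck_on_mult Ck_on_const Ck_on_shift[where f = "\<lambda>x. x \<bullet> h"]
            Ck_on_bounded_linear bounded_linear_inner_left)
    ultimately have "Ck_on (Suc j) q UNIV" by (rule Ck_on_SucI)
    then show ?thesis using Suc by (simp del: Ck_on.simps)
  qed
  then have sm: "smooth_on (\<lambda>x. flat_exp 0 (q x)) UNIV"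
    unfolding smooth_on_def by (blast intro: Ck_on_flat_exp_compose)
  have pos: "q x > 0 \<longleftrightarrow> x \<in> ball a r" for x
    using assms(1) by (auto simp: q_def dist_norm norm_minus_commute abs_le_square_iff abs_square_less_1
         power2_norm_eq_inner[symmetric] power2_less_imp_less intro: power_strict_mono)
  show "(\<lambda>x. flat_exp 0 (q x)) \<in> test_functions U"
    by (rule test_functionsI(1)[OF sm assms(3,2)]) (use pos ball_subset_cball in \<open>auto simp: flat_exp_def subset_iff\<close>)
  show "flat_exp 0 (q x) \<ge> 0" for x by (simp add: flat_exp_def)
  show "flat_exp 0 (q x) > 0" if "x \<in> ball a r" for x using that pos by (simp add: flat_exp_def)
qed

lemma test_functions_add:
  assumes "f \<in> test_functions U" "g \<in> test_functions U"
  shows "(\<lambda>x. f x + g x) \<in> test_functions U"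
proof (rule test_functionsI(1))
  show "smooth_on (\<lambda>x. f x + g x) UNIV"
    using assms by (auto simp: test_functions_def smooth_on_def intro!: Ck_on_add)
  show "compact (supp f \<union> supp g)" "supp f \<union> supp g \<subseteq> U"
    using assms by (auto simp: test_functions_def)
  show "f x + g x = 0" if "x \<notin> supp f \<union> supp g" for x
    using that assms[THEN test_functions_eq_0] by simp
qed

lemma test_functions_0: "(\<lambda>x. 0) \<in> test_functions U"
  by (rule test_functionsI(1)[of _ "{}"]) (auto simp: smooth_on_def Ck_on_const)

lemma test_functions_sum:
  "finite I \<Longrightarrow> (\<And>i. i \<in> I \<Longrightarrow> f i \<in> test_functions U) \<Longrightarrow> (\<lambda>x. \<Sum>i\<in>I. f i x) \<in> test_functions U"
  by (induction I rule: finite_induct) (auto intro: test_functions_0 test_functions_add)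

lemma test_function_pos_on_compact:
  fixes K :: "'a::euclidean_space set"
  assumes "compact K" "open U" "K \<subseteq> U"
  obtains f :: "'a \<Rightarrow> real" where "f \<in> test_functions U" "\<And>x. f x \<ge> 0" "\<And>x. x \<in> K \<Longrightarrow> f x > 0"
proof -
  have "\<exists>r f. r > 0 \<and> f \<in> test_functions U \<and> (\<forall>x. f x \<ge> 0) \<and> (\<forall>x\<in>ball a r. f x > (0::real))" if "a \<in> K" for a
  proof -
    have "a \<in> U" using that assms by auto
    then obtain r where "r > 0" "cball a r \<subseteq> U" using \<open>open U\<close> open_contains_cball by metis
    then show ?thesis using test_function_bump[of r a U] by (metis compact_cball)
  qed
  then obtain r f where rf: "\<And>a. a \<in> K \<Longrightarrow> r a > 0 \<and> f a \<in> test_functions U \<and> (\<forall>x. f a x \<ge> 0) \<and> (\<forall>x\<in>ball a (r a). f a x > (0::real))"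
    by metis
  have "K \<subseteq> (\<Union>a\<in>K. ball a (r a))" using rf by auto
  then obtain C where C: "C \<subseteq> K" "finite C" "K \<subseteq> (\<Union>a\<in>C. ball a (r a))"
    using compactE_image[OF assms(1), of K "\<lambda>a. ball a (r a)"] by auto
  show thesis
  proof
    show "(\<lambda>x. \<Sum>a\<in>C. f a x) \<in> test_functions U"
      using C rf by (intro test_functions_sum) auto
    show "(\<Sum>a\<in>C. f a x) \<ge> 0" for x using C rf by (intro sum_nonneg) auto
    show "(\<Sum>a\<in>C. f a x) > 0" if x: "x \<in> K" for x
    proof -
      obtain b where "b \<in> C" "x \<in> ball b (r b)" using C x by blast
      then show ?thesis using C rf by (intro sum_pos2[of C b]) auto
    qed
  qed
qed

section \<open>Approximation by test functions\<close>

text \<open>A substitute for mollification. The quotient of h by a bump \<open>\<eta>\<close>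
  positive on K is approximated by polynomials on the support of \<open>\<eta>\<close>, and
  multiplying back by \<open>\<eta>\<close> yields test functions. The order of quantifiers matters:
  C and K' depend only on K and U, so later estimates are uniform in h.\<close>

lemma test_function_approx:
  fixes K U :: "'a::euclidean_space set"
  assumes "compact K" "open U" "K \<subseteq> U"
  shows "\<exists>(C::real) K'. C > 0 \<and> compact K' \<and> K' \<subseteq> U \<and>
    (\<forall>(h::'a \<Rightarrow> real) B. h \<in> borel_measurable lebesgue \<and> B > 0 \<and> (\<forall>x. \<bar>h x\<bar> \<le> B) \<and> (\<forall>x. x \<notin> K \<longrightarrow> h x = 0) \<longrightarrow>
      (\<exists>\<phi>. (\<forall>n. \<phi> n \<in> test_functions U \<and> supp (\<phi> n) \<subseteq> K' \<and> (\<forall>x. \<bar>\<phi> n x\<bar> \<le> C * B)) \<and>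
          (AE x in lebesgue. (\<lambda>n. \<phi> n x) \<longlonglongrightarrow> h x)))"
proof -
  obtain \<eta> :: "'a \<Rightarrow> real" where \<eta>: "\<eta> \<in> test_functions U" "\<And>x. \<eta> x \<ge> 0" "\<And>x. x \<in> K \<Longrightarrow> \<eta> x > 0"
    using test_function_pos_on_compact[OF assms] by metis
  have cont: "continuous_on A \<eta>" for A
    using \<eta>(1) by (auto simp: test_functions_def intro: continuous_on_subset smooth_on_imp_continuous_on)
  have K': "compact (supp \<eta>)" "supp \<eta> \<subseteq> U" using \<eta>(1) by (auto simp: test_functions_def)
  obtain E where E: "E > 0" "\<And>x. \<eta> x \<le> E"
  proof -
    have "bounded (\<eta> ` supp \<eta>)" by (intro compact_imp_bounded compact_continuous_image cont K')
    then obtain E where E: "E > 0" "\<forall>x\<in>supp \<eta>. norm (\<eta> x) \<le> E" by (auto simp: bounded_pos)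
    have "\<eta> x \<le> E" for x
    proof (cases "x \<in> supp \<eta>")
      case True
      then show ?thesis using E by fastforce
    next
      case False
      then show ?thesis using E test_functions_eq_0[OF \<eta>(1)] by simp
    qed
    with E that show thesis by blast
  qed
  obtain c where c: "c > 0" "\<And>x. x \<in> K \<Longrightarrow> \<eta> x \<ge> c"
  proof (cases "K = {}")
    case False
    then obtain y where "y \<in> K" "\<forall>x\<in>K. \<eta> y \<le> \<eta> x"
      using continuous_attains_inf[OF assms(1) _ cont] by blast
    then show thesis using that[of "\<eta> y"] \<eta>(3) by auto
  qed (use that[of 1] in auto)
  \<comment> \<open>E bounds \<open>\<eta>\<close> from above and c bounds it from below on K, so h
    / \<open>\<eta>\<close> is at most B / c; the factor 2 leaves room for the polynomial
    error.\<close>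
  show ?thesis
  proof (intro exI[of _ "2 * E / c"] exI[of _ "supp \<eta>"] conjI allI impI)
    fix h :: "'a \<Rightarrow> real" and B :: real
    assume "h \<in> borel_measurable lebesgue \<and> B > 0 \<and> (\<forall>x. \<bar>h x\<bar> \<le> B) \<and> (\<forall>x. x \<notin> K \<longrightarrow> h x = 0)"
    then have h: "h \<in> borel_measurable lebesgue" "B > 0" "\<And>x. \<bar>h x\<bar> \<le> B" "\<And>x. x \<notin> K \<Longrightarrow> h x = 0"
      by auto
    define f where "f x = h x / \<eta> x" for x
    have f_bound: "\<bar>f x\<bar> \<le> B / c" for x
    proof (cases "x \<in> K")
      case True
      then show ?thesis using h(2) h(3)[of x] c \<eta>(3)[of x] by (auto simp: f_def intro!: frac_le)
    next
      case False
      then show ?thesis using h c by (simp add: f_def)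
    qed
    have \<eta>f: "\<eta> x * f x = h x" for x
      using h(4)[of x] \<eta>(3)[of x] by (cases "x \<in> K") (auto simp: f_def)
    have [measurable]: "\<eta> \<in> borel_measurable lebesgue"
      using borel_measurable_continuous_onI[OF cont] by (simp add: measurable_completion)
    have "f \<in> borel_measurable lebesgue" unfolding f_def using h(1) by measurable
    then have "f measurable_on UNIV"
      by (intro lebesgue_measurable_imp_measurable_on) auto
    then obtain N g where g: "negligible N" "\<And>n. continuous_on UNIV (g n)"
        "\<And>x. x \<notin> N \<Longrightarrow> (\<lambda>n. g n x) \<longlonglongrightarrow> f x"
      unfolding measurable_on_def by auto
    \<comment> \<open>The continuous approximants \<open>g n\<close> carry no uniform bound.
      Truncating at B / c restores one and leaves the limit f unchanged, since f obeys the same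
      bound.\<close>
    define k where "k n x = max (- (B / c)) (min (B / c) (g n x))" for n x
    \<comment> \<open>The tolerance is at most B / c for every n, which gives the uniform bound 2 *
      (B / c), and it tends to 0, which keeps the limit.\<close>
    have "\<exists>p. real_polynomial_function p \<and> (\<forall>x\<in>supp \<eta>. \<bar>k n x - p x\<bar> < B / c / Suc n)" for n
    proof -
      have "continuous_on (supp \<eta>) (k n)" unfolding k_def
        by (intro continuous_intros continuous_on_subset[OF g(2)]) auto
      moreover have "0 < B / c / Suc n" using h(2) c by simp
      ultimately show ?thesis
        using Stone_Weierstrass_real_polynomial_function[OF K'(1)] by metis
    qed
    then obtain p where p: "\<And>n. real_polynomial_function (p n)"
       "\<And>n x. x \<in> supp \<eta> \<Longrightarrow> \<bar>k n x - p n x\<bar> < B / c / Suc n" by metis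
    have "smooth_on (p n) UNIV" for n
      using p(1) Ck_on_real_polynomial_function by (auto simp: smooth_on_def)
    note test = test_functions_mult_smooth[OF \<eta>(1) this]
    have "\<bar>\<eta> x * p n x\<bar> \<le> 2 * E / c * B" for n x
    proof (cases "x \<in> supp \<eta>")
      case True
      have "0 \<le> B / c" using h(2) c by simp
      then have "\<bar>k n x\<bar> \<le> B / c" by (auto simp: k_def abs_le_iff min_def max_def)
      moreover have "B / c / Suc n \<le> B / c / 1" using h(2) c by (intro divide_left_mono) auto
      ultimately have "\<bar>p n x\<bar> \<le> 2 * (B / c)" using p(2)[OF True, of n] by linarith
      then have "\<bar>\<eta> x\<bar> * \<bar>p n x\<bar> \<le> E * (2 * (B / c))"
        using E \<eta>(2) by (intro mult_mono) auto
      then show ?thesis by (simp add: abs_mult mult_ac)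
    next
      case False
      then show ?thesis using E c h(2) test_functions_eq_0[OF \<eta>(1)] by simp
    qed
    moreover have "(\<lambda>n. \<eta> x * p n x) \<longlonglongrightarrow> h x" if "x \<notin> N" for x
    proof (cases "x \<in> supp \<eta>")
      case True
      have "(\<lambda>n. k n x) \<longlonglongrightarrow> max (- (B / c)) (min (B / c) (f x))"
        unfolding k_def using g(3)[OF that] by (intro tendsto_intros)
      moreover have "max (- (B / c)) (min (B / c) (f x)) = f x"
        using f_bound[of x] by (simp add: abs_le_iff min_def max_def)
      moreover have "(\<lambda>n. p n x - k n x) \<longlonglongrightarrow> 0"
      proof (rule Lim_null_comparison)
        show "(\<lambda>n. B / c / Suc n) \<longlonglongrightarrow> 0" by (rule LIMSEQ_Suc[OF lim_const_over_n])
        show "\<forall>\<^sub>F n in sequentially. norm (p n x - k n x) \<le> B / c / Suc n"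
          using p(2)[OF True] by (intro always_eventually) (auto simp: abs_minus_commute less_imp_le)
      qed
      ultimately have "(\<lambda>n. (p n x - k n x) + k n x) \<longlonglongrightarrow> 0 + f x" by (intro tendsto_add) auto
      then have "(\<lambda>n. \<eta> x * p n x) \<longlonglongrightarrow> \<eta> x * f x" by (intro tendsto_intros) auto
      then show ?thesis by (simp add: \<eta>f)
    next
      case False
      then show ?thesis using \<eta>f[of x] test_functions_eq_0[OF \<eta>(1)] by simp
    qed
    then have "AE x in lebesgue. (\<lambda>n. \<eta> x * p n x) \<longlonglongrightarrow> h x"
      using g(1) by (intro AE_I'[of N]) (auto simp: negligible_iff_null_sets)
    ultimately show "\<exists>\<phi>. (\<forall>n. \<phi> n \<in> test_functions U \<and> supp (\<phi> n) \<subseteq> supp \<eta> \<and> (\<forall>x. \<bar>\<phi> n x\<bar> \<le> 2 * E / c * B)) \<and>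
          (AE x in lebesgue. (\<lambda>n. \<phi> n x) \<longlonglongrightarrow> h x)"
      using test by (intro exI[of _ "\<lambda>n x. \<eta> x * p n x"]) auto
  qed (use E c K' in auto)
qed

lemma test_functions_imp_measurable:
  fixes f :: "'a::euclidean_space \<Rightarrow> real"
  assumes "f \<in> test_functions U"
  shows "f \<in> borel_measurable borel" and "f \<in> borel_measurable lebesgue"
proof -
  show "f \<in> borel_measurable borel"
    using assms by (auto simp: test_functions_def intro!: borel_measurable_continuous_onI smooth_on_imp_continuous_on)
  then show "f \<in> borel_measurable lebesgue" by (simp add: measurable_completion)
qed

lemma test_functions_bounded:
  fixes f :: "'a::euclidean_space \<Rightarrow> 'b::real_normed_vector"
  assumes "f \<in> test_functions U"
  obtains B where "B > 0" "\<And>x. norm (f x) \<le> B"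
proof -
  have "continuous_on (supp f) f"
    using assms by (auto simp: test_functions_def intro: continuous_on_subset smooth_on_imp_continuous_on)
  then have "bounded (f ` supp f)"
    using assms by (intro compact_imp_bounded compact_continuous_image) (auto simp: test_functions_def)
  then obtain B where B: "B > 0" "\<forall>x\<in>supp f. norm (f x) \<le> B" by (auto simp: bounded_pos)
  have "norm (f x) \<le> B" for x
    using B test_functions_eq_0[OF assms, of x] by (cases "x \<in> supp f") auto
  with B that show thesis by blast
qed

lemma integrable_indicator_compact:
  fixes K :: "'a::euclidean_space set"
  assumes "compact K"
  shows "integrable lebesgue (indicator K :: 'a \<Rightarrow> real)"
  using fmeasurableD2[OF lmeasurable_compact[OF assms]] fmeasurableD[OF lmeasurable_compact[OF assms]]
  by (intro integrable_real_indicator) (auto simp: top.not_eq_extremum)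

text \<open>Testing f with bounded approximations of its sign on a compact set K gives, in the
  limit, that |f| has integral 0 over K. Domination by C * |f| on K' explains why local
  integrability suffices.\<close>

lemma fundamental_lemma_of_variations:
  fixes f :: "'a::euclidean_space \<Rightarrow> real"
  assumes "open U" and int: "\<And>K. compact K \<Longrightarrow> K \<subseteq> U \<Longrightarrow> integrable (lebesgue_on K) f"
    and zero: "\<And>\<phi>. \<phi> \<in> test_functions U \<Longrightarrow> (LINT x|lebesgue_on U. f x * \<phi> x) = 0"
  shows "AE x in lebesgue_on U. f x = 0"
proof -
  have int': "integrable lebesgue (\<lambda>x. indicator K x * f x)" if "compact K" "K \<subseteq> U" for K
    using int[OF that] that by (simp add: integrable_restrict_space lmeasurable_compact fmeasurableD)
  have "AE x in lebesgue. x \<in> K \<longrightarrow> f x = 0" if K: "compact K" "K \<subseteq> U" for K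
  proof -
    obtain C :: real and K' where *: "C > 0" "compact K'" "K' \<subseteq> U"
    "\<forall>h B. h \<in> borel_measurable lebesgue \<and> B > 0 \<and> (\<forall>x. \<bar>h x\<bar> \<le> B) \<and> (\<forall>x. x \<notin> K \<longrightarrow> h x = 0) \<longrightarrow>
      (\<exists>\<phi>. (\<forall>n. \<phi> n \<in> test_functions U \<and> supp (\<phi> n) \<subseteq> K' \<and> (\<forall>x. \<bar>\<phi> n x\<bar> \<le> C * B)) \<and>
          (AE x in lebesgue. (\<lambda>n. \<phi> n x) \<longlonglongrightarrow> (h x :: real)))"
      using test_function_approx[OF K(1) \<open>open U\<close> K(2)] by (elim exE conjE) (rule that)
    have m[measurable]: "(\<lambda>x. indicator K x * f x) \<in> borel_measurable lebesgue"
       "(\<lambda>x. indicator K' x * f x) \<in> borel_measurable lebesgue"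
      using int'[OF K] int'[OF *(2,3)] by auto
    obtain \<phi> where \<phi>: "\<And>n. \<phi> n \<in> test_functions U" "\<And>n. supp (\<phi> n) \<subseteq> K'" "\<And>n x. \<bar>\<phi> n x\<bar> \<le> C"
        "AE x in lebesgue. (\<lambda>n. \<phi> n x) \<longlonglongrightarrow> sgn (indicator K x * f x)"
    proof -
      have "(\<lambda>x. sgn (indicator K x * f x)) \<in> borel_measurable lebesgue"
        unfolding sgn_if by measurable
      then show thesis
        using that *(4)[rule_format, of "\<lambda>x. sgn (indicator K x * f x)" 1] by (auto simp: abs_sgn_eq)
    qed
    note [measurable] = test_functions_imp_measurable(2)[OF \<phi>(1)]
    have "(\<lambda>n. LINT x|lebesgue. (indicator K' x * f x) * \<phi> n x) \<longlonglongrightarrow>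
        (LINT x|lebesgue. (indicator K' x * f x) * sgn (indicator K x * f x))"
    proof (rule integral_dominated_convergence[where w = "\<lambda>x. C * \<bar>indicator K' x * f x\<bar>"])
      show "AE x in lebesgue. (\<lambda>n. indicator K' x * f x * \<phi> n x) \<longlonglongrightarrow> indicator K' x * f x * sgn (indicator K x * f x)"
        using \<phi>(4) by eventually_elim (auto intro: tendsto_intros)
      show "AE x in lebesgue. norm (indicator K' x * f x * \<phi> n x) \<le> C * \<bar>indicator K' x * f x\<bar>" for n
        using \<phi>(3)[of n] by (simp add: abs_mult mult.commute[of _ "\<bar>\<phi> n _\<bar>"] mult_right_mono)
    qed (use int'[OF *(2,3)] in auto)
    moreover have "(LINT x|lebesgue. (indicator K' x * f x) * \<phi> n x) = 0" for n
    proof -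
      have "(LINT x|lebesgue. (indicator K' x * f x) * \<phi> n x) = (LINT x|lebesgue_on U. f x * \<phi> n x)"
      proof -
        have "indicator K' x * f x * \<phi> n x = indicator U x *\<^sub>R (f x * \<phi> n x)" for x
          using *(3) \<phi>(2)[of n] test_functions_eq_0[OF \<phi>(1)[of n], of x]
          by (cases "x \<in> supp (\<phi> n)") (auto simp: indicator_def)
        then have "(LINT x|lebesgue. (indicator K' x * f x) * \<phi> n x) = (LINT x|lebesgue. indicator U x *\<^sub>R (f x * \<phi> n x))"
          by presburger
        then show ?thesis using \<open>open U\<close> by (simp add: integral_restrict_space)
      qed
      then show ?thesis using zero[OF \<phi>(1)] by simp
    qed
    moreover have "(LINT x|lebesgue. (indicator K' x * f x) * sgn (indicator K x * f x))
        = (LINT x|lebesgue. \<bar>indicator K x * f x\<bar>)"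
    proof (rule integral_cong_AE)
      \<comment> \<open>That K lies inside K' is not among the facts obtained from
        \<open>test_function_approx\<close>. The vanishing of the sign off K' is instead read off
        from the limit, as every \<open>\<phi> n\<close> vanishes there.\<close>
      have "AE x in lebesgue. x \<notin> K' \<longrightarrow> sgn (indicator K x * f x) = 0"
        using \<phi>(4)
      proof eventually_elim
        case (elim x)
        show ?case
        proof
          assume "x \<notin> K'"
          then have "\<phi> n x = 0" for n using test_functions_eq_0[OF \<phi>(1)] \<phi>(2) by blast
          with elim show "sgn (indicator K x * f x) = 0" by (simp add: LIMSEQ_const_iff)
        qed
      qed
      then show "AE x in lebesgue. indicator K' x * f x * sgn (indicator K x * f x) = \<bar>indicator K x * f x\<bar>"
        by eventually_elim (auto simp: indicator_def sgn_if split: if_splits)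
    qed measurable
    ultimately have "(LINT x|lebesgue. \<bar>indicator K x * f x\<bar>) = 0"
      by (simp only: LIMSEQ_const_iff)
    then have "AE x in lebesgue. \<bar>indicator K x * f x\<bar> = 0"
      using int'[OF K] by (subst (asm) integral_nonneg_eq_0_iff_AE) auto
    then show ?thesis by eventually_elim auto
  qed
  moreover obtain D :: "nat \<Rightarrow> 'a set" where D: "\<And>n. compact (D n)" "\<And>n. D n \<subseteq> U" "\<Union>(range D) = U"
    using open_Union_compact_subsets[OF \<open>open U\<close>] by metis
  ultimately have "AE x in lebesgue. \<forall>n. x \<in> D n \<longrightarrow> f x = 0"
    by (subst AE_all_countable) auto
  then have "AE x in lebesgue. x \<in> U \<longrightarrow> f x = 0"
    unfolding D(3)[symmetric] by eventually_elim auto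
  then show ?thesis using \<open>open U\<close> by (subst AE_restrict_space_iff) auto
qed

lemma add_square_le: "((a::real) + b)\<^sup>2 \<le> 2 * a\<^sup>2 + 2 * b\<^sup>2"
  using sum_squares_bound[of a b] by (simp add: power2_sum)

text \<open>Discarding the values of G above a height reduces the claim to bounded functions, where
  almost everywhere approximation with a uniform bound and a common compact support gives
  convergence in the mean by domination.\<close>

lemma test_functions_dense_L2:
  fixes G :: "'a::euclidean_space \<Rightarrow> real"
  assumes "open U" "compact K" "K \<subseteq> U"
    and [measurable]: "G \<in> borel_measurable lebesgue" and int: "integrable lebesgue (\<lambda>x. (G x)\<^sup>2)"
    and G0: "\<And>x. x \<notin> K \<Longrightarrow> G x = 0" and "e > 0"
  obtains \<phi> where "\<phi> \<in> test_functions U" "integrable lebesgue (\<lambda>x. (G x - \<phi> x)\<^sup>2)"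
    "(LINT x|lebesgue. (G x - \<phi> x)\<^sup>2) < e"
proof -
  define T where "T m x = (if \<bar>G x\<bar> \<le> real m then G x else 0)" for m :: nat and x
  have [measurable]: "T m \<in> borel_measurable lebesgue" for m unfolding T_def by measurable
  have "(\<lambda>m. LINT x|lebesgue. (G x - T m x)\<^sup>2) \<longlonglongrightarrow> (LINT x|(lebesgue :: 'a measure). 0 :: real)"
  proof (rule integral_dominated_convergence[where w = "\<lambda>x. (G x)\<^sup>2"])
    show "AE x in lebesgue. (\<lambda>m. (G x - T m x)\<^sup>2) \<longlonglongrightarrow> 0"
    proof (rule AE_I2, rule tendsto_eventually)
      fix x
      obtain m0 where "\<bar>G x\<bar> \<le> real m0" using real_arch_simple by blast
      then show "\<forall>\<^sub>F m in sequentially. (G x - T m x)\<^sup>2 = 0"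
        by (intro eventually_mono[OF eventually_ge_at_top[of m0]]) (auto simp: T_def)
    qed
  qed (auto simp: T_def int)
  \<comment> \<open>A quarter of e, because each of the two squared errors is doubled by
    \<open>add_square_le\<close> at the end.\<close>
  then have "\<forall>\<^sub>F m in sequentially. (LINT x|lebesgue. (G x - T m x)\<^sup>2) < e / 4"
    using \<open>e > 0\<close> by (intro order_tendstoD(2)[of _ 0]) auto
  then obtain m where "\<forall>n\<ge>m. (LINT x|lebesgue. (G x - T n x)\<^sup>2) < e / 4"
    unfolding eventually_sequentially by blast
  \<comment> \<open>\<open>Suc m\<close> in place of \<open>m\<close>, as
    \<open>test_function_approx\<close> demands a strictly positive bound.\<close>
  then have m: "(LINT x|lebesgue. (G x - T (Suc m) x)\<^sup>2) < e / 4" by simp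
  have intT: "integrable lebesgue (\<lambda>x. (G x - T (Suc m) x)\<^sup>2)"
    by (rule Bochner_Integration.integrable_bound[OF int]) (auto simp: T_def)
  obtain C :: real and K' where *: "C > 0" "compact K'" "K' \<subseteq> U"
    "\<forall>h B. h \<in> borel_measurable lebesgue \<and> B > 0 \<and> (\<forall>x. \<bar>h x\<bar> \<le> B) \<and> (\<forall>x. x \<notin> K \<longrightarrow> h x = 0) \<longrightarrow>
      (\<exists>\<phi>. (\<forall>n. \<phi> n \<in> test_functions U \<and> supp (\<phi> n) \<subseteq> K' \<and> (\<forall>x. \<bar>\<phi> n x\<bar> \<le> C * B)) \<and>
          (AE x in lebesgue. (\<lambda>n. \<phi> n x) \<longlonglongrightarrow> (h x :: real)))"
    using test_function_approx[OF assms(2,1,3)] by (elim exE conjE) (rule that)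
  obtain \<phi> where \<phi>: "\<And>n. \<phi> n \<in> test_functions U" "\<And>n. supp (\<phi> n) \<subseteq> K'" "\<And>n x. \<bar>\<phi> n x\<bar> \<le> C * Suc m"
      "AE x in lebesgue. (\<lambda>n. \<phi> n x) \<longlonglongrightarrow> T (Suc m) x"
  proof -
    have "\<bar>T (Suc m) x\<bar> \<le> Suc m" for x by (simp add: T_def)
    moreover have "x \<notin> K \<longrightarrow> T (Suc m) x = 0" for x using G0 by (simp add: T_def)
    ultimately have "\<exists>\<phi>. (\<forall>n. \<phi> n \<in> test_functions U \<and> supp (\<phi> n) \<subseteq> K' \<and> (\<forall>x. \<bar>\<phi> n x\<bar> \<le> C * Suc m)) \<and>
          (AE x in lebesgue. (\<lambda>n. \<phi> n x) \<longlonglongrightarrow> T (Suc m) x)"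
      using *(4)[THEN spec, THEN spec, of "T (Suc m)" "real (Suc m)"] by simp
    then show thesis using that by blast
  qed
  note [measurable] = test_functions_imp_measurable(2)[OF \<phi>(1)]
  define w :: "'a \<Rightarrow> real" where "w x = 2 * (indicator K' x * (C * Suc m)\<^sup>2) + 2 * (indicator K x * (real (Suc m))\<^sup>2)" for x
  have w: "integrable lebesgue w"
    unfolding w_def using assms(2) *(2)
    by (intro Bochner_Integration.integrable_add integrable_mult_right integrable_mult_left integrable_indicator_compact)
  have bound: "(T (Suc m) x - \<phi> n x)\<^sup>2 \<le> w x" for n x
  proof -
    have "(T (Suc m) x - \<phi> n x)\<^sup>2 \<le> 2 * (T (Suc m) x)\<^sup>2 + 2 * (\<phi> n x)\<^sup>2"
      using add_square_le[of "T (Suc m) x" "- \<phi> n x"] by simp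
    moreover have "(T (Suc m) x)\<^sup>2 \<le> indicator K x * (real (Suc m))\<^sup>2"
      using G0[of x] by (cases "x \<in> K") (auto simp: T_def simp flip: abs_le_square_iff)
    moreover have "(\<phi> n x)\<^sup>2 \<le> indicator K' x * (C * Suc m)\<^sup>2"
    proof (cases "x \<in> K'")
      case True
      then show ?thesis using \<phi>(3)[of n x] *(1) by (auto simp flip: abs_le_square_iff simp: abs_mult)
    next
      case False
      then show ?thesis using test_functions_eq_0[OF \<phi>(1)[of n], of x] \<phi>(2)[of n] by auto
    qed
    ultimately show ?thesis by (simp add: w_def)
  qed
  have "(\<lambda>n. LINT x|lebesgue. (T (Suc m) x - \<phi> n x)\<^sup>2) \<longlonglongrightarrow> (LINT x|(lebesgue :: 'a measure). 0 :: real)"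
  proof (rule integral_dominated_convergence[where w = w])
    show "AE x in lebesgue. (\<lambda>n. (T (Suc m) x - \<phi> n x)\<^sup>2) \<longlonglongrightarrow> 0"
      using \<phi>(4)
    proof eventually_elim
      case (elim x)
      then have "(\<lambda>n. (T (Suc m) x - \<phi> n x)\<^sup>2) \<longlonglongrightarrow> (T (Suc m) x - T (Suc m) x)\<^sup>2"
        by (intro tendsto_intros)
      then show ?case by simp
    qed
  qed (use bound w in auto)
  then have "\<forall>\<^sub>F n in sequentially. (LINT x|lebesgue. (T (Suc m) x - \<phi> n x)\<^sup>2) < e / 4"
    using \<open>e > 0\<close> by (intro order_tendstoD(2)[of _ 0]) auto
  then obtain n where n: "(LINT x|lebesgue. (T (Suc m) x - \<phi> n x)\<^sup>2) < e / 4"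
    unfolding eventually_sequentially by blast
  have intphi: "integrable lebesgue (\<lambda>x. (T (Suc m) x - \<phi> n x)\<^sup>2)"
    by (rule Bochner_Integration.integrable_bound[OF w]) (use bound in \<open>auto intro: order_trans[OF _ abs_ge_self]\<close>)
  have bd: "(G x - \<phi> n x)\<^sup>2 \<le> 2 * (G x - T (Suc m) x)\<^sup>2 + 2 * (T (Suc m) x - \<phi> n x)\<^sup>2" for x
    using add_square_le[of "G x - T (Suc m) x" "T (Suc m) x - \<phi> n x"] by simp
  have int2: "integrable lebesgue (\<lambda>x. 2 * (G x - T (Suc m) x)\<^sup>2 + 2 * (T (Suc m) x - \<phi> n x)\<^sup>2)"
    using intT intphi by auto
  have int3: "integrable lebesgue (\<lambda>x. (G x - \<phi> n x)\<^sup>2)"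
    by (rule Bochner_Integration.integrable_bound[OF int2]) (use bd in auto)
  have "(LINT x|lebesgue. (G x - \<phi> n x)\<^sup>2)
      \<le> (LINT x|lebesgue. 2 * (G x - T (Suc m) x)\<^sup>2 + 2 * (T (Suc m) x - \<phi> n x)\<^sup>2)"
    by (rule integral_mono[OF int3 int2]) (rule bd)
  also have "\<dots> < e" using m n intT intphi by simp
  finally show thesis using that \<phi>(1) int3 by blast
qed

section \<open>Translations of functions with a weak gradient\<close>

lemma test_functions_frechet_derivative:
  fixes f :: "'a::real_normed_vector \<Rightarrow> 'b::real_normed_vector"
  assumes "f \<in> test_functions U"
  shows "(\<lambda>x. frechet_derivative f (at x) v) \<in> test_functions U"
proof (rule test_functionsI(1))
  show "smooth_on (\<lambda>x. frechet_derivative f (at x) v) UNIV"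
    using assms by (auto simp: test_functions_def intro: smooth_on_frechet_derivative)
  show "compact (supp f)" "supp f \<subseteq> U" using assms by (auto simp: test_functions_def)
  show "frechet_derivative f (at x) v = 0" if "x \<notin> supp f" for x
  proof -
    have "(f has_derivative (\<lambda>_. 0)) (at x)"
    proof (rule has_derivative_transform_within_open[of "\<lambda>_. 0" _ x UNIV "- supp f"])
      show "open (- supp f)" unfolding supp_def by (rule open_Compl) simp
    qed (use that test_functions_eq_0[OF assms] in auto)
    then have "frechet_derivative f (at x) = (\<lambda>_. 0)" using frechet_derivative_at by metis
    then show ?thesis by simp
  qed
qed

lemma test_function_line_derivative:
  fixes \<phi> :: "'a::euclidean_space \<Rightarrow> real"
  assumes "\<phi> \<in> test_functions U"
  shows "((\<lambda>t. \<phi> (x - t *\<^sub>R h)) has_real_derivative - frechet_derivative \<phi> (at (x - t *\<^sub>R h)) h) (at t)"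
proof -
  have d: "(\<phi> has_derivative frechet_derivative \<phi> (at y)) (at y)" for y
    using assms by (auto simp: test_functions_def intro: smooth_on_has_derivative)
  have "((\<lambda>t. x - t *\<^sub>R h) has_derivative (\<lambda>s. - (s *\<^sub>R h))) (at t)"
    by (auto intro!: derivative_eq_intros)
  from has_derivative_compose[OF this d]
  have "((\<lambda>t. \<phi> (x - t *\<^sub>R h)) has_derivative (\<lambda>s. frechet_derivative \<phi> (at (x - t *\<^sub>R h)) (- (s *\<^sub>R h)))) (at t)" .
  moreover have "linear (frechet_derivative \<phi> (at (x - t *\<^sub>R h)))"
    using d has_derivative_linear by blast
  then have "(\<lambda>s. frechet_derivative \<phi> (at (x - t *\<^sub>R h)) (- (s *\<^sub>R h))) = (*) (- frechet_derivative \<phi> (at (x - t *\<^sub>R h)) h)"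
    by (auto simp: linear_neg linear_scale)
  ultimately show ?thesis by (simp add: has_field_derivative_def)
qed

lemma integral_lborel_translation:
  fixes f :: "'a::euclidean_space \<Rightarrow> 'b::{banach, second_countable_topology}"
  assumes [measurable]: "f \<in> borel_measurable borel"
  shows "(LINT x|lborel. f (x + c)) = (LINT x|lborel. f x)"
    and "integrable lborel (\<lambda>x. f (x + c)) \<longleftrightarrow> integrable lborel f"
proof -
  have "(LINT x|lborel. f x) = (LINT x|distr lborel borel ((+) c). f x)"
    by (simp add: lborel_distr_plus)
  also have "\<dots> = (LINT x|lborel. f (x + c))"
    by (subst integral_distr) (auto simp: add.commute)
  finally show "(LINT x|lborel. f (x + c)) = (LINT x|lborel. f x)" by simp
  have "integrable lborel f \<longleftrightarrow> integrable (distr lborel borel ((+) c)) f"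
    by (simp add: lborel_distr_plus)
  also have "\<dots> \<longleftrightarrow> integrable lborel (\<lambda>x. f (x + c))"
    by (subst integrable_distr_eq) (auto simp: add.commute)
  finally show "integrable lborel (\<lambda>x. f (x + c)) \<longleftrightarrow> integrable lborel f" by simp
qed

text \<open>Stated for functions on the whole space and for \<open>lborel\<close>, so that
  translation invariance and Tonelli apply directly. Integrability is global while the weak identity
  is tested only inside V; this admits functions extended by zero, whose jump outside V does not
  matter.\<close>

definition weak_grad_L1 :: "'a::euclidean_space set \<Rightarrow> ('a \<Rightarrow> real) \<Rightarrow> ('a \<Rightarrow> 'a) \<Rightarrow> bool" where
  "weak_grad_L1 V w D \<longleftrightarrow> integrable lborel w \<and> integrable lborel D \<and>
     (\<forall>\<phi>\<in>test_functions V. \<forall>h.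
       (LINT x|lborel. w x * frechet_derivative \<phi> (at x) h) = - (LINT x|lborel. (D x \<bullet> h) * \<phi> x))"

text \<open>The translation acts on \<open>\<phi>\<close>, never on w. The function F t, the
  integral of w against \<open>\<phi> (x - t *\<^sub>R h)\<close>, is differentiable, the weak
  identity turns its derivative into an integral of D against the translated \<open>\<phi>\<close>,
  and the mean value theorem on [0,1] gives the difference.\<close>

lemma weak_translation_estimate:
  fixes w :: "'a::euclidean_space \<Rightarrow> real"
  assumes wD: "weak_grad_L1 V w D"
    and \<phi>: "\<phi> \<in> test_functions U" and C: "\<And>x. \<bar>\<phi> x\<bar> \<le> C"
    and K': "K' \<subseteq> V" "K' \<in> sets borel"
      "\<And>x t. x \<in> supp \<phi> \<Longrightarrow> 0 \<le> t \<Longrightarrow> t \<le> 1 \<Longrightarrow> x + t *\<^sub>R h \<in> K'"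
  shows "\<bar>(LINT x|lborel. w x * \<phi> (x - h)) - (LINT x|lborel. w x * \<phi> x)\<bar>
      \<le> C * norm h * (LINT x|lborel. indicator K' x * norm (D x))"
proof -
  have w: "integrable lborel w" and D: "integrable lborel D"
    and weak: "\<And>\<phi> h. \<phi> \<in> test_functions V \<Longrightarrow>
       (LINT x|lborel. w x * frechet_derivative \<phi> (at x) h) = - (LINT x|lborel. (D x \<bullet> h) * \<phi> x)"
    using wD by (auto simp: weak_grad_L1_def)
  note [measurable] = borel_measurable_integrable[OF w] borel_measurable_integrable[OF D]
    test_functions_imp_measurable(1)[OF \<phi>] K'(2)
  define d where "d y = frechet_derivative \<phi> (at y) h" for y
  have d: "d \<in> test_functions U" unfolding d_def by (rule test_functions_frechet_derivative[OF \<phi>])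
  note [measurable] = test_functions_imp_measurable(1)[OF d]
  obtain L where L: "L > 0" "\<And>y. \<bar>d y\<bar> \<le> L" using test_functions_bounded[OF d] by (metis real_norm_def)
  define F where "F t = (LINT x|lborel. w x * \<phi> (x - t *\<^sub>R h))" for t
  define F' where "F' t = (LINT x|lborel. w x * - d (x - t *\<^sub>R h))" for t
  have int: "integrable lborel (\<lambda>x. w x * \<phi> (x - t *\<^sub>R h))" for t
    by (rule Bochner_Integration.integrable_bound[OF integrable_mult_left[OF w, of C]])
       (use C in \<open>auto simp: abs_mult intro!: mult_left_mono order_trans[OF C]\<close>)
  \<comment> \<open>The Lipschitz bound dominates the difference quotients of \<open>\<phi>\<close>
    along the line and so permits differentiation under the integral.\<close>
  have lip: "\<bar>\<phi> (x - (t + s) *\<^sub>R h) - \<phi> (x - t *\<^sub>R h)\<bar> \<le> L * \<bar>s\<bar>" for x t s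
  proof -
    have "norm (\<phi> (x - (t + s) *\<^sub>R h) - \<phi> (x - t *\<^sub>R h)) \<le> L * norm (t + s - t)"
      by (rule field_differentiable_bound[of UNIV "\<lambda>t. \<phi> (x - t *\<^sub>R h)" "\<lambda>t. - d (x - t *\<^sub>R h)"])
         (use L test_function_line_derivative[OF \<phi>] in \<open>auto simp: d_def\<close>)
    then show ?thesis by simp
  qed
  have deriv: "(F has_real_derivative F' t) (at t)" for t
    unfolding DERIV_def tendsto_at_iff_sequentially
  proof (intro allI impI)
    fix X :: "nat \<Rightarrow> real" assume X: "\<forall>i. X i \<in> UNIV - {0}" "X \<longlonglongrightarrow> 0"
    have "(\<lambda>i. LINT x|lborel. w x * ((\<phi> (x - (t + X i) *\<^sub>R h) - \<phi> (x - t *\<^sub>R h)) / X i)) \<longlonglongrightarrow> F' t"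
      unfolding F'_def
    proof (rule integral_dominated_convergence[where w = "\<lambda>x. \<bar>w x\<bar> * L"])
      show "AE x in lborel. norm (w x * ((\<phi> (x - (t + X i) *\<^sub>R h) - \<phi> (x - t *\<^sub>R h)) / X i)) \<le> \<bar>w x\<bar> * L" for i
      proof (rule AE_I2)
        fix x
        have "\<bar>(\<phi> (x - (t + X i) *\<^sub>R h) - \<phi> (x - t *\<^sub>R h)) / X i\<bar> \<le> L"
          using lip[of x t "X i"] X(1) by (simp add: divide_le_eq)
        then show "norm (w x * ((\<phi> (x - (t + X i) *\<^sub>R h) - \<phi> (x - t *\<^sub>R h)) / X i)) \<le> \<bar>w x\<bar> * L"
          unfolding real_norm_def abs_mult by (rule mult_left_mono) simp
      qed
      show "AE x in lborel. (\<lambda>i. w x * ((\<phi> (x - (t + X i) *\<^sub>R h) - \<phi> (x - t *\<^sub>R h)) / X i)) \<longlonglongrightarrow> w x * - d (x - t *\<^sub>R h)"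
      proof (intro AE_I2 tendsto_mult tendsto_const)
        fix x
        show "(\<lambda>i. (\<phi> (x - (t + X i) *\<^sub>R h) - \<phi> (x - t *\<^sub>R h)) / X i) \<longlonglongrightarrow> - d (x - t *\<^sub>R h)"
          using test_function_line_derivative[OF \<phi>, of x h t] X
          unfolding DERIV_def tendsto_at_iff_sequentially d_def by (auto simp: o_def)
      qed
    qed (use w in auto)
    also have "(\<lambda>i. LINT x|lborel. w x * ((\<phi> (x - (t + X i) *\<^sub>R h) - \<phi> (x - t *\<^sub>R h)) / X i))
       = ((\<lambda>h. (F (t + h) - F t) / h) \<circ> X)"
      unfolding F_def o_def
      by (subst Bochner_Integration.integral_diff[OF int int, symmetric])
         (auto simp: algebra_simps diff_divide_distrib simp flip: integral_divide_zero)
    finally show "((\<lambda>h. (F (t + h) - F t) / h) \<circ> X) \<longlonglongrightarrow> F' t" .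
  qed
  \<comment> \<open>For t between 0 and 1 the translate \<open>\<psi>\<close> is supported in K' and
    hence in V, so the weak identity applies and only the values of D on K' enter.\<close>
  have bound: "\<bar>F' t\<bar> \<le> C * norm h * (LINT x|lborel. indicator K' x * norm (D x))" if t: "0 \<le> t" "t \<le> 1" for t
  proof -
    have sub: "(\<lambda>x. x + t *\<^sub>R h) ` supp \<phi> \<subseteq> K'" using K'(3) t by auto
    define \<psi> where "\<psi> x = \<phi> (x - t *\<^sub>R h)" for x
    have \<psi>: "\<psi> \<in> test_functions V"
      unfolding \<psi>_def using test_functions_shift[OF \<phi>] sub K'(1) by blast
    have \<psi>0: "\<psi> x = 0" if "x \<notin> K'" for x
    proof -
      have "x - t *\<^sub>R h \<notin> supp \<phi>" using that sub by (metis diff_add_cancel imageI subsetD)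
      then show ?thesis unfolding \<psi>_def by (rule test_functions_eq_0[OF \<phi>])
    qed
    have "frechet_derivative \<psi> (at x) h = d (x - t *\<^sub>R h)" for x
    proof -
      have "(\<psi> has_derivative frechet_derivative \<phi> (at (x - t *\<^sub>R h))) (at x)"
        unfolding \<psi>_def
        by (rule has_derivative_compose[of "\<lambda>x. x - t *\<^sub>R h" "\<lambda>h. h" x UNIV \<phi>, simplified])
           (use \<phi> in \<open>auto intro!: derivative_eq_intros smooth_on_has_derivative simp: test_functions_def\<close>)
      then show ?thesis unfolding d_def using frechet_derivative_at by metis
    qed
    then have "F' t = (LINT x|lborel. (D x \<bullet> h) * \<psi> x)"
      unfolding F'_def using weak[OF \<psi>, of h] by simp
    also have "\<bar>\<dots>\<bar> \<le> (LINT x|lborel. \<bar>(D x \<bullet> h) * \<psi> x\<bar>)" by (rule integral_abs_bound)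
    also have "\<dots> \<le> (LINT x|lborel. C * norm h * (indicator K' x * norm (D x)))"
    proof (rule integral_mono_AE')
      show "integrable lborel (\<lambda>x. C * norm h * (indicator K' x * norm (D x)))"
        using integrable_real_mult_indicator[of K' lborel "\<lambda>x. norm (D x)"] D K'(2)
        by (intro integrable_mult_right) (simp add: mult.commute)
      have "\<bar>(D x \<bullet> h) * \<psi> x\<bar> \<le> C * norm h * (indicator K' x * norm (D x))" for x
      proof (cases "x \<in> K'")
        case True
        have "\<bar>D x \<bullet> h\<bar> * \<bar>\<psi> x\<bar> \<le> (norm (D x) * norm h) * C"
          by (rule mult_mono) (use Cauchy_Schwarz_ineq2 C in \<open>auto simp: \<psi>_def\<close>)
        then show ?thesis using True by (simp add: abs_mult mult_ac)
      qed (simp add: \<psi>0)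
      then show "AE x in lborel. \<bar>(D x \<bullet> h) * \<psi> x\<bar> \<le> C * norm h * (indicator K' x * norm (D x))" by simp
      have "C \<ge> 0" using C[of 0] by linarith
      then show "AE x in lborel. 0 \<le> C * norm h * (indicator K' x * norm (D x))" by simp
    qed
    finally show ?thesis by simp
  qed
  obtain z where "0 < z" "z < 1" "F 1 - F 0 = (1 - 0) * F' z"
    using MVT2[of 0 1 F F'] deriv by auto
  then show ?thesis using bound[of z] by (simp add: F_def)
qed

text \<open>The constant \<open>C\<close> appears because the sign of \<open>w (x + h) - w x\<close> is approximated by test functions
  that are bounded by \<open>C\<close>, not by \<open>1\<close>.\<close>

lemma translation_L1_estimate:
  fixes K V :: "'a::euclidean_space set"
  assumes "compact K" "open V" "K \<subseteq> V"
  shows "\<exists>r C K'. r > 0 \<and> C > 0 \<and> compact K' \<and> K' \<subseteq> V \<and>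
    (\<forall>w D h. weak_grad_L1 V w D \<longrightarrow> norm h \<le> r \<longrightarrow>
      (LINT x|lborel. indicator K x * \<bar>w (x + h) - w x\<bar>) \<le> C * norm h * (LINT x|lborel. indicator K' x * norm (D x)))"
proof -
  obtain e where e: "e > 0" "(\<Union>x\<in>K. cball x e) \<subseteq> V"
    using compact_subset_open_imp_cball_epsilon_subset[OF assms] by metis
  \<comment> \<open>Test functions live in the e / 2-neighbourhood of K and translations have length
    at most e / 2, so every segment stays in K', the closed e-neighbourhood.\<close>
  define U where "U = (\<Union>x\<in>K. ball x (e / 2))"
  have U: "open U" "K \<subseteq> U" using e by (auto simp: U_def)
  define K' where "K' = (\<Union>x\<in>K. cball x e)"
  have K'_eq: "K' = {x + y |x y. x \<in> K \<and> y \<in> cball 0 e}"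
  proof -
    have "z \<in> K'" if z: "z \<in> {x + y |x y. x \<in> K \<and> y \<in> cball 0 e}" for z
    proof -
      obtain x y where "z = x + y" "x \<in> K" "norm y \<le> e" using z by auto
      then show ?thesis unfolding K'_def by (intro UN_I[of x]) (auto simp: dist_norm)
    qed
    moreover have "z \<in> {x + y |x y. x \<in> K \<and> y \<in> cball 0 e}" if z: "z \<in> K'" for z
    proof -
      obtain x where "x \<in> K" "dist x z \<le> e" using z by (auto simp: K'_def)
      then have "z = x + (z - x)" "x \<in> K" "z - x \<in> cball 0 e" by (auto simp: dist_norm norm_minus_commute)
      then show ?thesis by blast
    qed
    ultimately show ?thesis by blast
  qed
  have K': "compact K'" "K' \<subseteq> V"
  proof -
    show "compact K'" unfolding K'_eq by (rule compact_sums[OF assms(1) compact_cball])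
    show "K' \<subseteq> V" using e(2) by (simp add: K'_def)
  qed
  obtain C :: real and L where *: "C > 0" "compact L" "L \<subseteq> U"
    "\<forall>h B. h \<in> borel_measurable lebesgue \<and> B > 0 \<and> (\<forall>x. \<bar>h x\<bar> \<le> B) \<and> (\<forall>x. x \<notin> K \<longrightarrow> h x = 0) \<longrightarrow>
      (\<exists>\<phi>. (\<forall>n. \<phi> n \<in> test_functions U \<and> supp (\<phi> n) \<subseteq> L \<and> (\<forall>x. \<bar>\<phi> n x\<bar> \<le> C * B)) \<and>
          (AE x in lebesgue. (\<lambda>n. \<phi> n x) \<longlonglongrightarrow> (h x :: real)))"
    using test_function_approx[OF assms(1) U] by (elim exE conjE) (rule that)
  have "(LINT x|lborel. indicator K x * \<bar>w (x + h) - w x\<bar>) \<le> C * norm h * (LINT x|lborel. indicator K' x * norm (D x))"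
    if wD: "weak_grad_L1 V w D" and h: "norm h \<le> e / 2" for w D h
  proof -
    have w: "integrable lborel w" using wD by (auto simp: weak_grad_L1_def)
    then have wm[measurable]: "w \<in> borel_measurable borel" by auto
    have wh: "integrable lborel (\<lambda>x. w (x + h))" using w by (simp add: integral_lborel_translation(2))
    have [measurable]: "K \<in> sets borel" using assms(1) by (simp add: borel_compact)
    define s where "s x = indicator K x * sgn (w (x + h) - w x)" for x
    have sm[measurable]: "s \<in> borel_measurable borel" unfolding s_def by measurable
    have "\<exists>\<phi>. (\<forall>n. \<phi> n \<in> test_functions U \<and> supp (\<phi> n) \<subseteq> L \<and> (\<forall>x. \<bar>\<phi> n x\<bar> \<le> C * 1)) \<and>
          (AE x in lebesgue. (\<lambda>n. \<phi> n x) \<longlonglongrightarrow> s x)"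
    proof (rule *(4)[rule_format], intro conjI allI impI)
      show "s \<in> borel_measurable lebesgue" using sm by (simp add: measurable_completion)
      show "\<bar>s x\<bar> \<le> 1" for x by (auto simp: s_def indicator_def abs_sgn_eq)
    qed (auto simp: s_def)
    then obtain \<phi> where \<phi>: "\<And>n. \<phi> n \<in> test_functions U" "\<And>n x. \<bar>\<phi> n x\<bar> \<le> C"
          "AE x in lborel. (\<lambda>n. \<phi> n x) \<longlonglongrightarrow> s x"
      by (auto simp: AE_completion_iff)
    note [measurable] = test_functions_imp_measurable(1)[OF \<phi>(1)]
    have int1: "integrable lborel (\<lambda>x. f x * \<phi> n x)" if "integrable lborel f" for f n
      by (rule Bochner_Integration.integrable_bound[OF integrable_mult_left[OF that, of C]])
         (use \<phi>(2) that in \<open>auto simp: abs_mult intro!: mult_left_mono order_trans[OF \<phi>(2)]\<close>)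
    have "(LINT x|lborel. (w (x + h) - w x) * \<phi> n x) \<le> C * norm h * (LINT x|lborel. indicator K' x * norm (D x))" for n
    proof -
      have "(LINT x|lborel. (w (x + h) - w x) * \<phi> n x) = (LINT x|lborel. w (x + h) * \<phi> n x) - (LINT x|lborel. w x * \<phi> n x)"
        using int1[OF w] int1[OF wh] by (simp add: left_diff_distrib)
      \<comment> \<open>The change of variables that moves the translation from w to the test
        function.\<close>
      also have "(LINT x|lborel. w (x + h) * \<phi> n x) = (LINT x|lborel. w x * \<phi> n (x - h))"
        using integral_lborel_translation(1)[of "\<lambda>x. w x * \<phi> n (x - h)" h] by simp
      also have "(LINT x|lborel. w x * \<phi> n (x - h)) - (LINT x|lborel. w x * \<phi> n x)
          \<le> C * norm h * (LINT x|lborel. indicator K' x * norm (D x))"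
      proof (rule order_trans[OF abs_ge_self], rule weak_translation_estimate[OF wD \<phi>(1,2) K'(2)])
        show "K' \<in> sets borel" using K'(1) by (simp add: borel_compact)
        fix x t :: _ assume "x \<in> supp (\<phi> n)" "0 \<le> t" "t \<le> (1::real)"
        then have "x \<in> U" using \<phi>(1)[of n] by (auto simp: test_functions_def)
        then obtain y where y: "y \<in> K" "dist y x < e / 2" by (auto simp: U_def)
        have "norm (t *\<^sub>R h) \<le> 1 * norm h" unfolding norm_scaleR
          using \<open>0 \<le> t\<close> \<open>t \<le> 1\<close> by (intro mult_right_mono) auto
        then have "dist x (x + t *\<^sub>R h) \<le> e / 2" using h by (simp add: dist_norm)
        then have "dist y (x + t *\<^sub>R h) \<le> e" using y(2) dist_triangle[of y "x + t *\<^sub>R h" x] by linarith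
        with y(1) show "x + t *\<^sub>R h \<in> K'" by (auto simp: K'_def)
      qed
      finally show ?thesis .
    qed
    moreover have "(\<lambda>n. LINT x|lborel. (w (x + h) - w x) * \<phi> n x) \<longlonglongrightarrow> (LINT x|lborel. (w (x + h) - w x) * s x)"
    proof (rule integral_dominated_convergence[where w = "\<lambda>x. \<bar>w (x + h) - w x\<bar> * C"])
      show "AE x in lborel. (\<lambda>n. (w (x + h) - w x) * \<phi> n x) \<longlonglongrightarrow> (w (x + h) - w x) * s x"
        using \<phi>(3) by eventually_elim (intro tendsto_intros)
      show "AE x in lborel. norm ((w (x + h) - w x) * \<phi> n x) \<le> \<bar>w (x + h) - w x\<bar> * C" for n
        using \<phi>(2) by (simp add: abs_mult mult_left_mono)
    qed (use w wh in auto)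
    ultimately have "(LINT x|lborel. (w (x + h) - w x) * s x) \<le> C * norm h * (LINT x|lborel. indicator K' x * norm (D x))"
      by (intro LIMSEQ_le_const2) auto
    moreover have "(w (x + h) - w x) * s x = indicator K x * \<bar>w (x + h) - w x\<bar>" for x
      by (simp add: s_def abs_sgn mult_ac)
    ultimately show ?thesis by simp
  qed
  then show ?thesis using e *(1) K' by (intro exI[of _ "e / 2"] exI[of _ C] exI[of _ K']) auto
qed

text \<open>At a fixed radius, the distance of \<open>w n\<close> to its ball averages is controlled by the gradients through
  the translation estimate, while the averages tend to zero by assumption.\<close>

lemma L1_convergence_of_weak_gradients:
  fixes K V :: "'a::euclidean_space set" and w :: "nat \<Rightarrow> 'a \<Rightarrow> real"
  assumes "compact K" "open V" "K \<subseteq> V"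
    and wD: "\<And>n. weak_grad_L1 V (w n) (D n)"
    and grad: "\<And>K'. compact K' \<Longrightarrow> K' \<subseteq> V \<Longrightarrow> (\<lambda>n. LINT x|lborel. indicator K' x * norm (D n x)) \<longlonglongrightarrow> 0"
    and ball: "\<And>x r. (\<lambda>n. LINT y|lborel. indicator (ball x r) y * w n y) \<longlonglongrightarrow> 0"
    and B: "\<And>n. (LINT x|lborel. \<bar>w n x\<bar>) \<le> B"
  shows "(\<lambda>n. LINT x|lborel. indicator K x * \<bar>w n x\<bar>) \<longlonglongrightarrow> 0"
proof -
  obtain r C K' where r: "r > 0" "C > 0" "compact K'" "K' \<subseteq> V"
    "\<And>w D h. weak_grad_L1 V w D \<Longrightarrow> norm h \<le> r \<Longrightarrow>
      (LINT x|lborel. indicator K x * \<bar>w (x + h) - w x\<bar>) \<le> C * norm h * (LINT x|lborel. indicator K' x * norm (D x))"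
    using translation_L1_estimate[OF assms(1-3)] by blast
  have w: "integrable lborel (w n)" for n using wD by (auto simp: weak_grad_L1_def)
  then have [measurable]: "w n \<in> borel_measurable borel" for n by auto
  have [measurable]: "K \<in> sets borel" using assms(1) by (simp add: borel_compact)
  define b where "b = measure lborel (ball (0::'a) r)"
  have b: "b > 0" "emeasure lborel (ball (0::'a) r) = ennreal b"
  proof -
    show "b > 0" unfolding b_def using r(1) by (simp add: content_ball_pos)
    show "emeasure lborel (ball (0::'a) r) = ennreal b"
      unfolding b_def using emeasure_bounded_finite[of "ball (0::'a) r"] by (intro emeasure_eq_ennreal_measure) auto
  qed
  define A where "A n x = (LINT y|lborel. indicator (ball x r) y * w n y)" for n x
  have A_meas[measurable]: "A n \<in> borel_measurable borel" for n
  proof -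
    \<comment> \<open>Expressing the ball through \<open>dist x y\<close> exhibits an integrand
      jointly measurable in x and y, as measurability of a parameter integral requires.\<close>
    have "A n x = (LINT y|lborel. (if dist x y < r then w n y else 0))" for x
      unfolding A_def by (intro Bochner_Integration.integral_cong) (auto simp: indicator_def)
    moreover have "(\<lambda>x. LINT y|lborel. (if dist x y < r then w n y else 0)) \<in> borel_measurable borel"
      by (rule lborel.borel_measurable_lebesgue_integral) measurable
    ultimately show ?thesis by (simp cong: measurable_cong)
  qed
  have [measurable]: "ball x \<rho> \<in> sets borel" for x :: 'a and \<rho> by simp
  have ind_w: "(\<lambda>y. indicator (ball x r) y * w n y) \<in> borel_measurable borel" for n x
    by measurable
  have A_eq: "A n x = (LINT h|lborel. indicator (ball 0 r) h * w n (x + h))" for n x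
  proof -
    have "A n x = (LINT h|lborel. indicator (ball x r) (h + x) * w n (h + x))"
      unfolding A_def by (rule integral_lborel_translation(1)[OF ind_w, symmetric])
    also have "\<dots> = (LINT h|lborel. indicator (ball 0 r) h * w n (x + h))"
      by (intro Bochner_Integration.integral_cong) (auto simp: indicator_def dist_norm add.commute)
    finally show ?thesis .
  qed
  have A_bound: "\<bar>A n x\<bar> \<le> B" for n x
  proof -
    have "\<bar>A n x\<bar> \<le> (LINT y|lborel. \<bar>indicator (ball x r) y * w n y\<bar>)"
      unfolding A_def by (rule integral_abs_bound)
    also have "\<dots> \<le> (LINT y|lborel. \<bar>w n y\<bar>)"
      by (rule integral_mono_AE') (use w in \<open>auto simp: indicator_def\<close>)
    finally show ?thesis using B[of n] by linarith
  qed
  have indK: "integrable lborel (indicator K :: 'a \<Rightarrow> real)"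
    using emeasure_bounded_finite[OF compact_imp_bounded[OF assms(1)]]
    by (intro integrable_real_indicator) auto
  have intA: "integrable lborel (\<lambda>x. indicator K x * \<bar>A n x\<bar>)" for n
    by (rule Bochner_Integration.integrable_bound[OF integrable_mult_left[OF indK, of B]])
       (use A_bound in \<open>auto simp: indicator_def intro!: order_trans[OF A_bound]\<close>)
  have intw: "integrable lborel (\<lambda>x. indicator K x * \<bar>w n x\<bar>)" for n
    using integrable_real_mult_indicator[of K lborel "\<lambda>x. \<bar>w n x\<bar>"] w by (simp add: mult.commute)
  have "(\<lambda>n. LINT x|lborel. indicator K x * \<bar>A n x\<bar>) \<longlonglongrightarrow> (LINT x|(lborel :: 'a measure). 0 :: real)"
  proof (rule integral_dominated_convergence[where w = "\<lambda>x. indicator K x * B"])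
    have "(\<lambda>n. A n x) \<longlonglongrightarrow> 0" for x unfolding A_def by (rule ball)
    then have "(\<lambda>n. indicator K x * \<bar>A n x\<bar>) \<longlonglongrightarrow> indicator K x * \<bar>0\<bar>" for x by (intro tendsto_intros)
    then show "AE x in lborel. (\<lambda>n. indicator K x * \<bar>A n x\<bar>) \<longlonglongrightarrow> 0" by simp
    show "AE x in lborel. norm (indicator K x * \<bar>A n x\<bar>) \<le> indicator K x * B" for n
      using A_bound by (auto simp: indicator_def)
  qed (use indK in auto)
  then have limA: "(\<lambda>n. LINT x|lborel. indicator K x * \<bar>A n x\<bar>) \<longlonglongrightarrow> 0" by simp
  define \<delta> where "\<delta> n = (LINT x|lborel. indicator K' x * norm (D n x))" for n
  have \<delta>: "\<delta> \<longlonglongrightarrow> 0" unfolding \<delta>_def using grad[OF r(3,4)] .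
  \<comment> \<open>Here b is the volume of the ball, and b * w n x differs from the unnormalized
    average \<open>A n x\<close> by the integral of w n (x + h) - w n x over |h| < r. The radius
    stays fixed; smallness comes from \<open>\<delta> n\<close>, not from letting r shrink.\<close>
  have main: "b * (LINT x|lborel. indicator K x * \<bar>w n x\<bar>) \<le> b * (C * r * \<delta> n) + (LINT x|lborel. indicator K x * \<bar>A n x\<bar>)" for n
  proof -
    have \<delta>0: "\<delta> n \<ge> 0" unfolding \<delta>_def by (intro integral_nonneg_AE) auto
    have pt: "ennreal (b * \<bar>w n x\<bar>) \<le> (\<integral>\<^sup>+h. ennreal (indicator (ball 0 r) h * \<bar>w n (x + h) - w n x\<bar>) \<partial>lborel) + ennreal \<bar>A n x\<bar>" for x
    proof -
      have i1: "integrable lborel (\<lambda>h. indicator (ball 0 r) h * w n (x + h))"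
        using integrable_real_mult_indicator[of "ball 0 r" lborel "\<lambda>h. w n (x + h)"] w[of n]
          integral_lborel_translation(2)[of "w n" x] by (simp add: mult.commute add.commute)
      have i2: "integrable lborel (\<lambda>h. indicator (ball (0::'a) r) h * w n x)"
        using b by (intro integrable_mult_left integrable_real_indicator) auto
      have i3: "integrable lborel (\<lambda>h. indicator (ball 0 r) h * \<bar>w n (x + h) - w n x\<bar>)"
        using integrable_abs[OF Bochner_Integration.integrable_diff[OF i1 i2]]
        by (simp add: abs_mult flip: right_diff_distrib)
      have "b * w n x = (LINT h|lborel. indicator (ball (0::'a) r) h * w n x)"
        unfolding b_def by simp
      also have "\<dots> = A n x - (LINT h|lborel. indicator (ball 0 r) h * w n (x + h) - indicator (ball 0 r) h * w n x)"
        unfolding A_eq using i1 i2 by simp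
      finally have "\<bar>b * w n x\<bar> \<le> \<bar>A n x\<bar> + \<bar>LINT h|lborel. indicator (ball 0 r) h * w n (x + h) - indicator (ball 0 r) h * w n x\<bar>"
        by linarith
      also have "\<bar>LINT h|lborel. indicator (ball 0 r) h * w n (x + h) - indicator (ball 0 r) h * w n x\<bar>
          \<le> (LINT h|lborel. \<bar>indicator (ball 0 r) h * w n (x + h) - indicator (ball 0 r) h * w n x\<bar>)"
        by (rule integral_abs_bound)
      also have "\<dots> = (LINT h|lborel. indicator (ball 0 r) h * \<bar>w n (x + h) - w n x\<bar>)"
        by (simp add: abs_mult flip: right_diff_distrib)
      finally have "b * \<bar>w n x\<bar> \<le> (LINT h|lborel. indicator (ball 0 r) h * \<bar>w n (x + h) - w n x\<bar>) + \<bar>A n x\<bar>"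
        using b by (simp add: abs_mult)
      then have "ennreal (b * \<bar>w n x\<bar>) \<le> ennreal (LINT h|lborel. indicator (ball 0 r) h * \<bar>w n (x + h) - w n x\<bar>) + ennreal \<bar>A n x\<bar>"
        using integral_nonneg_AE[where M = lborel and f = "\<lambda>h. indicator (ball 0 r) h * \<bar>w n (x + h) - w n x\<bar>"]
        by (simp add: ennreal_leI flip: ennreal_plus)
      also have "ennreal (LINT h|lborel. indicator (ball 0 r) h * \<bar>w n (x + h) - w n x\<bar>) =
           (\<integral>\<^sup>+h. ennreal (indicator (ball 0 r) h * \<bar>w n (x + h) - w n x\<bar>) \<partial>lborel)"
        by (rule nn_integral_eq_integral[symmetric]) (use i3 in auto)
      finally show ?thesis .
    qed
    \<comment> \<open>Integration over K is done with nonnegative integrals, so that exchanging x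
      and h needs measurability only. After the exchange the inner integral in x is the one that the
      translation estimate bounds.\<close>
    have "ennreal (b * (LINT x|lborel. indicator K x * \<bar>w n x\<bar>)) = (\<integral>\<^sup>+x. ennreal (b * (indicator K x * \<bar>w n x\<bar>)) \<partial>lborel)"
      using intw b by (subst nn_integral_eq_integral) auto
    also have "\<dots> \<le> (\<integral>\<^sup>+x. (\<integral>\<^sup>+h. ennreal (indicator K x * (indicator (ball 0 r) h * \<bar>w n (x + h) - w n x\<bar>)) \<partial>lborel)
          + ennreal (indicator K x * \<bar>A n x\<bar>) \<partial>lborel)"
      by (rule nn_integral_mono) (use pt in \<open>auto simp: indicator_def\<close>)
    also have "\<dots> = (\<integral>\<^sup>+x. \<integral>\<^sup>+h. ennreal (indicator K x * (indicator (ball 0 r) h * \<bar>w n (x + h) - w n x\<bar>)) \<partial>lborel \<partial>lborel)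
        + (\<integral>\<^sup>+x. ennreal (indicator K x * \<bar>A n x\<bar>) \<partial>lborel)"
      by (rule nn_integral_add) measurable
    also have "(\<integral>\<^sup>+x. ennreal (indicator K x * \<bar>A n x\<bar>) \<partial>lborel) = ennreal (LINT x|lborel. indicator K x * \<bar>A n x\<bar>)"
      by (rule nn_integral_eq_integral[OF intA]) auto
    also have "(\<integral>\<^sup>+x. \<integral>\<^sup>+h. ennreal (indicator K x * (indicator (ball 0 r) h * \<bar>w n (x + h) - w n x\<bar>)) \<partial>lborel \<partial>lborel)
        = (\<integral>\<^sup>+h. \<integral>\<^sup>+x. ennreal (indicator K x * (indicator (ball 0 r) h * \<bar>w n (x + h) - w n x\<bar>)) \<partial>lborel \<partial>lborel)"
      by (rule lborel_pair.Fubini') measurable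
    finally have split: "ennreal (b * (LINT x|lborel. indicator K x * \<bar>w n x\<bar>))
      \<le> (\<integral>\<^sup>+h. \<integral>\<^sup>+x. ennreal (indicator K x * (indicator (ball 0 r) h * \<bar>w n (x + h) - w n x\<bar>)) \<partial>lborel \<partial>lborel)
        + ennreal (LINT x|lborel. indicator K x * \<bar>A n x\<bar>)" .
    have "(\<integral>\<^sup>+h. \<integral>\<^sup>+x. ennreal (indicator K x * (indicator (ball 0 r) h * \<bar>w n (x + h) - w n x\<bar>)) \<partial>lborel \<partial>lborel)
        \<le> (\<integral>\<^sup>+h. ennreal (C * r * \<delta> n) * indicator (ball (0::'a) r) h \<partial>lborel)"
    proof (rule nn_integral_mono)
      fix h :: 'a
      show "(\<integral>\<^sup>+x. ennreal (indicator K x * (indicator (ball 0 r) h * \<bar>w n (x + h) - w n x\<bar>)) \<partial>lborel)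
          \<le> ennreal (C * r * \<delta> n) * indicator (ball (0::'a) r) h"
      proof (cases "h \<in> ball 0 r")
        case True
        have "integrable lborel (\<lambda>x. \<bar>w n (x + h) - w n x\<bar>)"
          using w[of n] integral_lborel_translation(2)[of "w n" h] by auto
        then have "integrable lborel (\<lambda>x. indicator K x * \<bar>w n (x + h) - w n x\<bar>)"
          using integrable_real_mult_indicator[of K lborel "\<lambda>x. \<bar>w n (x + h) - w n x\<bar>"] by (simp add: mult.commute)
        then have "(\<integral>\<^sup>+x. ennreal (indicator K x * \<bar>w n (x + h) - w n x\<bar>) \<partial>lborel)
           = ennreal (LINT x|lborel. indicator K x * \<bar>w n (x + h) - w n x\<bar>)"
          by (rule nn_integral_eq_integral) auto
        also have "\<dots> \<le> ennreal (C * norm h * \<delta> n)"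
          unfolding \<delta>_def using True by (intro ennreal_leI r(5)[OF wD]) auto
        also have "\<dots> \<le> ennreal (C * r * \<delta> n)"
          using True r(1,2) \<delta>0 by (intro ennreal_leI mult_right_mono mult_left_mono) auto
        finally show ?thesis using True by simp
      qed simp
    qed
    also have "\<dots> = ennreal (b * (C * r * \<delta> n))"
      using b r \<delta>0 by (subst nn_integral_cmult_indicator) (auto simp: ennreal_mult[symmetric] mult.commute)
    finally have "ennreal (b * (LINT x|lborel. indicator K x * \<bar>w n x\<bar>))
      \<le> ennreal (b * (C * r * \<delta> n)) + ennreal (LINT x|lborel. indicator K x * \<bar>A n x\<bar>)"
      using split by (meson add_right_mono order_trans)
    moreover have "(LINT x|lborel. indicator K x * \<bar>A n x\<bar>) \<ge> 0" by (intro integral_nonneg_AE) auto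
    ultimately show ?thesis
      using b r(1,2) \<delta>0 by (simp add: ennreal_le_iff flip: ennreal_plus)
  qed
  have "(\<lambda>n. b * (LINT x|lborel. indicator K x * \<bar>w n x\<bar>)) \<longlonglongrightarrow> 0"
  proof (rule tendsto_sandwich[OF _ _ tendsto_const])
    show "(\<lambda>n. b * (C * r * \<delta> n) + (LINT x|lborel. indicator K x * \<bar>A n x\<bar>)) \<longlonglongrightarrow> 0"
      using tendsto_add[OF tendsto_mult_left[OF tendsto_mult_left[OF \<delta>]] limA] by simp
  qed (use main b in \<open>auto intro!: always_eventually integral_nonneg_AE\<close>)
  from tendsto_mult_left[OF this, of "inverse b"] show ?thesis using b by (simp flip: mult.assoc)
qed

section \<open>Weak convergence in Sobolev spaces\<close>

lemma integrable_mult_square_integrable: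
  fixes f g :: "'a \<Rightarrow> real"
  assumes [measurable]: "f \<in> borel_measurable M" "g \<in> borel_measurable M"
    and "integrable M (\<lambda>x. (f x)\<^sup>2)" "integrable M (\<lambda>x. (g x)\<^sup>2)"
  shows "integrable M (\<lambda>x. f x * g x)"
proof (rule Bochner_Integration.integrable_bound[OF Bochner_Integration.integrable_add[OF assms(3,4)]])
  have "\<bar>f x\<bar> * \<bar>g x\<bar> \<le> (f x)\<^sup>2 + (g x)\<^sup>2" for x
  proof -
    have "2 * (\<bar>f x\<bar> * \<bar>g x\<bar>) \<le> (f x)\<^sup>2 + (g x)\<^sup>2"
      using sum_squares_bound[of "\<bar>f x\<bar>" "\<bar>g x\<bar>"] by simp
    moreover have "0 \<le> \<bar>f x\<bar> * \<bar>g x\<bar>" by simp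
    ultimately show ?thesis by linarith
  qed
  then show "AE x in M. norm (f x * g x) \<le> norm ((f x)\<^sup>2 + (g x)\<^sup>2)"
    by (simp add: abs_mult)
qed measurable

text \<open>A form of Young's inequality with a free weight. It takes the role of Cauchy-Schwarz: t
  is chosen first to make one term small, and the other factor is then made small relative to
  t.\<close>

lemma integral_mult_le_Young:
  fixes f g :: "'a \<Rightarrow> real"
  assumes [measurable]: "f \<in> borel_measurable M" "g \<in> borel_measurable M"
    and f: "integrable M (\<lambda>x. (f x)\<^sup>2)" and g: "integrable M (\<lambda>x. (g x)\<^sup>2)" and "t > 0"
  shows "\<bar>LINT x|M. f x * g x\<bar> \<le> t * (LINT x|M. (f x)\<^sup>2) + (LINT x|M. (g x)\<^sup>2) / t"
proof -
  have pt: "\<bar>f x * g x\<bar> \<le> t * (f x)\<^sup>2 + (g x)\<^sup>2 / t" for x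
  proof -
    have "2 * (t * \<bar>f x\<bar>) * \<bar>g x\<bar> \<le> (t * \<bar>f x\<bar>)\<^sup>2 + \<bar>g x\<bar>\<^sup>2" by (rule sum_squares_bound)
    moreover have "0 \<le> (t * \<bar>f x\<bar>) * \<bar>g x\<bar>" using \<open>t > 0\<close> by simp
    ultimately have "(t * \<bar>f x\<bar>) * \<bar>g x\<bar> \<le> (t * \<bar>f x\<bar>)\<^sup>2 + \<bar>g x\<bar>\<^sup>2" by linarith
    then have "t * \<bar>f x * g x\<bar> \<le> t\<^sup>2 * (f x)\<^sup>2 + (g x)\<^sup>2"
      by (simp add: abs_mult power_mult_distrib mult.assoc)
    also have "\<dots> = t * (t * (f x)\<^sup>2 + (g x)\<^sup>2 / t)"
      using \<open>t > 0\<close> by (simp add: field_simps power2_eq_square)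
    finally show ?thesis using \<open>t > 0\<close> by simp
  qed
  have "\<bar>LINT x|M. f x * g x\<bar> \<le> (LINT x|M. \<bar>f x * g x\<bar>)" by (rule integral_abs_bound)
  also have "\<dots> \<le> (LINT x|M. t * (f x)\<^sup>2 + (g x)\<^sup>2 / t)"
    using f g integrable_mult_square_integrable[OF assms(1-4)] by (intro integral_mono pt) auto
  also have "\<dots> = t * (LINT x|M. (f x)\<^sup>2) + (LINT x|M. (g x)\<^sup>2) / t"
    using f g by simp
  finally show ?thesis .
qed

lemma integral_lebesgue_on:
  fixes f :: "'a::euclidean_space \<Rightarrow> 'b::{banach, second_countable_topology}"
  assumes "U \<in> sets lebesgue"
  shows "(LINT x|lebesgue_on U. f x) = (LINT x|lebesgue. indicator U x *\<^sub>R f x)"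
    and "integrable (lebesgue_on U) f \<longleftrightarrow> integrable lebesgue (\<lambda>x. indicator U x *\<^sub>R f x)"
  using assms by (auto simp: integral_restrict_space integrable_restrict_space)

lemma integrable_mult_test_function:
  fixes f :: "'a::euclidean_space \<Rightarrow> real"
  assumes \<phi>: "\<phi> \<in> test_functions U" and U: "U \<in> sets lebesgue"
    and int: "\<And>K. compact K \<Longrightarrow> K \<subseteq> U \<Longrightarrow> integrable (lebesgue_on K) f"
  shows "integrable (lebesgue_on U) (\<lambda>x. f x * \<phi> x)"
proof -
  have K: "compact (supp \<phi>)" "supp \<phi> \<subseteq> U" using \<phi> by (auto simp: test_functions_def)
  have Ks: "supp \<phi> \<in> sets lebesgue" using K(1) by (simp add: lmeasurable_compact fmeasurableD)
  have i: "integrable lebesgue (\<lambda>x. indicator (supp \<phi>) x * f x)"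
    using int[OF K] Ks by (simp add: integral_lebesgue_on)
  obtain B where B: "B > 0" "\<And>x. norm (\<phi> x) \<le> B" using test_functions_bounded[OF \<phi>] by metis
  note [measurable] = test_functions_imp_measurable(2)[OF \<phi>]
  have "integrable lebesgue (\<lambda>x. (indicator (supp \<phi>) x * f x) * \<phi> x)"
    by (rule Bochner_Integration.integrable_bound[OF integrable_mult_left[OF i, of B]])
       (use i B in \<open>auto simp: abs_mult intro!: mult_left_mono order_trans[OF _ abs_ge_self]\<close>)
  moreover have "(indicator (supp \<phi>) x * f x) * \<phi> x = indicator U x *\<^sub>R (f x * \<phi> x)" for x
    using test_functions_eq_0[OF \<phi>, of x] K(2) by (cases "x \<in> supp \<phi>") auto
  ultimately show ?thesis using U by (simp add: integral_lebesgue_on)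
qed

text \<open>Density of test functions: under the uniform \<open>L^2\<close> bound, replacing G by a
  nearby test function costs an error that is uniform in n.\<close>

lemma weak_convergence_L2_from_test_functions:
  fixes f :: "nat \<Rightarrow> 'a::euclidean_space \<Rightarrow> real"
  assumes U: "open U" and K: "compact K" "K \<subseteq> U"
    and fm[measurable]: "\<And>n. f n \<in> borel_measurable (lebesgue_on U)" "g \<in> borel_measurable (lebesgue_on U)"
    and f2: "\<And>n. integrable (lebesgue_on U) (\<lambda>x. (f n x)\<^sup>2)" and g2: "integrable (lebesgue_on U) (\<lambda>x. (g x)\<^sup>2)"
    and fB: "\<And>n. (LINT x|lebesgue_on U. (f n x)\<^sup>2) \<le> B"
    and conv: "\<And>\<phi>. \<phi> \<in> test_functions U \<Longrightarrow>
      (\<lambda>n. LINT x|lebesgue_on U. f n x * \<phi> x) \<longlonglongrightarrow> (LINT x|lebesgue_on U. g x * \<phi> x)"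
    and G: "G \<in> borel_measurable lebesgue" "integrable lebesgue (\<lambda>x. (G x)\<^sup>2)" "\<And>x. x \<notin> K \<Longrightarrow> G x = 0"
  shows "(\<lambda>n. LINT x|lebesgue_on U. f n x * G x) \<longlonglongrightarrow> (LINT x|lebesgue_on U. g x * G x)"
proof (rule LIMSEQ_I)
  fix e :: real assume "e > 0"
  have Us: "U \<in> sets lebesgue" using U by simp
  define C where "C = max B (LINT x|lebesgue_on U. (g x)\<^sup>2) + 1"
  have "0 \<le> (LINT x|lebesgue_on U. (g x)\<^sup>2)" by simp
  then have "C > 0" unfolding C_def by (simp add: add_nonneg_pos le_max_iff_disj)
  then have C: "C > 0" "\<And>n. (LINT x|lebesgue_on U. (f n x)\<^sup>2) \<le> C" "(LINT x|lebesgue_on U. (g x)\<^sup>2) \<le> C"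
    unfolding C_def using fB order_trans[OF fB max.cobounded1] by (auto simp: add_increasing2)
  \<comment> \<open>With this t, Young's inequality gives t * C = e / 6 plus less than e / 6 from
    the choice of \<open>\<phi>\<close>. Each of the two replacements of G thus costs less than e /
    3, and the third share is left for the convergence against \<open>\<phi>\<close>.\<close>
  define t where "t = e / (6 * C)"
  have t: "t > 0" using \<open>e > 0\<close> C(1) by (simp add: t_def)
  obtain \<phi> where \<phi>: "\<phi> \<in> test_functions U" "integrable lebesgue (\<lambda>x. (G x - \<phi> x)\<^sup>2)"
     "(LINT x|lebesgue. (G x - \<phi> x)\<^sup>2) < t * (e / 6)"
    using test_functions_dense_L2[OF U K G(1,2), of "t * (e / 6)"] G(3) t \<open>e > 0\<close> by auto
  have [measurable]: "G \<in> borel_measurable (lebesgue_on U)" "\<phi> \<in> borel_measurable (lebesgue_on U)"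
    using G(1) test_functions_imp_measurable(2)[OF \<phi>(1)] by (auto intro: measurable_restrict_space1)
  have d2: "integrable (lebesgue_on U) (\<lambda>x. (G x - \<phi> x)\<^sup>2)"
    using integrable_mult_indicator[OF Us \<phi>(2)] Us by (simp add: integral_lebesgue_on)
  have G2: "integrable (lebesgue_on U) (\<lambda>x. (G x)\<^sup>2)"
    using integrable_mult_indicator[OF Us G(2)] Us by (simp add: integral_lebesgue_on)
  have d: "(LINT x|lebesgue_on U. (G x - \<phi> x)\<^sup>2) < t * (e / 6)"
  proof -
    have "(LINT x|lebesgue_on U. (G x - \<phi> x)\<^sup>2) \<le> (LINT x|lebesgue. (G x - \<phi> x)\<^sup>2)"
      unfolding integral_lebesgue_on(1)[OF Us]
      by (rule integral_mono_AE') (use \<phi>(2) in \<open>auto simp: indicator_def\<close>)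
    then show ?thesis using \<phi>(3) by linarith
  qed
  have small: "\<bar>(LINT x|lebesgue_on U. h x * G x) - (LINT x|lebesgue_on U. h x * \<phi> x)\<bar> < e / 3"
    if [measurable]: "h \<in> borel_measurable (lebesgue_on U)" and h2: "integrable (lebesgue_on U) (\<lambda>x. (h x)\<^sup>2)"
      and hC: "(LINT x|lebesgue_on U. (h x)\<^sup>2) \<le> C" for h
  proof -
    have i1: "integrable (lebesgue_on U) (\<lambda>x. h x * G x)"
      by (rule integrable_mult_square_integrable) (use h2 G2 in auto)
    have i2: "integrable (lebesgue_on U) (\<lambda>x. h x * (G x - \<phi> x))"
      by (rule integrable_mult_square_integrable) (use h2 d2 in auto)
    have "integrable (lebesgue_on U) (\<lambda>x. h x * G x - h x * (G x - \<phi> x))" using i1 i2 by (rule Bochner_Integration.integrable_diff)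
    then have i3: "integrable (lebesgue_on U) (\<lambda>x. h x * \<phi> x)" by (simp add: right_diff_distrib)
    have "(LINT x|lebesgue_on U. h x * G x) - (LINT x|lebesgue_on U. h x * \<phi> x) = (LINT x|lebesgue_on U. h x * (G x - \<phi> x))"
      using i1 i3 by (simp add: right_diff_distrib)
    also have "\<bar>\<dots>\<bar> \<le> t * (LINT x|lebesgue_on U. (h x)\<^sup>2) + (LINT x|lebesgue_on U. (G x - \<phi> x)\<^sup>2) / t"
      by (rule integral_mult_le_Young) (use h2 d2 t in auto)
    also have "\<dots> < t * C + e / 6"
      using t hC d by (intro add_le_less_mono) (auto simp: divide_less_eq mult.commute)
    also have "t * C + e / 6 = e / 3" using C(1) by (simp add: t_def)
    finally show ?thesis .
  qed
  obtain N where N: "\<And>n. n \<ge> N \<Longrightarrow> \<bar>(LINT x|lebesgue_on U. f n x * \<phi> x) - (LINT x|lebesgue_on U. g x * \<phi> x)\<bar> < e / 3"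
    using LIMSEQ_D[OF conv[OF \<phi>(1)], of "e / 3"] \<open>e > 0\<close> by auto
  show "\<exists>N. \<forall>n\<ge>N. norm ((LINT x|lebesgue_on U. f n x * G x) - (LINT x|lebesgue_on U. g x * G x)) < e"
  proof (intro exI allI impI)
    fix n assume "n \<ge> N"
    then show "norm ((LINT x|lebesgue_on U. f n x * G x) - (LINT x|lebesgue_on U. g x * G x)) < e"
      using N[of n] small[OF fm(1) f2 C(2), of n] small[OF fm(2) g2 C(3)] unfolding real_norm_def by linarith
  qed
qed

text \<open>The Hilbert space principle that weak convergence together with convergence of norms is
  strong convergence, in a weighted form: expand the square and pass to the limit in each
  term.\<close>

lemma tendsto_weighted_square_diff:
  fixes f :: "nat \<Rightarrow> 'a \<Rightarrow> 'b::euclidean_space"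
  assumes [measurable]: "\<eta> \<in> borel_measurable M" "\<And>n. f n \<in> borel_measurable M" "g \<in> borel_measurable M"
    and f2: "\<And>n. integrable M (\<lambda>x. (norm (f n x))\<^sup>2)" and g2: "integrable M (\<lambda>x. (norm (g x))\<^sup>2)"
    and \<eta>: "\<And>x. \<bar>\<eta> x\<bar> \<le> B"
    and norms: "(\<lambda>n. LINT x|M. \<eta> x * (norm (f n x))\<^sup>2) \<longlonglongrightarrow> (LINT x|M. \<eta> x * (norm (g x))\<^sup>2)"
    and inner: "(\<lambda>n. LINT x|M. \<eta> x * (f n x \<bullet> g x)) \<longlonglongrightarrow> (LINT x|M. \<eta> x * (g x \<bullet> g x))"
  shows "(\<lambda>n. LINT x|M. \<eta> x * (norm (f n x - g x))\<^sup>2) \<longlonglongrightarrow> 0"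
proof -
  have i: "integrable M (\<lambda>x. \<eta> x * k x)" if "integrable M k" for k
    by (rule Bochner_Integration.integrable_bound[OF integrable_mult_left[OF that, of B]])
       (use \<eta> that in \<open>auto simp: abs_mult mult.commute intro!: mult_right_mono order_trans[OF \<eta>]\<close>)
  have fg: "integrable M (\<lambda>x. f n x \<bullet> g x)" for n
  proof (rule Bochner_Integration.integrable_bound)
    show "integrable M (\<lambda>x. norm (f n x) * norm (g x))"
      by (rule integrable_mult_square_integrable) (use f2 g2 in auto)
  qed (auto simp: Cauchy_Schwarz_ineq2)
  have "(LINT x|M. \<eta> x * (norm (f n x - g x))\<^sup>2) =
      (LINT x|M. \<eta> x * (norm (f n x))\<^sup>2) - 2 * (LINT x|M. \<eta> x * (f n x \<bullet> g x)) + (LINT x|M. \<eta> x * (norm (g x))\<^sup>2)" for n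
  proof -
    have "\<eta> x * (norm (f n x - g x))\<^sup>2 = \<eta> x * (norm (f n x))\<^sup>2 - 2 * (\<eta> x * (f n x \<bullet> g x)) + \<eta> x * (norm (g x))\<^sup>2" for x
      unfolding power2_norm_eq_inner by (simp add: inner_diff inner_commute algebra_simps)
    then show ?thesis using i[OF f2] i[OF g2] i[OF fg] by simp
  qed
  moreover have "(\<lambda>n. (LINT x|M. \<eta> x * (norm (f n x))\<^sup>2) - 2 * (LINT x|M. \<eta> x * (f n x \<bullet> g x)) + (LINT x|M. \<eta> x * (norm (g x))\<^sup>2))
     \<longlonglongrightarrow> (LINT x|M. \<eta> x * (norm (g x))\<^sup>2) - 2 * (LINT x|M. \<eta> x * (g x \<bullet> g x)) + (LINT x|M. \<eta> x * (norm (g x))\<^sup>2)"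
    by (intro tendsto_intros norms inner)
  ultimately show ?thesis by (simp add: power2_norm_eq_inner)
qed

section \<open>Weak gradients and the consequences of weak Sobolev convergence\<close>

lemma has_weak_gradient_unique:
  assumes "open \<Omega>" "has_weak_gradient u D \<Omega>" "has_weak_gradient u D' \<Omega>"
  shows "AE x in lebesgue_on \<Omega>. D x = D' x"
proof -
  have "AE x in lebesgue_on \<Omega>. D x $ i $ j - D' x $ i $ j = 0" for i j
  proof (rule fundamental_lemma_of_variations[OF assms(1)])
    have comp: "integrable (lebesgue_on K) (\<lambda>x. F x $ i $ j)"
      if "has_weak_gradient u F \<Omega>" "compact K" "K \<subseteq> \<Omega>" for F K
      using that unfolding has_weak_gradient_def
      by (auto intro!: integrable_bounded_linear[OF bounded_linear_vec_nth] integrable_bounded_linear[OF bounded_linear_vec_nth, of _ "\<lambda>x. F x $ i"])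
    show "integrable (lebesgue_on K) (\<lambda>x. D x $ i $ j - D' x $ i $ j)" if "compact K" "K \<subseteq> \<Omega>" for K
      using comp that assms(2,3) by auto
    show "(LINT x|lebesgue_on \<Omega>. (D x $ i $ j - D' x $ i $ j) * \<phi> x) = 0" if \<phi>: "\<phi> \<in> test_functions \<Omega>" for \<phi>
    proof -
      have "integrable (lebesgue_on \<Omega>) (\<lambda>x. F x $ i $ j * \<phi> x)" if "has_weak_gradient u F \<Omega>" for F
        using \<phi> assms(1) comp[OF that] by (intro integrable_mult_test_function) auto
      from this[OF assms(2)] this[OF assms(3)] show ?thesis
        using assms(2,3) \<phi> unfolding has_weak_gradient_def by (simp add: left_diff_distrib)
    qed
  qed
  then have "AE x in lebesgue_on \<Omega>. \<forall>i\<in>UNIV. \<forall>j\<in>UNIV. D x $ i $ j - D' x $ i $ j = 0"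
    by (intro AE_finite_allI) auto
  then show ?thesis by eventually_elim (simp add: vec_eq_iff)
qed

text \<open>\<open>wgrad\<close> is an arbitrary choice among weak gradients. Its square
  integrability is inherited, by uniqueness almost everywhere, from the gradient that membership in
  \<open>W12\<close> provides.\<close>

lemma wgrad_W12:
  assumes "open \<Omega>" "u \<in> W12 \<Omega>"
  shows "has_weak_gradient u (wgrad \<Omega> u) \<Omega>"
    and "wgrad \<Omega> u \<in> borel_measurable (lebesgue_on \<Omega>)"
    and "integrable (lebesgue_on \<Omega>) (\<lambda>x. (norm (wgrad \<Omega> u x))\<^sup>2)"
proof -
  obtain D where D: "D \<in> L2 \<Omega>" "has_weak_gradient u D \<Omega>" using assms(2) by (auto simp: W12_def)
  show w: "has_weak_gradient u (wgrad \<Omega> u) \<Omega>" unfolding wgrad_def by (rule someI[of _ D]) (rule D)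
  then show m[measurable]: "wgrad \<Omega> u \<in> borel_measurable (lebesgue_on \<Omega>)" by (simp add: has_weak_gradient_def)
  have [measurable]: "D \<in> borel_measurable (lebesgue_on \<Omega>)" using D(1) by (simp add: L2_def)
  have "AE x in lebesgue_on \<Omega>. (norm (D x))\<^sup>2 = (norm (wgrad \<Omega> u x))\<^sup>2"
    using has_weak_gradient_unique[OF assms(1) D(2) w] by eventually_elim simp
  moreover have "integrable (lebesgue_on \<Omega>) (\<lambda>x. (norm (D x))\<^sup>2)" using D(1) by (simp add: L2_def)
  ultimately show "integrable (lebesgue_on \<Omega>) (\<lambda>x. (norm (wgrad \<Omega> u x))\<^sup>2)"
    by (subst integrable_cong_AE[of _ _ "\<lambda>x. (norm (D x))\<^sup>2"]) auto
qed

lemma component_square_le_norm_square: "(x $ i)\<^sup>2 \<le> (norm (x :: real^'n))\<^sup>2"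
  using component_le_norm_cart[of x i] by (simp flip: abs_le_square_iff)

lemma W12_component:
  assumes "u \<in> W12 \<Omega>"
  shows "(\<lambda>x. u x $ i) \<in> borel_measurable (lebesgue_on \<Omega>)"
    and "integrable (lebesgue_on \<Omega>) (\<lambda>x. (u x $ i)\<^sup>2)"
    and "integrable (lebesgue_on \<Omega>) (\<lambda>x. (norm (u x))\<^sup>2)"
    and "u \<in> borel_measurable (lebesgue_on \<Omega>)"
proof -
  show um[measurable]: "u \<in> borel_measurable (lebesgue_on \<Omega>)"
    and u2: "integrable (lebesgue_on \<Omega>) (\<lambda>x. (norm (u x))\<^sup>2)"
    using assms by (auto simp: W12_def L2_def)
  show m[measurable]: "(\<lambda>x. u x $ i) \<in> borel_measurable (lebesgue_on \<Omega>)"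
    by (rule measurable_compose[OF um borel_measurable_nth])
  show "integrable (lebesgue_on \<Omega>) (\<lambda>x. (u x $ i)\<^sup>2)"
    by (rule Bochner_Integration.integrable_bound[OF u2])
       (auto simp: component_square_le_norm_square)
qed

lemma integrable_lebesgue_on_const:
  fixes \<Omega> :: "'a::euclidean_space set"
  assumes "open \<Omega>" "bounded \<Omega>"
  shows "integrable (lebesgue_on \<Omega>) (\<lambda>x. c :: real)"
proof -
  have "\<Omega> \<in> lmeasurable" using assms by (simp add: lmeasurable_open)
  then have "integrable lebesgue (indicator \<Omega> :: 'a \<Rightarrow> real)"
    using fmeasurableD2[of \<Omega> lebesgue] fmeasurableD[of \<Omega> lebesgue]
    by (intro integrable_real_indicator) (auto simp: top.not_eq_extremum)
  then have "integrable (lebesgue_on \<Omega>) (\<lambda>x. 1 :: real)"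
    using assms(1) by (subst integral_lebesgue_on(2)) auto
  then show ?thesis using integrable_mult_right[where c = c and f = "\<lambda>x. 1" and M = "lebesgue_on \<Omega>"] by simp
qed

lemma integrable_mult_bounded:
  fixes f h :: "'a \<Rightarrow> real"
  assumes f: "integrable M f" and [measurable]: "h \<in> borel_measurable M" and h: "\<And>x. \<bar>h x\<bar> \<le> B"
  shows "integrable M (\<lambda>x. f x * h x)"
  by (rule Bochner_Integration.integrable_bound[OF integrable_mult_left[OF f, of B]])
     (use f h in \<open>auto simp: abs_mult intro!: mult_left_mono order_trans[OF h]\<close>)

lemma square_integrable_imp_integrable:
  fixes f :: "'a::euclidean_space \<Rightarrow> real"
  assumes "open \<Omega>" "bounded \<Omega>" "f \<in> borel_measurable (lebesgue_on \<Omega>)" "integrable (lebesgue_on \<Omega>) (\<lambda>x. (f x)\<^sup>2)"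
  shows "integrable (lebesgue_on \<Omega>) f"
  using integrable_mult_square_integrable[of f "lebesgue_on \<Omega>" "\<lambda>x. 1"] assms integrable_lebesgue_on_const[OF assms(1,2)]
  by simp

text \<open>Integration of a component against a bounded h is a functional in
  \<open>W12_dual\<close>. Boundedness of h is general enough for the two uses: derivatives of test
  functions, which give the weak limit of the gradients, and indicators of balls, which give the
  averages.\<close>

lemma weakly_converges_W12_integral:
  assumes \<Omega>: "open \<Omega>" "bounded \<Omega>" and conv: "weakly_converges_W12 \<Omega> u v"
    and h[measurable]: "h \<in> borel_measurable (lebesgue_on \<Omega>)" and hB: "\<And>x. \<bar>h x\<bar> \<le> B"
  shows "(\<lambda>n. LINT x|lebesgue_on \<Omega>. u n x $ i * h x) \<longlonglongrightarrow> (LINT x|lebesgue_on \<Omega>. v x $ i * h x)"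
proof -
  define l where "l w = (LINT x|lebesgue_on \<Omega>. w x $ i * h x)" for w :: "real^3 \<Rightarrow> real^3"
  have int: "integrable (lebesgue_on \<Omega>) (\<lambda>x. w x $ i * h x)" if "w \<in> W12 \<Omega>" for w
    by (rule integrable_mult_bounded[OF square_integrable_imp_integrable[OF \<Omega> W12_component(1,2)[OF that]] h hB])
  have h2: "integrable (lebesgue_on \<Omega>) (\<lambda>x. (h x)\<^sup>2)"
  proof (rule Bochner_Integration.integrable_bound[OF integrable_lebesgue_on_const[OF \<Omega>, of "B\<^sup>2"]])
    show "AE x in lebesgue_on \<Omega>. norm ((h x)\<^sup>2) \<le> norm (B\<^sup>2)"
      using hB by (auto intro!: AE_I2 simp: abs_le_square_iff[symmetric] intro: order_trans[OF hB])
  qed measurable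
  define A where "A = (LINT x|lebesgue_on \<Omega>. (h x)\<^sup>2)"
  have "A \<ge> 0" by (simp add: A_def)
  have bound: "\<bar>l w\<bar> \<le> (1 + A) * W12_norm \<Omega> w" if w: "w \<in> W12 \<Omega>" for w
  proof -
    note [measurable] = W12_component(1)[OF w]
    define n2 where "n2 = (LINT x|lebesgue_on \<Omega>. (norm (w x))\<^sup>2)"
    have n2: "n2 \<ge> 0" by (simp add: n2_def)
    have wi: "(LINT x|lebesgue_on \<Omega>. (w x $ i)\<^sup>2) \<le> n2"
      unfolding n2_def using W12_component(2,3)[OF w]
      by (intro integral_mono) (auto simp: component_square_le_norm_square)
    have W: "sqrt n2 \<le> W12_norm \<Omega> w" unfolding W12_norm_def n2_def by (intro real_sqrt_le_mono) simp
    have l: "\<bar>l w\<bar> \<le> t * n2 + A / t" if "t > 0" for t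
    proof -
      have "\<bar>l w\<bar> \<le> t * (LINT x|lebesgue_on \<Omega>. (w x $ i)\<^sup>2) + (LINT x|lebesgue_on \<Omega>. (h x)\<^sup>2) / t"
        unfolding l_def by (rule integral_mult_le_Young) (use W12_component(2)[OF w] h2 that in auto)
      also have "\<dots> \<le> t * n2 + A / t" using wi that by (simp add: A_def)
      finally show ?thesis .
    qed
    have "\<bar>l w\<bar> \<le> (1 + A) * sqrt n2"
    proof (cases "n2 = 0")
      case True
      \<comment> \<open>When n2 vanishes only A / t remains, and a large t makes it as small as
        desired.\<close>
      have "\<bar>l w\<bar> \<le> 0 + e" if "e > 0" for e
      proof -
        have "A / ((A + 1) / e) \<le> e"
          using that \<open>A \<ge> 0\<close> by (simp add: pos_divide_le_eq algebra_simps)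
        then show ?thesis using l[of "(A + 1) / e"] that \<open>A \<ge> 0\<close> True by simp
      qed
      then have "\<bar>l w\<bar> \<le> 0" by (rule field_le_epsilon)
      then show ?thesis using True by simp
    next
      case False
      with n2 have p: "sqrt n2 > 0" by simp
      have "n2 = sqrt n2 * sqrt n2" using n2 by simp
      \<comment> \<open>The choice t = 1 / sqrt n2 makes both terms of Young's inequality
        proportional to the norm.\<close>
      then have "(1 / sqrt n2) * n2 + A / (1 / sqrt n2) = (1 + A) * sqrt n2"
        using p by (simp add: field_simps)
      then show ?thesis using l[of "1 / sqrt n2"] p by simp
    qed
    also have "\<dots> \<le> (1 + A) * W12_norm \<Omega> w" using W \<open>A \<ge> 0\<close> by (intro mult_left_mono) auto
    finally show ?thesis .
  qed
  have "l (\<lambda>x. w x + w' x) = l w + l w'" if "w \<in> W12 \<Omega>" "w' \<in> W12 \<Omega>" for w w'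
    unfolding l_def using int[OF that(1)] int[OF that(2)] by (simp add: distrib_right)
  moreover have "l (\<lambda>x. c *\<^sub>R w x) = c * l w" for c w
    unfolding l_def by (simp add: mult.assoc)
  ultimately have "l \<in> W12_dual \<Omega>" unfolding W12_dual_def using bound by blast
  then have "(\<lambda>n. l (u n)) \<longlonglongrightarrow> l v" using conv by (simp add: weakly_converges_W12_def)
  then show ?thesis by (simp add: l_def)
qed

lemma borel_measurable_wgrad_component:
  assumes "D \<in> borel_measurable M"
  shows "(\<lambda>x. (D x :: real^3^3) $ i $ j) \<in> borel_measurable M"
  by (rule measurable_compose[OF assms]) (intro borel_measurable_continuous_onI continuous_intros)

lemma matrix_component_square_le: "(A $ i $ j)\<^sup>2 \<le> (norm (A :: real^'n^'m))\<^sup>2"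
  using component_le_norm_cart[of "A $ i" j] Finite_Cartesian_Product.norm_nth_le[of A i]
  by (simp flip: abs_le_square_iff)

lemma wgrad_component_square_integrable:
  assumes "open \<Omega>" "u \<in> W12 \<Omega>"
  shows "integrable (lebesgue_on \<Omega>) (\<lambda>x. (wgrad \<Omega> u x $ i $ j)\<^sup>2)"
proof (rule Bochner_Integration.integrable_bound[OF wgrad_W12(3)[OF assms]])
  show "(\<lambda>x. (wgrad \<Omega> u x $ i $ j)\<^sup>2) \<in> borel_measurable (lebesgue_on \<Omega>)"
    by (intro borel_measurable_power borel_measurable_wgrad_component wgrad_W12(2) assms)
  show "AE x in lebesgue_on \<Omega>. norm ((wgrad \<Omega> u x $ i $ j)\<^sup>2) \<le> norm ((norm (wgrad \<Omega> u x))\<^sup>2)"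
    by (simp add: matrix_component_square_le)
qed

text \<open>The weak identity puts the derivative on \<open>\<phi>\<close>, and the maps converge
  against that bounded function.\<close>

lemma weakly_converges_W12_wgrad:
  assumes \<Omega>: "open \<Omega>" "bounded \<Omega>" and conv: "weakly_converges_W12 \<Omega> u v" and \<phi>: "\<phi> \<in> test_functions \<Omega>"
  shows "(\<lambda>n. LINT x|lebesgue_on \<Omega>. wgrad \<Omega> (u n) x $ i $ j * \<phi> x) \<longlonglongrightarrow>
    (LINT x|lebesgue_on \<Omega>. wgrad \<Omega> v x $ i $ j * \<phi> x)"
proof -
  define d where "d x = frechet_derivative \<phi> (at x) (axis j 1)" for x
  have d: "d \<in> test_functions \<Omega>" unfolding d_def by (rule test_functions_frechet_derivative[OF \<phi>])
  obtain B where B: "\<And>x. norm (d x) \<le> B" using test_functions_bounded[OF d] by metis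
  have "(\<lambda>n. LINT x|lebesgue_on \<Omega>. u n x $ i * d x) \<longlonglongrightarrow> (LINT x|lebesgue_on \<Omega>. v x $ i * d x)"
    using B test_functions_imp_measurable(2)[OF d]
    by (intro weakly_converges_W12_integral[OF \<Omega> conv]) (auto intro: measurable_restrict_space1)
  moreover have "(LINT x|lebesgue_on \<Omega>. w x $ i * d x) = - (LINT x|lebesgue_on \<Omega>. wgrad \<Omega> w x $ i $ j * \<phi> x)"
    if "w \<in> W12 \<Omega>" for w
    using wgrad_W12(1)[OF \<Omega>(1) that] \<phi> by (auto simp: has_weak_gradient_def d_def)
  moreover have "u n \<in> W12 \<Omega>" "v \<in> W12 \<Omega>" for n using conv by (auto simp: weakly_converges_W12_def)
  ultimately show ?thesis by (simp add: tendsto_minus_cancel_left)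
qed

section \<open>Strong convergence of gradients where their norms converge\<close>

lemma inner_matrix_eq_sum:
  "(A :: real^'n^'m) \<bullet> B = (\<Sum>i\<in>UNIV. \<Sum>j\<in>UNIV. A $ i $ j * B $ i $ j)"
  by (simp add: inner_vec_def)

text \<open>The cross term pairs the gradients of \<open>u n\<close> with \<open>\<eta>\<close>
  times the gradient of v. This is an \<open>L^2\<close> field with compact support but not a test
  function, which is why weak convergence first had to be extended by density.\<close>

lemma strong_convergence_wgrad_weighted:
  assumes \<Omega>: "open \<Omega>" "bounded \<Omega>" and conv: "weakly_converges_W12 \<Omega> u v"
    and B: "\<And>n. (LINT x|lebesgue_on \<Omega>. (norm (wgrad \<Omega> (u n) x))\<^sup>2) \<le> B"
    and \<eta>: "continuous_on UNIV \<eta>" "compact (supp \<eta>)" "supp \<eta> \<subseteq> \<Omega>"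
    and norms: "(\<lambda>n. LINT x|lebesgue_on \<Omega>. \<eta> x * (norm (wgrad \<Omega> (u n) x))\<^sup>2) \<longlonglongrightarrow>
       (LINT x|lebesgue_on \<Omega>. \<eta> x * (norm (wgrad \<Omega> v x))\<^sup>2)"
  shows "(\<lambda>n. LINT x|lebesgue_on \<Omega>. \<eta> x * (norm (wgrad \<Omega> (u n) x - wgrad \<Omega> v x))\<^sup>2) \<longlonglongrightarrow> 0"
proof -
  have W: "u n \<in> W12 \<Omega>" "v \<in> W12 \<Omega>" for n using conv by (auto simp: weakly_converges_W12_def)
  note wm[measurable] = wgrad_W12(2)[OF \<Omega>(1) W(1)] wgrad_W12(2)[OF \<Omega>(1) W(2)]
  note cm[measurable] = borel_measurable_wgrad_component[OF wm(1)] borel_measurable_wgrad_component[OF wm(2)]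
  have \<eta>m: "\<eta> \<in> borel_measurable lebesgue"
    using borel_measurable_continuous_onI[OF \<eta>(1)] by (simp add: measurable_completion)
  then have [measurable]: "\<eta> \<in> borel_measurable (lebesgue_on \<Omega>)" by (rule measurable_restrict_space1)
  have \<eta>0: "\<eta> x = 0" if "x \<notin> supp \<eta>" for x
    using that closure_subset[of "{x. \<eta> x \<noteq> 0}"] by (auto simp: supp_def)
  have "bounded (\<eta> ` supp \<eta>)"
    by (intro compact_imp_bounded compact_continuous_image continuous_on_subset[OF \<eta>(1)] \<eta>(2)) auto
  then obtain C where C: "C > 0" "\<And>x. x \<in> supp \<eta> \<Longrightarrow> \<bar>\<eta> x\<bar> \<le> C" by (auto simp: bounded_pos)
  have \<eta>C: "\<bar>\<eta> x\<bar> \<le> C" for x using C \<eta>0[of x] by (cases "x \<in> supp \<eta>") auto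
  show ?thesis
  proof (rule tendsto_weighted_square_diff[OF _ wm wgrad_W12(3)[OF \<Omega>(1) W(1)] wgrad_W12(3)[OF \<Omega>(1) W(2)] \<eta>C norms])
    \<comment> \<open>The indicator extends the entry by zero: nothing is known about
      \<open>wgrad \<Omega> v\<close> outside \<open>\<Omega>\<close>, whereas the density argument
      wants a function measurable on the whole space.\<close>
    have lim: "(\<lambda>n. LINT x|lebesgue_on \<Omega>. wgrad \<Omega> (u n) x $ i $ j * (\<eta> x * (indicator \<Omega> x * wgrad \<Omega> v x $ i $ j)))
       \<longlonglongrightarrow> (LINT x|lebesgue_on \<Omega>. wgrad \<Omega> v x $ i $ j * (\<eta> x * (indicator \<Omega> x * wgrad \<Omega> v x $ i $ j)))" for i j
    proof (rule weak_convergence_L2_from_test_functions[OF \<Omega>(1) \<eta>(2,3) cm])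
      show "(LINT x|lebesgue_on \<Omega>. (wgrad \<Omega> (u n) x $ i $ j)\<^sup>2) \<le> B" for n
      proof (rule order_trans[OF integral_mono B])
        show "(wgrad \<Omega> (u n) x $ i $ j)\<^sup>2 \<le> (norm (wgrad \<Omega> (u n) x))\<^sup>2" for x
          by (rule matrix_component_square_le)
      qed (use wgrad_component_square_integrable[OF \<Omega>(1) W(1)] wgrad_W12(3)[OF \<Omega>(1) W(1)] in auto)
      have im: "(\<lambda>x. indicator \<Omega> x * wgrad \<Omega> v x $ i $ j) \<in> borel_measurable lebesgue"
        using cm(2) \<Omega>(1) by (subst (asm) borel_measurable_restrict_space_iff) auto
      then show "(\<lambda>x. \<eta> x * (indicator \<Omega> x * wgrad \<Omega> v x $ i $ j)) \<in> borel_measurable lebesgue"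
        by (rule borel_measurable_times[OF \<eta>m])
      have "integrable lebesgue (\<lambda>x. indicator \<Omega> x * (wgrad \<Omega> v x $ i $ j)\<^sup>2)"
        using wgrad_component_square_integrable[OF \<Omega>(1) W(2)] \<Omega>(1) by (simp add: integral_lebesgue_on)
      moreover have "indicator \<Omega> x * (wgrad \<Omega> v x $ i $ j)\<^sup>2 = (indicator \<Omega> x * wgrad \<Omega> v x $ i $ j)\<^sup>2" for x
        by (simp add: indicator_def)
      ultimately have "integrable lebesgue (\<lambda>x. (indicator \<Omega> x * wgrad \<Omega> v x $ i $ j)\<^sup>2 * (\<eta> x)\<^sup>2)"
        using \<eta>m \<eta>C by (intro integrable_mult_bounded[where B = "C\<^sup>2"]) (auto simp: abs_le_square_iff[symmetric] intro: order_trans[OF \<eta>C])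
      then show "integrable lebesgue (\<lambda>x. (\<eta> x * (indicator \<Omega> x * wgrad \<Omega> v x $ i $ j))\<^sup>2)"
        by (simp add: power_mult_distrib mult_ac)
    qed (use \<eta>0 weakly_converges_W12_wgrad[OF \<Omega> conv] wgrad_component_square_integrable[OF \<Omega>(1) W(1)]
          wgrad_component_square_integrable[OF \<Omega>(1) W(2)] in auto)
    have eq: "(LINT x|lebesgue_on \<Omega>. \<eta> x * (wgrad \<Omega> w x \<bullet> wgrad \<Omega> v x)) =
       (\<Sum>i\<in>UNIV. \<Sum>j\<in>UNIV. LINT x|lebesgue_on \<Omega>. wgrad \<Omega> w x $ i $ j * (\<eta> x * (indicator \<Omega> x * wgrad \<Omega> v x $ i $ j)))"
      if w: "w \<in> W12 \<Omega>" for w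
    proof -
      have i1: "integrable (lebesgue_on \<Omega>) (\<lambda>x. wgrad \<Omega> w x $ i $ j * (\<eta> x * (indicator \<Omega> x * wgrad \<Omega> v x $ i $ j)))" for i j
      proof -
        have "integrable (lebesgue_on \<Omega>) (\<lambda>x. (wgrad \<Omega> w x $ i $ j * wgrad \<Omega> v x $ i $ j) * (\<eta> x * indicator \<Omega> x))"
        proof (rule integrable_mult_bounded[where B = C])
          show "integrable (lebesgue_on \<Omega>) (\<lambda>x. wgrad \<Omega> w x $ i $ j * wgrad \<Omega> v x $ i $ j)"
            by (intro integrable_mult_square_integrable cm borel_measurable_wgrad_component wgrad_W12(2)
               wgrad_component_square_integrable \<Omega> W w)
          show "(\<lambda>x. \<eta> x * indicator \<Omega> x) \<in> borel_measurable (lebesgue_on \<Omega>)"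
            using \<Omega>(1) by (intro borel_measurable_times borel_measurable_indicator) (auto simp: sets_restrict_space)
          show "\<bar>\<eta> x * indicator \<Omega> x\<bar> \<le> C" for x using \<eta>C[of x] C(1) by (auto simp: indicator_def)
        qed
        then show ?thesis by (simp add: mult_ac)
      qed
      have "(LINT x|lebesgue_on \<Omega>. \<eta> x * (wgrad \<Omega> w x \<bullet> wgrad \<Omega> v x)) =
         (LINT x|lebesgue_on \<Omega>. (\<Sum>i\<in>UNIV. \<Sum>j\<in>UNIV. wgrad \<Omega> w x $ i $ j * (\<eta> x * (indicator \<Omega> x * wgrad \<Omega> v x $ i $ j))))"
        by (intro Bochner_Integration.integral_cong)
           (auto simp: inner_matrix_eq_sum sum_distrib_left mult_ac)
      also have "\<dots> = (\<Sum>i\<in>UNIV. \<Sum>j\<in>UNIV. LINT x|lebesgue_on \<Omega>. wgrad \<Omega> w x $ i $ j * (\<eta> x * (indicator \<Omega> x * wgrad \<Omega> v x $ i $ j)))"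
        using i1 by (simp add: Bochner_Integration.integral_sum)
      finally show ?thesis .
    qed
    show "(\<lambda>n. LINT x|lebesgue_on \<Omega>. \<eta> x * (wgrad \<Omega> (u n) x \<bullet> wgrad \<Omega> v x)) \<longlonglongrightarrow>
        (LINT x|lebesgue_on \<Omega>. \<eta> x * (wgrad \<Omega> v x \<bullet> wgrad \<Omega> v x))"
      unfolding eq[OF W(1)] eq[OF W(2)] by (intro tendsto_sum lim)
  qed measurable
qed

lemma integrable_norm_diff_square:
  fixes f g :: "'a \<Rightarrow> 'b::euclidean_space"
  assumes [measurable]: "f \<in> borel_measurable M" "g \<in> borel_measurable M"
    and "integrable M (\<lambda>x. (norm (f x))\<^sup>2)" "integrable M (\<lambda>x. (norm (g x))\<^sup>2)"
  shows "integrable M (\<lambda>x. (norm (f x - g x))\<^sup>2)"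
proof (rule Bochner_Integration.integrable_bound)
  show "integrable M (\<lambda>x. 2 * (norm (f x))\<^sup>2 + 2 * (norm (g x))\<^sup>2)"
    using assms by auto
  have "(norm (f x - g x))\<^sup>2 \<le> 2 * (norm (f x))\<^sup>2 + 2 * (norm (g x))\<^sup>2" for x
    using order_trans[OF power_mono[OF norm_triangle_ineq4[of "f x" "g x"], of 2] add_square_le] by simp
  then show "AE x in M. norm ((norm (f x - g x))\<^sup>2) \<le> norm (2 * (norm (f x))\<^sup>2 + 2 * (norm (g x))\<^sup>2)" by simp
qed measurable

text \<open>A weight that is positive on K dominates a multiple of the indicator of K. The
  first-power version feeds the translation estimate, the squared one the uniform integrability of
  the integrands.\<close>

lemma strong_convergence_wgrad_compact:
  assumes \<Omega>: "open \<Omega>" "bounded \<Omega>" and conv: "weakly_converges_W12 \<Omega> u v"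
    and B: "\<And>n. (LINT x|lebesgue_on \<Omega>. (norm (wgrad \<Omega> (u n) x))\<^sup>2) \<le> B"
    and V: "open V" "V \<subseteq> \<Omega>" and K: "compact K" "K \<subseteq> V"
    and norms: "\<And>\<eta>. continuous_on UNIV \<eta> \<Longrightarrow> compact (supp \<eta>) \<Longrightarrow> supp \<eta> \<subseteq> V \<Longrightarrow>
      (\<lambda>n. LINT x|lebesgue_on \<Omega>. \<eta> x * (norm (wgrad \<Omega> (u n) x))\<^sup>2) \<longlonglongrightarrow>
       (LINT x|lebesgue_on \<Omega>. \<eta> x * (norm (wgrad \<Omega> v x))\<^sup>2)"
  shows "(\<lambda>n. LINT x|lebesgue_on \<Omega>. indicator K x * (norm (wgrad \<Omega> (u n) x - wgrad \<Omega> v x))\<^sup>2) \<longlonglongrightarrow> 0"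
    and "(\<lambda>n. LINT x|lebesgue_on \<Omega>. indicator K x * norm (wgrad \<Omega> (u n) x - wgrad \<Omega> v x)) \<longlonglongrightarrow> 0"
    and "\<And>n. integrable (lebesgue_on \<Omega>) (\<lambda>x. indicator K x * (norm (wgrad \<Omega> (u n) x - wgrad \<Omega> v x))\<^sup>2)"
    and "\<And>n. integrable (lebesgue_on \<Omega>) (\<lambda>x. indicator K x * norm (wgrad \<Omega> (u n) x - wgrad \<Omega> v x))"
proof -
  have W: "u n \<in> W12 \<Omega>" "v \<in> W12 \<Omega>" for n using conv by (auto simp: weakly_converges_W12_def)
  note wm[measurable] = wgrad_W12(2)[OF \<Omega>(1) W(1)] wgrad_W12(2)[OF \<Omega>(1) W(2)]
  have Ks: "K \<in> sets (lebesgue_on \<Omega>)"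
    using K V \<Omega> by (auto simp: sets_restrict_space_iff lmeasurable_compact fmeasurableD)
  then have Km[measurable]: "(indicator K :: _ \<Rightarrow> real) \<in> borel_measurable (lebesgue_on \<Omega>)" by measurable
  define d where "d n x = norm (wgrad \<Omega> (u n) x - wgrad \<Omega> v x)" for n x
  have dm[measurable]: "d n \<in> borel_measurable (lebesgue_on \<Omega>)" for n unfolding d_def by measurable
  have d2: "integrable (lebesgue_on \<Omega>) (\<lambda>x. (d n x)\<^sup>2)" for n
    unfolding d_def by (rule integrable_norm_diff_square) (use wm wgrad_W12(3)[OF \<Omega>(1)] W in auto)
  have Kd2: "integrable (lebesgue_on \<Omega>) (\<lambda>x. indicator K x * (d n x)\<^sup>2)" for n
    using integrable_mult_bounded[OF d2 Km, of 1] by (simp add: mult.commute indicator_def)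
  have iK: "integrable (lebesgue_on \<Omega>) (\<lambda>x. (indicator K x)\<^sup>2 :: real)"
  proof -
    have "integrable (lebesgue_on \<Omega>) (\<lambda>x. 1 * indicator K x :: real)"
      by (rule integrable_mult_bounded[OF integrable_lebesgue_on_const[OF \<Omega>] Km, of 1]) (simp add: indicator_def)
    then show ?thesis
    proof (rule Bochner_Integration.integrable_bound)
      show "(\<lambda>x. (indicator K x)\<^sup>2 :: real) \<in> borel_measurable (lebesgue_on \<Omega>)" using Km by measurable
    qed (auto simp: indicator_def)
  qed
  have sq: "(indicator K x * d n x)\<^sup>2 = indicator K x * (d n x)\<^sup>2" for n x by (simp add: indicator_def)
  have Kd: "integrable (lebesgue_on \<Omega>) (\<lambda>x. indicator K x * d n x)" for n
    by (rule integrable_mult_square_integrable) (use iK d2 in auto)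
  obtain \<eta> :: "real^3 \<Rightarrow> real" where \<eta>: "\<eta> \<in> test_functions V" "\<And>x. \<eta> x \<ge> 0" "\<And>x. x \<in> K \<Longrightarrow> \<eta> x > 0"
    using test_function_pos_on_compact[OF K(1) V(1) K(2)] by metis
  have \<eta>': "continuous_on UNIV \<eta>" "compact (supp \<eta>)" "supp \<eta> \<subseteq> V"
    using \<eta>(1) by (auto simp: test_functions_def intro: smooth_on_imp_continuous_on)
  \<comment> \<open>The minimum of \<open>\<eta>\<close> on K; then \<open>\<eta>\<close> / c
    dominates the indicator. For empty K any positive number serves.\<close>
  obtain c where c: "c > 0" "\<And>x. x \<in> K \<Longrightarrow> \<eta> x \<ge> c"
  proof (cases "K = {}")
    case False
    then obtain y where "y \<in> K" "\<forall>x\<in>K. \<eta> y \<le> \<eta> x"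
      using continuous_attains_inf[OF K(1) _ continuous_on_subset[OF \<eta>'(1)]] by blast
    then show thesis using that[of "\<eta> y"] \<eta>(3) by auto
  qed (use that[of 1] in auto)
  obtain C where C: "\<And>x. norm (\<eta> x) \<le> C" using test_functions_bounded[OF \<eta>(1)] by metis
  have \<eta>m: "\<eta> \<in> borel_measurable (lebesgue_on \<Omega>)"
    using test_functions_imp_measurable(2)[OF \<eta>(1)] by (rule measurable_restrict_space1)
  have i\<eta>: "integrable (lebesgue_on \<Omega>) (\<lambda>x. \<eta> x * (d n x)\<^sup>2)" for n
    using integrable_mult_bounded[OF d2 \<eta>m, of C] C by (simp add: mult.commute)
  have lim: "(\<lambda>n. LINT x|lebesgue_on \<Omega>. indicator K x * (d n x)\<^sup>2) \<longlonglongrightarrow> 0"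
  proof (rule tendsto_sandwich[OF _ _ tendsto_const])
    have "(\<lambda>n. LINT x|lebesgue_on \<Omega>. \<eta> x * (d n x)\<^sup>2) \<longlonglongrightarrow> 0"
      unfolding d_def using \<eta>' V(2) by (intro strong_convergence_wgrad_weighted[OF \<Omega> conv B] norms) auto
    from tendsto_mult_left[OF this, of "1 / c"]
    show "(\<lambda>n. 1 / c * (LINT x|lebesgue_on \<Omega>. \<eta> x * (d n x)\<^sup>2)) \<longlonglongrightarrow> 0" by simp
    have "(LINT x|lebesgue_on \<Omega>. indicator K x * (d n x)\<^sup>2) \<le> 1 / c * (LINT x|lebesgue_on \<Omega>. \<eta> x * (d n x)\<^sup>2)" for n
    proof -
      have "(LINT x|lebesgue_on \<Omega>. indicator K x * (d n x)\<^sup>2) \<le> (LINT x|lebesgue_on \<Omega>. 1 / c * (\<eta> x * (d n x)\<^sup>2))"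
      proof (rule integral_mono)
        fix x
        have "indicator K x \<le> 1 / c * \<eta> x" using c \<eta>(2)[of x] by (auto simp: indicator_def)
        from mult_right_mono[OF this, of "(d n x)\<^sup>2"]
        show "indicator K x * (d n x)\<^sup>2 \<le> 1 / c * (\<eta> x * (d n x)\<^sup>2)" by simp
      qed (use Kd2 i\<eta> in auto)
      then show ?thesis by simp
    qed
    then show "\<forall>\<^sub>F n in sequentially. (LINT x|lebesgue_on \<Omega>. indicator K x * (d n x)\<^sup>2) \<le> 1 / c * (LINT x|lebesgue_on \<Omega>. \<eta> x * (d n x)\<^sup>2)"
      by simp
  qed (auto intro!: always_eventually integral_nonneg_AE)
  moreover have "(\<lambda>n. LINT x|lebesgue_on \<Omega>. indicator K x * d n x) \<longlonglongrightarrow> 0"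
  proof (rule LIMSEQ_I)
    fix e :: real assume "e > 0"
    define m where "m = (LINT x|lebesgue_on \<Omega>. (indicator K x)\<^sup>2 :: real)"
    have m: "m \<ge> 0" by (simp add: m_def)
    \<comment> \<open>This makes t * m at most e / 2; the other Young term drops below e / 2 once
      the squared integral is below t * (e / 2).\<close>
    define t where "t = e / (2 * (m + 1))"
    have t: "t > 0" "t * m \<le> e / 2"
      using \<open>e > 0\<close> m by (auto simp: t_def field_simps add_pos_nonneg)
    obtain N where N: "\<And>n. n \<ge> N \<Longrightarrow> \<bar>LINT x|lebesgue_on \<Omega>. indicator K x * (d n x)\<^sup>2\<bar> < t * (e / 2)"
      using LIMSEQ_D[OF lim, of "t * (e / 2)"] t \<open>e > 0\<close> by auto
    show "\<exists>N. \<forall>n\<ge>N. norm ((LINT x|lebesgue_on \<Omega>. indicator K x * d n x) - 0) < e"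
    proof (intro exI allI impI)
      fix n assume "n \<ge> N"
      have "(LINT x|lebesgue_on \<Omega>. indicator K x * d n x) = (LINT x|lebesgue_on \<Omega>. indicator K x * (indicator K x * d n x))"
        by (intro Bochner_Integration.integral_cong) (auto simp: indicator_def)
      also have "\<bar>\<dots>\<bar> \<le> t * m + (LINT x|lebesgue_on \<Omega>. (indicator K x * d n x)\<^sup>2) / t"
        unfolding m_def by (rule integral_mult_le_Young) (use t iK Kd2 in \<open>auto simp: sq\<close>)
      also have "\<dots> < e / 2 + e / 2"
        using N[OF \<open>n \<ge> N\<close>] t unfolding sq by (intro add_le_less_mono) (auto simp: divide_less_eq mult.commute)
      finally show "norm ((LINT x|lebesgue_on \<Omega>. indicator K x * d n x) - 0) < e" by simp
    qed
  qed
  ultimately show "(\<lambda>n. LINT x|lebesgue_on \<Omega>. indicator K x * (norm (wgrad \<Omega> (u n) x - wgrad \<Omega> v x))\<^sup>2) \<longlonglongrightarrow> 0"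
    and "(\<lambda>n. LINT x|lebesgue_on \<Omega>. indicator K x * norm (wgrad \<Omega> (u n) x - wgrad \<Omega> v x)) \<longlonglongrightarrow> 0"
    by (simp_all add: d_def)
  show "\<And>n. integrable (lebesgue_on \<Omega>) (\<lambda>x. indicator K x * (norm (wgrad \<Omega> (u n) x - wgrad \<Omega> v x))\<^sup>2)"
    and "\<And>n. integrable (lebesgue_on \<Omega>) (\<lambda>x. indicator K x * norm (wgrad \<Omega> (u n) x - wgrad \<Omega> v x))"
    using Kd2 Kd by (simp_all add: d_def)
qed

section \<open>Local strong convergence of the maps\<close>

text \<open>Sobolev functions are only Lebesgue measurable, while the translation argument is
  carried out for \<open>lborel\<close>; this supplies the Borel representatives, coordinate by
  coordinate.\<close>

lemma borel_version:
  fixes f :: "'a::euclidean_space \<Rightarrow> 'b::euclidean_space"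
  assumes f: "f \<in> borel_measurable lebesgue"
  obtains g where "g \<in> borel_measurable borel" "AE x in lebesgue. f x = g x"
proof -
  have "\<exists>g\<in>borel_measurable lborel. (AE x in lebesgue. f x \<bullet> b = g x)" for b
    using completion_ex_borel_measurable_real[OF borel_measurable_inner[OF f borel_measurable_const[of b]]]
    by (auto intro: AE_completion)
  then obtain g where g: "\<And>b. g b \<in> borel_measurable lborel" "\<And>b. AE x in lebesgue. f x \<bullet> b = g b x" by metis
  then have [measurable]: "g b \<in> borel_measurable borel" for b by simp
  show thesis
  proof
    show "(\<lambda>x. \<Sum>b\<in>Basis. g b x *\<^sub>R b) \<in> borel_measurable borel" by measurable
    have "AE x in lebesgue. \<forall>b\<in>Basis. f x \<bullet> b = g b x" using g(2) by (intro AE_finite_allI) auto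
    then show "AE x in lebesgue. f x = (\<Sum>b\<in>Basis. g b x *\<^sub>R b)"
    proof eventually_elim
      case (elim x)
      have "f x = (\<Sum>b\<in>Basis. (f x \<bullet> b) *\<^sub>R b)" by (simp add: euclidean_representation)
      also have "\<dots> = (\<Sum>b\<in>Basis. g b x *\<^sub>R b)" using elim by (intro sum.cong) auto
      finally show ?case .
    qed
  qed
qed

lemma integral_lborel_eq_lebesgue:
  fixes f g :: "'a::euclidean_space \<Rightarrow> 'b::{banach, second_countable_topology}"
  assumes g: "g \<in> borel_measurable borel" and f: "f \<in> borel_measurable lebesgue" and "AE x in lebesgue. f x = g x"
  shows "(LINT x|lborel. g x) = (LINT x|lebesgue. f x)"
    and "integrable lborel g \<longleftrightarrow> integrable lebesgue f"
proof -
  have g': "g \<in> borel_measurable lebesgue" "g \<in> borel_measurable lborel" using g by (auto simp: measurable_completion)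
  have "(LINT x|lebesgue. f x) = (LINT x|lebesgue. g x)" using assms g' by (intro integral_cong_AE) auto
  then show "(LINT x|lborel. g x) = (LINT x|lebesgue. f x)" using integral_completion[OF g'(2)] by simp
  have "integrable lebesgue f \<longleftrightarrow> integrable lebesgue g" using assms g' by (intro integrable_cong_AE) auto
  then show "integrable lborel g \<longleftrightarrow> integrable lebesgue f" using integrable_completion[OF g'(2)] by simp
qed

lemma linear_eq_sum_axis:
  fixes f :: "real^'n \<Rightarrow> real"
  assumes "linear f"
  shows "f h = (\<Sum>j\<in>UNIV. h $ j * f (axis j 1))"
proof -
  have "f h = f (\<Sum>j\<in>UNIV. h $ j *\<^sub>R axis j 1)"
    using basis_expansion[of h] by (simp add: scalar_mult_eq_scaleR)
  then show ?thesis using assms by (simp add: linear_sum linear_scale)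
qed

lemma test_functions_mono: "f \<in> test_functions U \<Longrightarrow> U \<subseteq> V \<Longrightarrow> f \<in> test_functions V"
  by (auto simp: test_functions_def)

lemma W12_component_integrable:
  assumes "open \<Omega>" "bounded \<Omega>" "w \<in> W12 \<Omega>"
  shows "integrable (lebesgue_on \<Omega>) (\<lambda>x. w x $ i)"
  by (rule square_integrable_imp_integrable[OF assms(1,2) W12_component(1,2)[OF assms(3)]])

lemma wgrad_component_integrable:
  assumes "open \<Omega>" "bounded \<Omega>" "w \<in> W12 \<Omega>"
  shows "integrable (lebesgue_on \<Omega>) (\<lambda>x. wgrad \<Omega> w x $ i $ j)"
  by (rule square_integrable_imp_integrable[OF assms(1,2)
        borel_measurable_wgrad_component[OF wgrad_W12(2)[OF assms(1,3)]]
        wgrad_component_square_integrable[OF assms(1,3)]])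

text \<open>By linearity of the derivative, the identities for the coordinate directions combine to
  the one for an arbitrary h, the form that \<open>weak_grad_L1\<close> requires.\<close>

lemma weak_gradient_directional:
  assumes \<Omega>: "open \<Omega>" "bounded \<Omega>" and w: "w \<in> W12 \<Omega>" and \<phi>: "\<phi> \<in> test_functions \<Omega>"
  shows "(LINT x|lebesgue_on \<Omega>. w x $ i * frechet_derivative \<phi> (at x) h) =
      - (LINT x|lebesgue_on \<Omega>. (wgrad \<Omega> w x $ i \<bullet> h) * \<phi> x)"
    and "integrable (lebesgue_on \<Omega>) (\<lambda>x. w x $ i * frechet_derivative \<phi> (at x) h)"
    and "integrable (lebesgue_on \<Omega>) (\<lambda>x. (wgrad \<Omega> w x $ i \<bullet> h) * \<phi> x)"
proof -
  have lin: "linear (frechet_derivative \<phi> (at x))" for x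
    using \<phi> by (intro has_derivative_linear[OF smooth_on_has_derivative[of _ UNIV]]) (auto simp: test_functions_def)
  have i1: "integrable (lebesgue_on \<Omega>) (\<lambda>x. w x $ i * frechet_derivative \<phi> (at x) k)" for k
  proof -
    have d: "(\<lambda>x. frechet_derivative \<phi> (at x) k) \<in> test_functions \<Omega>"
      by (rule test_functions_frechet_derivative[OF \<phi>])
    obtain B where "\<And>x. norm (frechet_derivative \<phi> (at x) k) \<le> B" using test_functions_bounded[OF d] by metis
    then show ?thesis
      by (intro integrable_mult_bounded[where B = B] W12_component_integrable[OF \<Omega> w]
          measurable_restrict_space1[OF test_functions_imp_measurable(2)[OF d]]) auto
  qed
  then show "integrable (lebesgue_on \<Omega>) (\<lambda>x. w x $ i * frechet_derivative \<phi> (at x) h)" .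
  have i2: "integrable (lebesgue_on \<Omega>) (\<lambda>x. wgrad \<Omega> w x $ i $ j * \<phi> x)" for j
  proof -
    obtain B where "\<And>x. norm (\<phi> x) \<le> B" using test_functions_bounded[OF \<phi>] by metis
    then show ?thesis
      by (intro integrable_mult_bounded[where B = B] wgrad_component_integrable[OF \<Omega> w]
          measurable_restrict_space1[OF test_functions_imp_measurable(2)[OF \<phi>]]) auto
  qed
  have eq2: "(wgrad \<Omega> w x $ i \<bullet> h) * \<phi> x = (\<Sum>j\<in>UNIV. h $ j * (wgrad \<Omega> w x $ i $ j * \<phi> x))" for x
    by (simp add: inner_vec_def sum_distrib_right sum_distrib_left mult_ac)
  then show "integrable (lebesgue_on \<Omega>) (\<lambda>x. (wgrad \<Omega> w x $ i \<bullet> h) * \<phi> x)"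
    using i2 by simp
  have "(LINT x|lebesgue_on \<Omega>. w x $ i * frechet_derivative \<phi> (at x) h) =
     (LINT x|lebesgue_on \<Omega>. (\<Sum>j\<in>UNIV. h $ j * (w x $ i * frechet_derivative \<phi> (at x) (axis j 1))))"
    by (subst linear_eq_sum_axis[OF lin]) (simp add: sum_distrib_left mult_ac)
  also have "\<dots> = (\<Sum>j\<in>UNIV. h $ j * (LINT x|lebesgue_on \<Omega>. w x $ i * frechet_derivative \<phi> (at x) (axis j 1)))"
    using i1 by (subst Bochner_Integration.integral_sum) auto
  also have "\<dots> = - (\<Sum>j\<in>UNIV. h $ j * (LINT x|lebesgue_on \<Omega>. wgrad \<Omega> w x $ i $ j * \<phi> x))"
    using wgrad_W12(1)[OF \<Omega>(1) w] \<phi> by (simp add: has_weak_gradient_def sum_negf)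
  also have "(\<Sum>j\<in>UNIV. h $ j * (LINT x|lebesgue_on \<Omega>. wgrad \<Omega> w x $ i $ j * \<phi> x))
     = (LINT x|lebesgue_on \<Omega>. (wgrad \<Omega> w x $ i \<bullet> h) * \<phi> x)"
    unfolding eq2 using i2 by (subst Bochner_Integration.integral_sum) auto
  finally show "(LINT x|lebesgue_on \<Omega>. w x $ i * frechet_derivative \<phi> (at x) h) =
      - (LINT x|lebesgue_on \<Omega>. (wgrad \<Omega> w x $ i \<bullet> h) * \<phi> x)" .
qed

text \<open>The abstract convergence result is applied to a component of \<open>u n\<close> - v,
  extended by zero outside \<open>\<Omega>\<close> and replaced by a Borel version. The extension
  may fail to have a weak gradient across the boundary, but test functions are supported in V,
  inside \<open>\<Omega>\<close>.\<close>

lemma local_L1_convergence_W12: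
  assumes \<Omega>: "open \<Omega>" "bounded \<Omega>" and conv: "weakly_converges_W12 \<Omega> u v"
    and M: "\<And>n. AE x in lebesgue_on \<Omega>. norm (u n x) \<le> M"
    and V: "open V" "V \<subseteq> \<Omega>" and K: "compact K" "K \<subseteq> V"
    and grad: "\<And>K'. compact K' \<Longrightarrow> K' \<subseteq> V \<Longrightarrow>
      (\<lambda>n. LINT x|lebesgue_on \<Omega>. indicator K' x * norm (wgrad \<Omega> (u n) x - wgrad \<Omega> v x)) \<longlonglongrightarrow> 0"
    and gradi: "\<And>K' n. compact K' \<Longrightarrow> K' \<subseteq> V \<Longrightarrow>
      integrable (lebesgue_on \<Omega>) (\<lambda>x. indicator K' x * norm (wgrad \<Omega> (u n) x - wgrad \<Omega> v x))"
  shows "(\<lambda>n. LINT x|lebesgue_on \<Omega>. indicator K x * \<bar>u n x $ i - v x $ i\<bar>) \<longlonglongrightarrow> 0"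
proof -
  have \<Omega>s: "\<Omega> \<in> sets lebesgue" using \<Omega> by simp
  have W: "u n \<in> W12 \<Omega>" "v \<in> W12 \<Omega>" for n using conv by (auto simp: weakly_converges_W12_def)
  define a where "a n x = indicator \<Omega> x * (u n x $ i - v x $ i)" for n x
  define G where "G n x = indicator \<Omega> x *\<^sub>R (wgrad \<Omega> (u n) x $ i - wgrad \<Omega> v x $ i)" for n x
  have i_u: "integrable (lebesgue_on \<Omega>) (\<lambda>x. w x $ i)" if "w \<in> W12 \<Omega>" for w
    by (rule W12_component_integrable[OF \<Omega> that])
  have ai: "integrable lebesgue (a n)" for n
    using Bochner_Integration.integrable_diff[OF i_u[OF W(1)[of n]] i_u[OF W(2)]]
    unfolding a_def integral_lebesgue_on(2)[OF \<Omega>s] by simp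
  have Gi: "integrable lebesgue (G n)" for n
  proof -
    have m: "(\<lambda>x. wgrad \<Omega> (u n) x - wgrad \<Omega> v x) \<in> borel_measurable (lebesgue_on \<Omega>)"
      using wgrad_W12(2)[OF \<Omega>(1) W(1)] wgrad_W12(2)[OF \<Omega>(1) W(2)] by (rule borel_measurable_diff)
    have "integrable (lebesgue_on \<Omega>) (\<lambda>x. norm (wgrad \<Omega> (u n) x - wgrad \<Omega> v x))"
      by (rule square_integrable_imp_integrable[OF \<Omega> measurable_compose[OF m borel_measurable_norm]])
         (intro integrable_norm_diff_square wgrad_W12 \<Omega> W)
    then have "integrable (lebesgue_on \<Omega>) (\<lambda>x. wgrad \<Omega> (u n) x - wgrad \<Omega> v x)"
      using integrable_norm_iff[OF m] by simp
    then have "integrable (lebesgue_on \<Omega>) (\<lambda>x. (wgrad \<Omega> (u n) x - wgrad \<Omega> v x) $ i)"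
      by (rule integrable_bounded_linear[OF bounded_linear_vec_nth])
    then show ?thesis unfolding G_def by (simp add: integral_lebesgue_on(2)[OF \<Omega>s])
  qed
  note am[measurable] = borel_measurable_integrable[OF ai] and Gm[measurable] = borel_measurable_integrable[OF Gi]
  have "\<exists>w. w \<in> borel_measurable borel \<and> (AE x in lebesgue. a n x = w x)" for n
    using borel_version[OF am] by metis
  then obtain w where w: "\<And>n. w n \<in> borel_measurable borel" "\<And>n. AE x in lebesgue. a n x = w n x" by metis
  have "\<exists>D. D \<in> borel_measurable borel \<and> (AE x in lebesgue. G n x = D x)" for n
    using borel_version[OF Gm] by metis
  then obtain D where D: "\<And>n. D n \<in> borel_measurable borel" "\<And>n. AE x in lebesgue. G n x = D n x" by metis
  note [measurable] = w(1) D(1)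
  have eq_w: "(LINT x|lborel. w n x * k x) = (LINT x|lebesgue_on \<Omega>. (u n x $ i - v x $ i) * k x)"
    if k[measurable]: "k \<in> borel_measurable borel" for k :: "real^3 \<Rightarrow> real" and n
  proof -
    have [measurable]: "k \<in> borel_measurable lebesgue" using k by (simp add: measurable_completion)
    have "(LINT x|lborel. w n x * k x) = (LINT x|lebesgue. a n x * k x)"
      by (rule integral_lborel_eq_lebesgue) (use w(2)[of n] in \<open>measurable, auto elim!: eventually_mono\<close>)
    then show ?thesis by (simp add: integral_lebesgue_on(1)[OF \<Omega>s] a_def mult.assoc)
  qed
  have weak: "weak_grad_L1 V (w n) (D n)" for n
    unfolding weak_grad_L1_def
  proof (intro conjI ballI allI)
    show "integrable lborel (w n)" using integral_lborel_eq_lebesgue(2)[OF w(1) am w(2)] ai by simp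
    show "integrable lborel (D n)" using integral_lborel_eq_lebesgue(2)[OF D(1) Gm D(2)] Gi by simp
    fix \<phi> :: "real^3 \<Rightarrow> real" and h assume "\<phi> \<in> test_functions V"
    then have \<phi>: "\<phi> \<in> test_functions \<Omega>" using V(2) by (rule test_functions_mono)
    note \<phi>m[measurable] = test_functions_imp_measurable[OF \<phi>]
    note wg = weak_gradient_directional[OF \<Omega> W(1) \<phi>] weak_gradient_directional[OF \<Omega> W(2) \<phi>]
    have "(LINT x|lborel. w n x * frechet_derivative \<phi> (at x) h) =
       (LINT x|lebesgue_on \<Omega>. (u n x $ i - v x $ i) * frechet_derivative \<phi> (at x) h)"
      by (rule eq_w[OF test_functions_imp_measurable(1)[OF test_functions_frechet_derivative[OF \<phi>]]])
    also have "\<dots> = - (LINT x|lebesgue_on \<Omega>. ((wgrad \<Omega> (u n) x $ i - wgrad \<Omega> v x $ i) \<bullet> h) * \<phi> x)"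
      using wg by (simp add: left_diff_distrib inner_diff_left)
    also have "(LINT x|lebesgue_on \<Omega>. ((wgrad \<Omega> (u n) x $ i - wgrad \<Omega> v x $ i) \<bullet> h) * \<phi> x) = (LINT x|lebesgue. (G n x \<bullet> h) * \<phi> x)"
      by (simp add: integral_lebesgue_on(1)[OF \<Omega>s] G_def mult.assoc)
    also have "\<dots> = (LINT x|lborel. (D n x \<bullet> h) * \<phi> x)"
      by (rule integral_lborel_eq_lebesgue(1)[symmetric])
         (use D(2)[of n] in \<open>measurable, auto elim!: eventually_mono\<close>)
    finally show "(LINT x|lborel. w n x * frechet_derivative \<phi> (at x) h) = - (LINT x|lborel. (D n x \<bullet> h) * \<phi> x)" .
  qed
  have abs_eq: "(LINT x|lborel. indicator A x * \<bar>w n x\<bar>) = (LINT x|lebesgue_on \<Omega>. indicator A x * \<bar>u n x $ i - v x $ i\<bar>)"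
    if A[measurable]: "A \<in> sets borel" for A n
  proof -
    have [measurable]: "A \<in> sets lebesgue" using A by simp
    have "(LINT x|lborel. indicator A x * \<bar>w n x\<bar>) = (LINT x|lebesgue. indicator A x * \<bar>a n x\<bar>)"
      by (rule integral_lborel_eq_lebesgue) (use w(2)[of n] in \<open>measurable, auto elim!: eventually_mono\<close>)
    then show ?thesis by (simp add: integral_lebesgue_on(1)[OF \<Omega>s] a_def abs_mult mult_ac)
  qed
  have "(\<lambda>n. LINT x|lborel. indicator K x * \<bar>w n x\<bar>) \<longlonglongrightarrow> 0"
  proof (rule L1_convergence_of_weak_gradients[OF K(1) V(1) K(2) weak])
    fix K' assume K': "compact K'" "K' \<subseteq> V"
    have [measurable]: "K' \<in> sets borel" "K' \<in> sets lebesgue" using K'(1) by (auto simp: borel_compact lmeasurable_compact fmeasurableD)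
    have "(LINT x|lborel. indicator K' x * norm (D n x)) = (LINT x|lebesgue. indicator K' x * norm (G n x))" for n
      by (rule integral_lborel_eq_lebesgue) (use D(2)[of n] in \<open>measurable, auto elim!: eventually_mono\<close>)
    also have "(LINT x|lebesgue. indicator K' x * norm (G n x))
        = (LINT x|lebesgue_on \<Omega>. indicator K' x * norm ((wgrad \<Omega> (u n) x - wgrad \<Omega> v x) $ i))" for n
      by (simp add: integral_lebesgue_on(1)[OF \<Omega>s] G_def mult_ac)
    finally have eqD: "(LINT x|lborel. indicator K' x * norm (D n x))
       = (LINT x|lebesgue_on \<Omega>. indicator K' x * norm ((wgrad \<Omega> (u n) x - wgrad \<Omega> v x) $ i))" for n .
    show "(\<lambda>n. LINT x|lborel. indicator K' x * norm (D n x)) \<longlonglongrightarrow> 0"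
      unfolding eqD
    proof (rule tendsto_sandwich[OF _ _ tendsto_const grad[OF K']])
      have "(LINT x|lebesgue_on \<Omega>. indicator K' x * norm ((wgrad \<Omega> (u n) x - wgrad \<Omega> v x) $ i))
          \<le> (LINT x|lebesgue_on \<Omega>. indicator K' x * norm (wgrad \<Omega> (u n) x - wgrad \<Omega> v x))" for n
        by (rule integral_mono_AE'[OF gradi[OF K']])
           (auto intro!: AE_I2 mult_left_mono Finite_Cartesian_Product.norm_nth_le simp del: vector_minus_component)
      then show "\<forall>\<^sub>F n in sequentially. (LINT x|lebesgue_on \<Omega>. indicator K' x * norm ((wgrad \<Omega> (u n) x - wgrad \<Omega> v x) $ i))
          \<le> (LINT x|lebesgue_on \<Omega>. indicator K' x * norm (wgrad \<Omega> (u n) x - wgrad \<Omega> v x))" by simp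
    qed (auto intro!: always_eventually integral_nonneg_AE simp del: vector_minus_component)
  next
    fix x :: "real^3" and r
    have kb: "(indicator (ball x r) :: _ \<Rightarrow> real) \<in> borel_measurable borel"
      by (intro borel_measurable_indicator) simp
    then have kl: "(indicator (ball x r) :: _ \<Rightarrow> real) \<in> borel_measurable (lebesgue_on \<Omega>)"
      by (intro measurable_restrict_space1) (simp add: measurable_completion)
    have i_k: "integrable (lebesgue_on \<Omega>) (\<lambda>y. z y $ i * indicator (ball x r) y)" if "z \<in> W12 \<Omega>" for z
      by (rule integrable_mult_bounded[OF i_u[OF that] kl, of 1]) (simp add: indicator_def)
    \<comment> \<open>Weak convergence is tested with the indicator of the ball itself. The ball may
      leave \<open>\<Omega>\<close>; the extension by zero makes the outer part contribute
      nothing.\<close>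
    have "(\<lambda>n. (LINT y|lebesgue_on \<Omega>. u n y $ i * indicator (ball x r) y) - (LINT y|lebesgue_on \<Omega>. v y $ i * indicator (ball x r) y))
        \<longlonglongrightarrow> (LINT y|lebesgue_on \<Omega>. v y $ i * indicator (ball x r) y) - (LINT y|lebesgue_on \<Omega>. v y $ i * indicator (ball x r) y)"
      by (intro tendsto_intros weakly_converges_W12_integral[OF \<Omega> conv kl, of 1]) (simp add: indicator_def)
    moreover have "(LINT y|lborel. indicator (ball x r) y * w n y) =
        (LINT y|lebesgue_on \<Omega>. u n y $ i * indicator (ball x r) y) - (LINT y|lebesgue_on \<Omega>. v y $ i * indicator (ball x r) y)" for n
      using eq_w[OF kb, of n] i_k[OF W(1), of n] i_k[OF W(2)] by (simp add: mult.commute[of "indicator _ _"] left_diff_distrib)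
    ultimately show "(\<lambda>n. LINT y|lborel. indicator (ball x r) y * w n y) \<longlonglongrightarrow> 0" by simp
  next
    fix n
    have "(LINT x|lborel. \<bar>w n x\<bar>) = (LINT x|lebesgue_on \<Omega>. \<bar>u n x $ i - v x $ i\<bar>)"
      using abs_eq[of UNIV n] by simp
    \<comment> \<open>The uniform bound M on the maps yields an \<open>L^1\<close> bound independent
      of n.\<close>
    also have "\<dots> \<le> (LINT x|lebesgue_on \<Omega>. M + \<bar>v x $ i\<bar>)"
    proof (rule integral_mono_AE)
      show "AE x in lebesgue_on \<Omega>. \<bar>u n x $ i - v x $ i\<bar> \<le> M + \<bar>v x $ i\<bar>"
        using M[of n]
      proof eventually_elim
        case (elim x)
        then show ?case using component_le_norm_cart[of "u n x" i] by linarith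
      qed
    qed (use i_u[OF W(1)] i_u[OF W(2)] integrable_lebesgue_on_const[OF \<Omega>, of M] in auto)
    finally show "(LINT x|lborel. \<bar>w n x\<bar>) \<le> (LINT x|lebesgue_on \<Omega>. M + \<bar>v x $ i\<bar>)" .
  qed
  then show ?thesis using abs_eq[of K] K(1) by (simp add: borel_compact)
qed

text \<open>Uniform integrability is stated through excesses over an integrable function because this form is
  inherited by sums of sequences.\<close>

lemma vitali_convergence:
  fixes f :: "nat \<Rightarrow> 'a \<Rightarrow> real"
  assumes f: "\<And>n. integrable M (f n)" and F: "integrable M F"
    and lim: "AE x in M. (\<lambda>n. f n x) \<longlonglongrightarrow> F x"
    and unif: "\<And>e. e > 0 \<Longrightarrow> \<exists>g N. integrable M g \<and> (\<forall>n\<ge>N. (\<integral>\<^sup>+x. ennreal (\<bar>f n x\<bar> - g x) \<partial>M) \<le> ennreal e)"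
  shows "(\<lambda>n. LINT x|M. f n x) \<longlonglongrightarrow> (LINT x|M. F x)"
proof (rule LIMSEQ_I)
  fix e :: real assume "e > 0"
  then obtain g N where g: "integrable M g" "\<And>n. n \<ge> N \<Longrightarrow> (\<integral>\<^sup>+x. ennreal (\<bar>f n x\<bar> - g x) \<partial>M) \<le> ennreal (e / 2)"
    using unif[of "e / 2"] by auto
  note [measurable] = borel_measurable_integrable[OF f] borel_measurable_integrable[OF F] borel_measurable_integrable[OF g(1)]
  \<comment> \<open>The truncation level majorizes both g and |F|: the first bounds the part cut off
    by the excess over g, the second makes truncation leave the limit F unchanged.\<close>
  define G where "G x = \<bar>g x\<bar> + \<bar>F x\<bar>" for x
  have G: "integrable M G" unfolding G_def using g(1) F by auto
  note [measurable] = borel_measurable_integrable[OF G]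
  have G0: "G x \<ge> 0" "g x \<le> G x" "\<bar>F x\<bar> \<le> G x" for x by (auto simp: G_def)
  define c where "c n x = max (- G x) (min (G x) (f n x))" for n x
  have [measurable]: "c n \<in> borel_measurable M" for n unfolding c_def by measurable
  have cG: "\<bar>c n x\<bar> \<le> G x" for n x using G0(1)[of x] by (auto simp: c_def abs_le_iff min_def max_def)
  have ci: "integrable M (c n)" for n
    by (rule Bochner_Integration.integrable_bound[OF G]) (use cG G0 in auto)
  have "(\<lambda>n. LINT x|M. c n x) \<longlonglongrightarrow> (LINT x|M. F x)"
  proof (rule integral_dominated_convergence[where w = G])
    show "AE x in M. (\<lambda>n. c n x) \<longlonglongrightarrow> F x"
      using lim
    proof eventually_elim
      case (elim x)
      then have "(\<lambda>n. c n x) \<longlonglongrightarrow> max (- G x) (min (G x) (F x))" unfolding c_def by (intro tendsto_intros)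
      moreover have "max (- G x) (min (G x) (F x)) = F x" using G0(3)[of x] by (simp add: abs_le_iff min_def max_def)
      ultimately show ?case by simp
    qed
  qed (use G F cG in auto)
  then obtain N' where N': "\<And>n. n \<ge> N' \<Longrightarrow> \<bar>(LINT x|M. c n x) - (LINT x|M. F x)\<bar> < e / 2"
    using LIMSEQ_D[of _ _ "e / 2"] \<open>e > 0\<close> by fastforce
  have close: "\<bar>(LINT x|M. f n x) - (LINT x|M. c n x)\<bar> \<le> e / 2" if "n \<ge> N" for n
  proof -
    have i: "integrable M (\<lambda>x. \<bar>f n x - c n x\<bar>)" using f ci by auto
    have "ennreal (LINT x|M. \<bar>f n x - c n x\<bar>) = (\<integral>\<^sup>+x. ennreal \<bar>f n x - c n x\<bar> \<partial>M)"
      using i by (intro nn_integral_eq_integral[symmetric]) auto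
    also have "\<dots> \<le> (\<integral>\<^sup>+x. ennreal (\<bar>f n x\<bar> - g x) \<partial>M)"
    proof (rule nn_integral_mono)
      fix x
      \<comment> \<open>\<open>ennreal\<close> sends negative reals to 0, so the hypothesis
        integrates the positive part of |f n x| - g x, and that is what the truncation error is
        compared with.\<close>
      have "\<bar>f n x - c n x\<bar> \<le> max 0 (\<bar>f n x\<bar> - g x)"
        using G0(1,2)[of x] by (auto simp: c_def min_def max_def)
      then have "ennreal \<bar>f n x - c n x\<bar> \<le> ennreal (max 0 (\<bar>f n x\<bar> - g x))" by (rule ennreal_leI)
      then show "ennreal \<bar>f n x - c n x\<bar> \<le> ennreal (\<bar>f n x\<bar> - g x)" by (simp add: max_def ennreal_neg split: if_splits)
    qed
    also have "\<dots> \<le> ennreal (e / 2)" by (rule g(2)[OF that])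
    finally have "(LINT x|M. \<bar>f n x - c n x\<bar>) \<le> e / 2" using \<open>e > 0\<close> by (simp add: ennreal_le_iff)
    moreover have "\<bar>(LINT x|M. f n x) - (LINT x|M. c n x)\<bar> \<le> (LINT x|M. \<bar>f n x - c n x\<bar>)"
      using f ci integral_abs_bound[of M "\<lambda>x. f n x - c n x"] by simp
    ultimately show ?thesis by linarith
  qed
  show "\<exists>N. \<forall>n\<ge>N. norm ((LINT x|M. f n x) - (LINT x|M. F x)) < e"
  proof (intro exI[of _ "max N N'"] allI impI)
    fix n assume "max N N' \<le> n"
    then have "n \<ge> N" "n \<ge> N'" by auto
    from close[OF this(1)] N'[OF this(2)]
    show "norm ((LINT x|M. f n x) - (LINT x|M. F x)) < e" unfolding real_norm_def by linarith
  qed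
qed

section \<open>Graph currents\<close>

lemma linear_eq_sum_Basis:
  fixes f :: "'a::euclidean_space \<Rightarrow> real"
  assumes "linear f"
  shows "f x = (\<Sum>b\<in>Basis. (x \<bullet> b) * f b)"
proof -
  have "f x = f (\<Sum>b\<in>Basis. (x \<bullet> b) *\<^sub>R b)" by (simp add: euclidean_representation)
  then show ?thesis using assms by (simp add: linear_sum linear_scale)
qed

lemma alternating3_linear:
  assumes "alternating3 \<alpha>"
  shows "linear (\<lambda>a. \<alpha> a b c)" and "linear (\<lambda>b. \<alpha> a b c)" and "linear (\<lambda>c. \<alpha> a b c)"
  using assms by (auto simp: alternating3_def)

lemma alternating3_eq_0:
  assumes "alternating3 \<alpha>"
  shows "\<alpha> a a c = 0" and "\<alpha> a c c = 0" and "\<alpha> a c a = 0"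
  using assms by (auto simp: alternating3_def)

text \<open>Reduces a covector to finitely many coefficients on basis triples. Both the bound and
  the joint continuity of the integrand come from this expansion.\<close>

lemma alternating3_eq_sum:
  fixes \<alpha> :: "'a::euclidean_space covector3"
  assumes "alternating3 \<alpha>"
  shows "\<alpha> a b c = (\<Sum>i\<in>Basis. \<Sum>j\<in>Basis. \<Sum>k\<in>Basis. (a \<bullet> i) * ((b \<bullet> j) * ((c \<bullet> k) * \<alpha> i j k)))"
proof -
  note l = alternating3_linear[OF assms]
  have "\<alpha> a b c = (\<Sum>i\<in>Basis. (a \<bullet> i) * \<alpha> i b c)" by (rule linear_eq_sum_Basis[OF l(1)])
  also have "\<dots> = (\<Sum>i\<in>Basis. (a \<bullet> i) * (\<Sum>j\<in>Basis. (b \<bullet> j) * \<alpha> i j c))"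
    by (intro sum.cong refl arg_cong2[where f = "(*)"] linear_eq_sum_Basis[OF l(2)])
  also have "\<dots> = (\<Sum>i\<in>Basis. (a \<bullet> i) * (\<Sum>j\<in>Basis. (b \<bullet> j) * (\<Sum>k\<in>Basis. (c \<bullet> k) * \<alpha> i j k)))"
    by (intro sum.cong refl arg_cong2[where f = "(*)"] linear_eq_sum_Basis[OF l(3)])
  finally show ?thesis by (simp add: sum_distrib_left)
qed

lemma alternating3_bound:
  fixes \<alpha> :: "'a::euclidean_space covector3"
  assumes "alternating3 \<alpha>" and B: "\<And>i j k. \<bar>\<alpha> i j k\<bar> \<le> B i j k"
  shows "\<bar>\<alpha> a b c\<bar> \<le> (\<Sum>i\<in>Basis. \<Sum>j\<in>Basis. \<Sum>k\<in>Basis. B i j k) * (norm a * norm b * norm c)"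
proof -
  have "\<bar>\<alpha> a b c\<bar> \<le> (\<Sum>i\<in>Basis. \<Sum>j\<in>Basis. \<Sum>k\<in>Basis. \<bar>(a \<bullet> i) * ((b \<bullet> j) * ((c \<bullet> k) * \<alpha> i j k))\<bar>)"
    unfolding alternating3_eq_sum[OF assms(1), of a b c]
    by (intro order_trans[OF sum_abs] sum_mono order_refl)
  also have "\<dots> \<le> (\<Sum>i\<in>Basis. \<Sum>j\<in>Basis. \<Sum>k\<in>Basis. B i j k * (norm a * norm b * norm c))"
  proof (intro sum_mono)
    fix i j k :: 'a assume "i \<in> Basis" "j \<in> Basis" "k \<in> Basis"
    then have "\<bar>a \<bullet> i\<bar> * (\<bar>b \<bullet> j\<bar> * (\<bar>c \<bullet> k\<bar> * \<bar>\<alpha> i j k\<bar>)) \<le> norm a * (norm b * (norm c * B i j k))"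
      by (intro mult_mono B Basis_le_norm) auto
    then show "\<bar>(a \<bullet> i) * ((b \<bullet> j) * ((c \<bullet> k) * \<alpha> i j k))\<bar> \<le> B i j k * (norm a * norm b * norm c)"
      by (simp add: abs_mult mult_ac)
  qed
  also have "\<dots> = (\<Sum>i\<in>Basis. \<Sum>j\<in>Basis. \<Sum>k\<in>Basis. B i j k) * (norm a * norm b * norm c)"
    by (simp add: sum_distrib_right)
  finally show ?thesis .
qed

text \<open>Polarization: expanding the vanishing \<open>\<alpha> (a + b) (a + b) c\<close> leaves
  two terms with sum 0.\<close>

lemma alternating3_swap:
  assumes "alternating3 \<alpha>"
  shows "\<alpha> b a c = - \<alpha> a b c" and "\<alpha> a c b = - \<alpha> a b c"
proof -
  note l = alternating3_linear[OF assms] and z = alternating3_eq_0[OF assms]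
  have "\<alpha> (a + b) (a + b) c = \<alpha> a b c + \<alpha> b a c"
    unfolding l(1)[THEN linear_add] l(2)[THEN linear_add] by (simp add: z)
  then show "\<alpha> b a c = - \<alpha> a b c" by (simp add: z)
  have "\<alpha> a (b + c) (b + c) = \<alpha> a b c + \<alpha> a c b"
    unfolding l(2)[THEN linear_add] l(3)[THEN linear_add] by (simp add: z)
  then show "\<alpha> a c b = - \<alpha> a b c" by (simp add: z)
qed

text \<open>Alternating trilinear forms on \<open>real^3\<close> are multiples of the determinant.
  Expanding the columns in the standard basis, terms with a repeated basis vector vanish, and the
  six remaining ones carry the signs of the Leibniz formula.\<close>

lemma alternating3_det:
  fixes \<beta> :: "(real^3) covector3"
  assumes \<beta>: "alternating3 \<beta>"
  shows "\<beta> (A *v axis 1 1) (A *v axis 2 1) (A *v axis 3 1) = det A * \<beta> (axis 1 1) (axis 2 1) (axis 3 1)"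
proof -
  note l = alternating3_linear[OF \<beta>] and z = alternating3_eq_0[OF \<beta>]
  have col: "A *v axis k 1 = A $ 1 $ k *\<^sub>R axis 1 1 + A $ 2 $ k *\<^sub>R axis 2 1 + A $ 3 $ k *\<^sub>R axis 3 1" for k
    unfolding matrix_vector_mult_basis by (simp add: vec_eq_iff forall_3 column_def axis_def)
  define e1 e2 e3 where e: "e1 = (axis 1 1 :: real^3)" "e2 = (axis 2 1 :: real^3)" "e3 = (axis 3 1 :: real^3)"
  note sw1 = alternating3_swap(1)[OF \<beta>] and sw2 = alternating3_swap(2)[OF \<beta>]
  have sw: "\<beta> e2 e1 e3 = - \<beta> e1 e2 e3" "\<beta> e1 e3 e2 = - \<beta> e1 e2 e3" "\<beta> e2 e3 e1 = \<beta> e1 e2 e3"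
     "\<beta> e3 e1 e2 = \<beta> e1 e2 e3" "\<beta> e3 e2 e1 = - \<beta> e1 e2 e3"
    using sw1[where a = e1 and b = e2 and c = e3] sw2[where a = e1 and b = e2 and c = e3]
      sw2[where a = e2 and b = e1 and c = e3] sw1[where a = e1 and b = e3 and c = e2]
      sw1[where a = e2 and b = e3 and c = e1] by linarith+
  show ?thesis
    unfolding col unfolding e[symmetric]
    by (simp only: l[THEN linear_add] l[THEN linear_scale] z sw real_scaleR_def mult_zero_right add_0_left add_0_right)
       (simp only: det_3, algebra)
qed

section \<open>Growth and continuity of the integrand of a graph current\<close>

lemma norm_mult_axis_le: "norm ((A :: real^3^3) *v axis k 1) \<le> 3 * norm A"
proof -
  have "norm (A *v axis k 1) \<le> (\<Sum>i\<in>UNIV. \<bar>(A *v axis k 1) $ i\<bar>)" by (rule norm_le_l1_cart)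
  also have "\<dots> \<le> (\<Sum>i\<in>(UNIV :: 3 set). norm A)"
  proof (rule sum_mono)
    fix i
    have "\<bar>A $ i $ k\<bar> \<le> norm A"
      using matrix_component_square_le[of A i k] by (simp flip: abs_le_square_iff)
    then show "\<bar>(A *v axis k 1) $ i\<bar> \<le> norm A" by (simp add: matrix_vector_mult_basis column_def)
  qed
  finally show ?thesis by simp
qed

text \<open>The point and the matrix are separate arguments, so that continuity and growth can be
  stated before a map and its gradient are inserted.\<close>

definition graph_integrand :: "((real^3) \<times> (real^3)) form3 \<Rightarrow> (real^3) \<times> (real^3) \<Rightarrow> real^3^3 \<Rightarrow> real" where
  "graph_integrand \<omega> z A = \<omega> z (axis 1 1, A *v axis 1 1) (axis 2 1, A *v axis 2 1) (axis 3 1, A *v axis 3 1)"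

lemma graph_current_eq: "graph_current \<Omega> u \<omega> = (LINT x|lebesgue_on \<Omega>. graph_integrand \<omega> (x, u x) (wgrad \<Omega> u x))"
  by (simp add: graph_current_def graph_integrand_def)

text \<open>The naive bound would be cubic in |A|, beyond what the energy controls. Splitting each
  vector into a horizontal part \<open>p k\<close> and a vertical part \<open>q k\<close> gives
  eight terms; those with at most two vertical entries are at most quadratic in |A|, and the purely
  vertical one is a coefficient times det A by \<open>alternating3_det\<close>.\<close>

lemma graph_integrand_bound_covector:
  fixes \<omega> :: "((real^3) \<times> (real^3)) form3"
  assumes \<alpha>: "alternating3 (\<omega> z)" and C: "C \<ge> 0" "\<And>a b c. \<bar>\<omega> z a b c\<bar> \<le> C * (norm a * norm b * norm c)"
  shows "\<bar>graph_integrand \<omega> z A\<bar> \<le> 54 * C * (1 + (norm A)\<^sup>2 + \<bar>det A\<bar>)"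
proof -
  define \<alpha>' where "\<alpha>' = \<omega> z"
  define p where "p k = (axis k 1 :: real^3, 0 :: real^3)" for k
  define q where "q k = (0 :: real^3, A *v axis k 1)" for k
  note l = alternating3_linear[OF \<alpha>, folded \<alpha>'_def] and z = alternating3_eq_0[OF \<alpha>, folded \<alpha>'_def]
  have pq: "(axis k 1, A *v axis k 1) = p k + q k" for k by (simp add: p_def q_def)
  have F: "graph_integrand \<omega> z A =
     \<alpha>' (p 1) (p 2) (p 3) + \<alpha>' (p 1) (p 2) (q 3) + \<alpha>' (p 1) (q 2) (p 3) + \<alpha>' (p 1) (q 2) (q 3)
      + \<alpha>' (q 1) (p 2) (p 3) + \<alpha>' (q 1) (p 2) (q 3) + \<alpha>' (q 1) (q 2) (p 3) + \<alpha>' (q 1) (q 2) (q 3)"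
    unfolding graph_integrand_def pq \<alpha>'_def[symmetric] by (simp add: l[THEN linear_add])
  define s where "s = 3 * norm A"
  have s0: "s \<ge> 0" by (simp add: s_def)
  have np: "norm (p k) = 1" for k by (simp add: p_def)
  have nq: "norm (q k) \<le> s" for k using norm_mult_axis_le[of A k] by (simp add: q_def s_def)
  have b: "\<bar>\<alpha>' a b c\<bar> \<le> C * t" if "norm a * norm b * norm c \<le> t" for a b c t
    using order_trans[OF C(2)[of a b c] mult_left_mono[OF that C(1)]] by (simp add: \<alpha>'_def)
  have qq: "norm (q i) * norm (q j) \<le> s\<^sup>2" for i j
    unfolding power2_eq_square using nq s0 by (intro mult_mono) auto
  have bounds: "\<bar>\<alpha>' (p 1) (p 2) (p 3)\<bar> \<le> C * 1" "\<bar>\<alpha>' (p 1) (p 2) (q 3)\<bar> \<le> C * s" "\<bar>\<alpha>' (p 1) (q 2) (p 3)\<bar> \<le> C * s"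
    "\<bar>\<alpha>' (p 1) (q 2) (q 3)\<bar> \<le> C * s\<^sup>2" "\<bar>\<alpha>' (q 1) (p 2) (p 3)\<bar> \<le> C * s" "\<bar>\<alpha>' (q 1) (p 2) (q 3)\<bar> \<le> C * s\<^sup>2"
    "\<bar>\<alpha>' (q 1) (q 2) (p 3)\<bar> \<le> C * s\<^sup>2"
    by (rule b; simp add: np nq qq)+
  have alt: "alternating3 (\<lambda>a b c. \<alpha>' (0, a) (0, b) (0, c))"
  proof -
    have lin: "linear (\<lambda>a. f (0, a))" if "linear f" for f :: "(real^3) \<times> (real^3) \<Rightarrow> real"
    proof (rule linearI)
      show "f (0, a + b) = f (0, a) + f (0, b)" for a b
        using linear_add[OF that, of "(0, a)" "(0, b)"] by simp
      show "f (0, r *\<^sub>R a) = r *\<^sub>R f (0, a)" for r a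
        using linear_scale[OF that, of r "(0, a)"] by simp
    qed
    show ?thesis
      using lin[OF l(1)] lin[OF l(2)] lin[OF l(3)] z by (simp add: alternating3_def)
  qed
  have "\<alpha>' (q 1) (q 2) (q 3) = det A * \<alpha>' (0, axis 1 1) (0, axis 2 1) (0, axis 3 1)"
    using alternating3_det[OF alt, of A] by (simp add: q_def)
  moreover have "\<bar>\<alpha>' (0, axis 1 1) (0, axis 2 1) (0, axis 3 1)\<bar> \<le> C * 1"
    by (rule b) simp
  ultimately have qqq: "\<bar>\<alpha>' (q 1) (q 2) (q 3)\<bar> \<le> C * \<bar>det A\<bar>"
    by (simp add: abs_mult mult.commute[of "\<bar>det A\<bar>"] mult_right_mono)
  have "\<bar>graph_integrand \<omega> z A\<bar> \<le>
      C * 1 + C * s + C * s + C * s\<^sup>2 + C * s + C * s\<^sup>2 + C * s\<^sup>2 + C * \<bar>det A\<bar>"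
    unfolding F by (intro order_trans[OF abs_triangle_ineq] add_mono bounds qqq)
  also have "\<dots> = C * (1 + 3 * s + 3 * s\<^sup>2 + \<bar>det A\<bar>)" by (simp add: algebra_simps)
  also have "\<dots> \<le> C * (54 * (1 + (norm A)\<^sup>2 + \<bar>det A\<bar>))"
  proof (rule mult_left_mono[OF _ C(1)])
    \<comment> \<open>With s = 3 * |A|, this turns 1 + 3 * s + 3 * s^2 into at most 5/2 + (81/2) *
      |A|^2; the constant 54 is a generous upper bound.\<close>
    have "2 * s \<le> 1 + s\<^sup>2" using sum_squares_bound[of s 1] by simp
    moreover have "s\<^sup>2 = 9 * (norm A)\<^sup>2" by (simp add: s_def power_mult_distrib)
    moreover have "0 \<le> (norm A)\<^sup>2" "0 \<le> \<bar>det A\<bar>" by simp_all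
    ultimately show "1 + 3 * s + 3 * s\<^sup>2 + \<bar>det A\<bar> \<le> 54 * (1 + (norm A)\<^sup>2 + \<bar>det A\<bar>)"
      by (simp only: distrib_left)
  qed
  finally show ?thesis by (simp add: mult_ac)
qed

lemma test_functions_imp_continuous_on: "f \<in> test_functions U \<Longrightarrow> continuous_on UNIV f"
  by (auto simp: test_functions_def intro: smooth_on_imp_continuous_on)

lemma test_forms3_alternating3: "\<omega> \<in> test_forms3 U \<Longrightarrow> alternating3 (\<omega> z)"
  by (auto simp: test_forms3_def)

lemma form_supp_eq_0: "z \<notin> form_supp \<omega> \<Longrightarrow> \<omega> z a b c = 0"
proof -
  assume "z \<notin> form_supp \<omega>"
  then have "\<omega> z = (\<lambda>a b c. 0)"
    using closure_subset[of "{z. \<omega> z \<noteq> (\<lambda>a b c. 0)}"] by (auto simp: form_supp_def)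
  then show "\<omega> z a b c = 0" by simp
qed

lemma test_forms3_coefficient:
  assumes "\<omega> \<in> test_forms3 U"
  shows "(\<lambda>z. \<omega> z a b c) \<in> test_functions U"
proof (rule test_functionsI(1))
  show "smooth_on (\<lambda>z. \<omega> z a b c) UNIV" "compact (form_supp \<omega>)" "form_supp \<omega> \<subseteq> U"
    using assms by (auto simp: test_forms3_def)
qed (rule form_supp_eq_0)

lemma graph_integrand_bound:
  assumes "\<omega> \<in> test_forms3 U"
  obtains C where "C > 0" "\<And>z A. \<bar>graph_integrand \<omega> z A\<bar> \<le> C * (1 + (norm A)\<^sup>2 + \<bar>det A\<bar>)"
proof -
  have "\<exists>B. \<forall>z. \<bar>\<omega> z a b c\<bar> \<le> B" for a b c
    using test_functions_bounded[OF test_forms3_coefficient[OF assms, of a b c]] unfolding real_norm_def by blast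
  then obtain B where B: "\<And>a b c z. \<bar>\<omega> z a b c\<bar> \<le> B a b c" by metis
  define C where "C = (\<Sum>i\<in>Basis. \<Sum>j\<in>Basis. \<Sum>k\<in>Basis. B i j k)"
  have "B a b c \<ge> 0" for a b c using B[of undefined a b c] by linarith
  then have C: "C \<ge> 0" unfolding C_def by (intro sum_nonneg)
  note alt = test_forms3_alternating3[OF assms]
  have "\<bar>\<omega> z a b c\<bar> \<le> C * (norm a * norm b * norm c)" for z a b c
    unfolding C_def by (rule alternating3_bound[OF alt B])
  note bd = graph_integrand_bound_covector[where \<omega> = \<omega>, OF alt C this]
  show thesis
  \<comment> \<open>The added 1 makes the constant strictly positive even if C = 0.\<close>
  proof (rule that[of "54 * C + 1"])
    show "54 * C + 1 > 0" using C by simp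
    show "\<bar>graph_integrand \<omega> z A\<bar> \<le> (54 * C + 1) * (1 + (norm A)\<^sup>2 + \<bar>det A\<bar>)" for z A
      by (rule order_trans[OF bd]) (intro mult_right_mono, auto)
  qed
qed

text \<open>Joint continuity serves twice: it makes the integrand measurable after composition with
  a map and its gradient, and it transfers their almost everywhere convergence to the
  integrands.\<close>

lemma continuous_on_graph_integrand:
  assumes "\<omega> \<in> test_forms3 U"
  shows "continuous_on UNIV (\<lambda>p. graph_integrand \<omega> (fst p) (snd p))"
proof -
  note alt = test_forms3_alternating3[OF assms]
  have "linear (\<lambda>A :: real^3^3. A *v x)" for x
    by (rule linearI) (simp_all add: matrix_vector_mult_add_rdistrib scaleR_matrix_vector_assoc)
  then have mv: "continuous_on UNIV (\<lambda>p :: ((real^3) \<times> (real^3)) \<times> (real^3^3). snd p *v x)" for x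
    by (intro continuous_on_compose2[of UNIV "\<lambda>A. A *v x" _ snd] linear_continuous_on continuous_intros)
       (auto simp: linear_conv_bounded_linear)
  have co: "continuous_on UNIV (\<lambda>p :: ((real^3) \<times> (real^3)) \<times> (real^3^3). \<omega> (fst p) a b c)" for a b c
  proof (rule continuous_on_compose2[of UNIV "\<lambda>z. \<omega> z a b c" _ fst])
    show "continuous_on UNIV (\<lambda>z. \<omega> z a b c)"
      by (rule test_functions_imp_continuous_on[OF test_forms3_coefficient[OF assms]])
  qed (auto intro: continuous_intros)
  have expand: "graph_integrand \<omega> (fst p) (snd p) = (\<Sum>i\<in>Basis. \<Sum>j\<in>Basis. \<Sum>k\<in>Basis.
      ((axis 1 1, snd p *v axis 1 1) \<bullet> i) * (((axis 2 1, snd p *v axis 2 1) \<bullet> j) *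
        (((axis 3 1, snd p *v axis 3 1) \<bullet> k) * \<omega> (fst p) i j k)))" for p
    unfolding graph_integrand_def by (rule alternating3_eq_sum[OF alt])
  show ?thesis
    unfolding expand
    by (intro continuous_on_sum continuous_on_mult continuous_on_inner continuous_on_Pair continuous_on_const mv co)
qed

section \<open>Convergence of graph currents\<close>

text \<open>\<open>N + H \<circ> d\<close> need not be measurable; only \<open>d\<close> is pulled out of the integral.\<close>

lemma nn_integral_excess_le:
  fixes d :: "'a \<Rightarrow> real"
  assumes [measurable]: "d \<in> borel_measurable M" and pos: "AE x in M. 0 < d x"
    and E: "(\<integral>\<^sup>+x. ennreal (N x + H (d x)) \<partial>M) \<le> ennreal E" and N: "\<And>x. N x \<ge> 0"
    and H: "\<And>t. t > 0 \<Longrightarrow> H t \<ge> 0" and T: "\<And>t. t > 0 \<Longrightarrow> t \<ge> T \<Longrightarrow> t \<le> \<epsilon> * H t" "T \<ge> 0"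
    and "\<epsilon> > 0" "E \<ge> 0"
  shows "(\<integral>\<^sup>+x. ennreal (d x - T) \<partial>M) \<le> ennreal (\<epsilon> * E)"
proof -
  have "(\<integral>\<^sup>+x. ennreal (d x - T) \<partial>M) = (\<integral>\<^sup>+x. ennreal \<epsilon> * ennreal ((d x - T) / \<epsilon>) \<partial>M)"
    using \<open>\<epsilon> > 0\<close> by (intro nn_integral_cong) (simp flip: ennreal_mult')
  also have "\<dots> = ennreal \<epsilon> * (\<integral>\<^sup>+x. ennreal ((d x - T) / \<epsilon>) \<partial>M)"
    by (rule nn_integral_cmult) measurable
  also have "(\<integral>\<^sup>+x. ennreal ((d x - T) / \<epsilon>) \<partial>M) \<le> (\<integral>\<^sup>+x. ennreal (N x + H (d x)) \<partial>M)"
  proof (rule nn_integral_mono_AE)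
    show "AE x in M. ennreal ((d x - T) / \<epsilon>) \<le> ennreal (N x + H (d x))"
      using pos
    proof eventually_elim
      case (elim x)
      show ?case
      proof (cases "d x \<ge> T")
        case True
        \<comment> \<open>Beyond T the Jacobian is at most \<open>\<epsilon>\<close> * H, and
          subtracting T >= 0 only decreases the left side.\<close>
        have "d x - T \<le> \<epsilon> * H (d x)" using T(1)[OF elim True] T(2) by linarith
        then have "(d x - T) / \<epsilon> \<le> H (d x)" using \<open>\<epsilon> > 0\<close> by (simp add: divide_le_eq mult.commute)
        then show ?thesis using N[of x] by (intro ennreal_leI) linarith
      next
        case False
        then have "(d x - T) / \<epsilon> \<le> 0" using \<open>\<epsilon> > 0\<close> by (simp add: divide_le_0_iff)
        then show ?thesis by (simp add: ennreal_neg)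
      qed
    qed
  qed
  also have "\<dots> \<le> ennreal E" by (rule E)
  also have "ennreal \<epsilon> * ennreal E = ennreal (\<epsilon> * E)"
    using \<open>\<epsilon> > 0\<close> \<open>E \<ge> 0\<close> by (simp add: ennreal_mult)
  finally show ?thesis by (simp add: mult_left_mono)
qed

text \<open>The second summand may be negative, in which case \<open>ennreal\<close> sends it to 0;
  this occurs for the excess of the Jacobian over a threshold.\<close>

lemma ennreal_add_le: "a \<ge> 0 \<Longrightarrow> ennreal (a + b) \<le> ennreal a + ennreal b"
  by (cases "b \<ge> 0") (auto simp: ennreal_neg ennreal_leI)

lemma graph_current_convergent_subseq:
  assumes \<Omega>: "open \<Omega>" "bounded \<Omega>" and conv: "weakly_converges_W12 \<Omega> u v"
    and M: "\<And>n. AE x in lebesgue_on \<Omega>. norm (u n x) \<le> M"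
    and det: "\<And>n. AE x in lebesgue_on \<Omega>. 0 < det (wgrad \<Omega> (u n) x)"
    and deti: "\<And>n. integrable (lebesgue_on \<Omega>) (\<lambda>x. det (wgrad \<Omega> (u n) x))"
    and detv: "integrable (lebesgue_on \<Omega>) (\<lambda>x. det (wgrad \<Omega> v x))"
    and E: "\<And>n. energy \<Omega> H (u n) \<le> ennreal E" "E \<ge> 0"
    and H: "\<And>t. t > 0 \<Longrightarrow> H t \<ge> 0" "filterlim (\<lambda>t. H t / t) at_top at_top"
    and V: "open V" "V \<subseteq> \<Omega>"
    and norms: "\<And>\<eta>. continuous_on UNIV \<eta> \<Longrightarrow> compact (supp \<eta>) \<Longrightarrow> supp \<eta> \<subseteq> V \<Longrightarrow>
      (\<lambda>n. LINT x|lebesgue_on \<Omega>. \<eta> x * (norm (wgrad \<Omega> (u n) x))\<^sup>2) \<longlonglongrightarrow>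
       (LINT x|lebesgue_on \<Omega>. \<eta> x * (norm (wgrad \<Omega> v x))\<^sup>2)"
    and \<omega>: "\<omega> \<in> test_forms3 (\<Omega> \<times> UNIV)" "form_supp \<omega> \<subseteq> V \<times> UNIV"
  shows "\<exists>r. strict_mono r \<and> (\<lambda>n. graph_current \<Omega> (u (r n)) \<omega>) \<longlonglongrightarrow> graph_current \<Omega> v \<omega>"
proof -
  have W: "u n \<in> W12 \<Omega>" "v \<in> W12 \<Omega>" for n using conv by (auto simp: weakly_converges_W12_def)
  \<comment> \<open>The compact projection of the support: the integrand vanishes for x outside K,
    so convergence on K is all that matters.\<close>
  define K where "K = fst ` form_supp \<omega>"
  have K: "compact K" "K \<subseteq> V"
    using \<omega> by (auto simp: K_def test_forms3_def intro!: compact_continuous_image continuous_intros)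
  note wm[measurable] = wgrad_W12(2)[OF \<Omega>(1) W(1)] wgrad_W12(2)[OF \<Omega>(1) W(2)]
  \<comment> \<open>As H is nonnegative at the positive Jacobians, the energy bound controls the
    \<open>L^2\<close> norms of the gradients.\<close>
  have B: "(LINT x|lebesgue_on \<Omega>. (norm (wgrad \<Omega> (u n) x))\<^sup>2) \<le> E" for n
  proof -
    have "ennreal (LINT x|lebesgue_on \<Omega>. (norm (wgrad \<Omega> (u n) x))\<^sup>2)
        = (\<integral>\<^sup>+x. ennreal ((norm (wgrad \<Omega> (u n) x))\<^sup>2) \<partial>lebesgue_on \<Omega>)"
      by (rule nn_integral_eq_integral[symmetric, OF wgrad_W12(3)[OF \<Omega>(1) W(1)]]) simp
    also have "\<dots> \<le> energy \<Omega> H (u n)"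
      unfolding energy_def
    proof (rule nn_integral_mono_AE)
      show "AE x in lebesgue_on \<Omega>. ennreal ((norm (wgrad \<Omega> (u n) x))\<^sup>2)
          \<le> ennreal ((norm (wgrad \<Omega> (u n) x))\<^sup>2 + H (det (wgrad \<Omega> (u n) x)))"
        using det[of n] by eventually_elim (simp add: ennreal_leI H(1))
    qed
    finally have "ennreal (LINT x|lebesgue_on \<Omega>. (norm (wgrad \<Omega> (u n) x))\<^sup>2) \<le> ennreal E"
      using E(1)[of n] by (rule order_trans)
    then show ?thesis using E(2) by (simp add: ennreal_le_iff)
  qed
  have strong:
    "(\<lambda>n. LINT x|lebesgue_on \<Omega>. indicator K' x * (norm (wgrad \<Omega> (u n) x - wgrad \<Omega> v x))\<^sup>2) \<longlonglongrightarrow> 0"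
    "(\<lambda>n. LINT x|lebesgue_on \<Omega>. indicator K' x * norm (wgrad \<Omega> (u n) x - wgrad \<Omega> v x)) \<longlonglongrightarrow> 0"
    "\<And>n. integrable (lebesgue_on \<Omega>) (\<lambda>x. indicator K' x * (norm (wgrad \<Omega> (u n) x - wgrad \<Omega> v x))\<^sup>2)"
    "\<And>n. integrable (lebesgue_on \<Omega>) (\<lambda>x. indicator K' x * norm (wgrad \<Omega> (u n) x - wgrad \<Omega> v x))"
    if "compact K'" "K' \<subseteq> V" for K'
    by (rule strong_convergence_wgrad_compact[OF \<Omega> conv B V that]; rule norms; assumption)+
  note lim2 = strong(1)[OF K] and lim1 = strong(2)[OF K] and int2 = strong(3)[OF K] and int1 = strong(4)[OF K]
  have limu: "(\<lambda>n. LINT x|lebesgue_on \<Omega>. indicator K x * \<bar>u n x $ i - v x $ i\<bar>) \<longlonglongrightarrow> 0" for i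
    by (rule local_L1_convergence_W12[OF \<Omega> conv M V K]) (fact strong)+
  have Ks: "K \<in> sets (lebesgue_on \<Omega>)"
    using K V \<Omega> by (auto simp: sets_restrict_space_iff lmeasurable_compact fmeasurableD)
  then have Km[measurable]: "(indicator K :: _ \<Rightarrow> real) \<in> borel_measurable (lebesgue_on \<Omega>)" by measurable
  have intu: "integrable (lebesgue_on \<Omega>) (\<lambda>x. indicator K x * \<bar>u n x $ i - v x $ i\<bar>)" for n i
  proof -
    have "integrable (lebesgue_on \<Omega>) (\<lambda>x. \<bar>u n x $ i - v x $ i\<bar>)"
      using W12_component_integrable[OF \<Omega> W(1)] W12_component_integrable[OF \<Omega> W(2)] by auto
    from integrable_mult_bounded[OF this Km, of 1] show ?thesis by (simp add: mult.commute indicator_def)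
  qed
  \<comment> \<open>All errors are added into one sequence so that a single subsequence gives almost
    everywhere convergence of the gradient and of all three components at once.\<close>
  define s where "s n x = indicator K x * norm (wgrad \<Omega> (u n) x - wgrad \<Omega> v x)
     + (\<Sum>i\<in>UNIV. indicator K x * \<bar>u n x $ i - v x $ i\<bar>)" for n x
  have s0: "s n x \<ge> 0" for n x unfolding s_def by (intro add_nonneg_nonneg sum_nonneg) auto
  have "(\<lambda>n. LINT x|lebesgue_on \<Omega>. norm (s n x)) \<longlonglongrightarrow> 0"
  proof -
    have "(LINT x|lebesgue_on \<Omega>. norm (s n x)) = (LINT x|lebesgue_on \<Omega>. indicator K x * norm (wgrad \<Omega> (u n) x - wgrad \<Omega> v x))
       + (\<Sum>i\<in>UNIV. LINT x|lebesgue_on \<Omega>. indicator K x * \<bar>u n x $ i - v x $ i\<bar>)" for n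
    proof -
      have "(LINT x|lebesgue_on \<Omega>. norm (s n x)) = (LINT x|lebesgue_on \<Omega>. s n x)" using s0 by simp
      also have "\<dots> = (LINT x|lebesgue_on \<Omega>. indicator K x * norm (wgrad \<Omega> (u n) x - wgrad \<Omega> v x))
         + (LINT x|lebesgue_on \<Omega>. (\<Sum>i\<in>UNIV. indicator K x * \<bar>u n x $ i - v x $ i\<bar>))"
        unfolding s_def by (intro Bochner_Integration.integral_add int1 Bochner_Integration.integrable_sum intu)
      also have "(LINT x|lebesgue_on \<Omega>. (\<Sum>i\<in>UNIV. indicator K x * \<bar>u n x $ i - v x $ i\<bar>))
         = (\<Sum>i\<in>UNIV. LINT x|lebesgue_on \<Omega>. indicator K x * \<bar>u n x $ i - v x $ i\<bar>)"
        by (intro Bochner_Integration.integral_sum intu)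
      finally show ?thesis .
    qed
    moreover have "(\<lambda>n. (LINT x|lebesgue_on \<Omega>. indicator K x * norm (wgrad \<Omega> (u n) x - wgrad \<Omega> v x))
       + (\<Sum>i\<in>UNIV. LINT x|lebesgue_on \<Omega>. indicator K x * \<bar>u n x $ i - v x $ i\<bar>)) \<longlonglongrightarrow> 0 + (\<Sum>i\<in>(UNIV :: 3 set). 0)"
      by (intro tendsto_add tendsto_sum lim1 limu)
    ultimately show ?thesis by simp
  qed
  moreover have "integrable (lebesgue_on \<Omega>) (s n)" for n
    unfolding s_def by (intro Bochner_Integration.integrable_add int1 Bochner_Integration.integrable_sum intu)
  ultimately obtain r :: "nat \<Rightarrow> nat" where r: "strict_mono r" "AE x in lebesgue_on \<Omega>. (\<lambda>n. s (r n) x) \<longlonglongrightarrow> 0"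
    using tendsto_L1_AE_subseq[of "lebesgue_on \<Omega>" s] by blast
  define F where "F n x = graph_integrand \<omega> (x, u (r n) x) (wgrad \<Omega> (u (r n)) x)" for n x
  define F' where "F' x = graph_integrand \<omega> (x, v x) (wgrad \<Omega> v x)" for x
  have cont: "continuous_on UNIV (\<lambda>p. graph_integrand \<omega> (fst p) (snd p))"
    by (rule continuous_on_graph_integrand[OF \<omega>(1)])
  have off: "graph_integrand \<omega> (x, y) A = 0" if "x \<notin> K" for x y A
  proof -
    have "(x, y) \<notin> form_supp \<omega>" using that by (force simp: K_def)
    then show ?thesis unfolding graph_integrand_def by (rule form_supp_eq_0)
  qed
  obtain C where C: "C > 0" "\<And>z A. \<bar>graph_integrand \<omega> z A\<bar> \<le> C * (1 + (norm A)\<^sup>2 + \<bar>det A\<bar>)"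
    using graph_integrand_bound[OF \<omega>(1)] by metis
  have int: "integrable (lebesgue_on \<Omega>) (\<lambda>x. graph_integrand \<omega> (x, w x) (wgrad \<Omega> w x))"
    if w: "w \<in> W12 \<Omega>" "integrable (lebesgue_on \<Omega>) (\<lambda>x. det (wgrad \<Omega> w x))" for w
  proof (rule Bochner_Integration.integrable_bound)
    show "integrable (lebesgue_on \<Omega>) (\<lambda>x. C * (1 + (norm (wgrad \<Omega> w x))\<^sup>2 + \<bar>det (wgrad \<Omega> w x)\<bar>))"
      using w(2) wgrad_W12(3)[OF \<Omega>(1) w(1)] integrable_lebesgue_on_const[OF \<Omega>, of 1] by auto
    have "(\<lambda>x. x) \<in> borel_measurable (lebesgue_on \<Omega>)"
      by (intro measurable_restrict_space1) (simp add: measurable_completion)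
    then have "(\<lambda>x. ((x, w x), wgrad \<Omega> w x)) \<in> borel_measurable (lebesgue_on \<Omega>)"
      by (intro borel_measurable_Pair W12_component(4)[OF w(1)] wgrad_W12(2)[OF \<Omega>(1) w(1)])
    from measurable_compose[OF this borel_measurable_continuous_onI[OF cont]]
    show "(\<lambda>x. graph_integrand \<omega> (x, w x) (wgrad \<Omega> w x)) \<in> borel_measurable (lebesgue_on \<Omega>)" by simp
    show "AE x in lebesgue_on \<Omega>. norm (graph_integrand \<omega> (x, w x) (wgrad \<Omega> w x))
        \<le> norm (C * (1 + (norm (wgrad \<Omega> w x))\<^sup>2 + \<bar>det (wgrad \<Omega> w x)\<bar>))"
      using C(2) by (intro AE_I2) (simp add: order_trans[OF _ abs_ge_self])
  qed
  have "(\<lambda>n. LINT x|lebesgue_on \<Omega>. F n x) \<longlonglongrightarrow> (LINT x|lebesgue_on \<Omega>. F' x)"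
  proof (rule vitali_convergence)
    show "integrable (lebesgue_on \<Omega>) (F n)" for n unfolding F_def by (rule int[OF W(1) deti])
    show "integrable (lebesgue_on \<Omega>) F'" unfolding F'_def by (rule int[OF W(2) detv])
    show "AE x in lebesgue_on \<Omega>. (\<lambda>n. F n x) \<longlonglongrightarrow> F' x"
      using r(2)
    proof eventually_elim
      case (elim x)
      show ?case
      proof (cases "x \<in> K")
        case True
        have le: "norm (wgrad \<Omega> (u n) x - wgrad \<Omega> v x) \<le> s n x" "\<bar>u n x $ i - v x $ i\<bar> \<le> s n x" for n i
        proof -
          have "0 \<le> (\<Sum>i\<in>UNIV. \<bar>u n x $ i - v x $ i\<bar>)" by (intro sum_nonneg) auto
          then show "norm (wgrad \<Omega> (u n) x - wgrad \<Omega> v x) \<le> s n x" using True by (simp add: s_def)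
          have "\<bar>u n x $ i - v x $ i\<bar> \<le> (\<Sum>i\<in>UNIV. \<bar>u n x $ i - v x $ i\<bar>)" by (rule member_le_sum) auto
          then show "\<bar>u n x $ i - v x $ i\<bar> \<le> s n x" using True by (simp add: s_def add_increasing)
        qed
        have D: "(\<lambda>n. wgrad \<Omega> (u (r n)) x) \<longlonglongrightarrow> wgrad \<Omega> v x"
          by (rule LIM_zero_cancel, rule Lim_null_comparison[OF _ elim]) (simp add: le)
        have "(\<lambda>n. u (r n) x $ i) \<longlonglongrightarrow> v x $ i" for i
          by (rule LIM_zero_cancel, rule Lim_null_comparison[OF _ elim]) (simp add: le)
        then have "(\<lambda>n. u (r n) x) \<longlonglongrightarrow> v x" by (rule vec_tendstoI)
        with D have "(\<lambda>n. ((x, u (r n) x), wgrad \<Omega> (u (r n)) x)) \<longlonglongrightarrow> ((x, v x), wgrad \<Omega> v x)"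
          by (intro tendsto_Pair tendsto_const)
        from continuous_on_tendsto_compose[OF cont this] show ?thesis by (simp add: F_def F'_def)
      next
        case False
        then show ?thesis by (simp add: F_def F'_def off)
      qed
    qed
    fix e :: real assume "e > 0"
    \<comment> \<open>Chosen so that the Jacobian part, of size C * (\<open>\<epsilon>\<close> * E),
      takes at most e / 2; E + 1 avoids a division by zero.\<close>
    define \<epsilon> where "\<epsilon> = e / (2 * C * (E + 1))"
    have \<epsilon>: "\<epsilon> > 0" "C * (\<epsilon> * E) \<le> e / 2"
    proof -
      show "\<epsilon> > 0" using C(1) E(2) \<open>e > 0\<close> unfolding \<epsilon>_def by (intro divide_pos_pos mult_pos_pos) auto
      have "C * (\<epsilon> * E) = e / 2 * (E / (E + 1))" using C(1) by (simp add: \<epsilon>_def)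
      also have "\<dots> \<le> e / 2 * 1" using E(2) \<open>e > 0\<close> by (intro mult_left_mono) auto
      finally show "C * (\<epsilon> * E) \<le> e / 2" by simp
    qed
    have "\<forall>\<^sub>F t in at_top. H t / t \<ge> 1 / \<epsilon>" using H(2) by (simp add: filterlim_at_top)
    then obtain T0 where T0: "\<And>t. t \<ge> T0 \<Longrightarrow> H t / t \<ge> 1 / \<epsilon>" by (auto simp: eventually_at_top_linorder)
    define T where "T = max T0 0"
    have T: "t \<le> \<epsilon> * H t" if "t > 0" "t \<ge> T" for t
      using T0[of t] that \<epsilon>(1) by (simp add: T_def field_simps)
    have "T \<ge> 0" by (simp add: T_def)
    \<comment> \<open>The part of the growth bound that does not depend on n, left over after
      |Du_n|^2 <= 2 * |Du_n - Dv|^2 + 2 * |Dv|^2 and after writing the positive Jacobian as T plus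
      its excess.\<close>
    define g where "g x = C * (1 + 2 * (norm (wgrad \<Omega> v x))\<^sup>2 + T)" for x
    have gi: "integrable (lebesgue_on \<Omega>) g"
      unfolding g_def using wgrad_W12(3)[OF \<Omega>(1) W(2)] integrable_lebesgue_on_const[OF \<Omega>] by auto
    have g0: "g x \<ge> 0" for x using C(1) \<open>T \<ge> 0\<close> by (simp add: g_def)
    have "(\<lambda>n. LINT x|lebesgue_on \<Omega>. indicator K x * (norm (wgrad \<Omega> (u (r n)) x - wgrad \<Omega> v x))\<^sup>2) \<longlonglongrightarrow> 0"
      using LIMSEQ_subseq_LIMSEQ[OF lim2 r(1)] by (simp add: o_def)
    \<comment> \<open>The bound e / (4 * C) becomes e / 2 after multiplication by the factor 2 * C
      in front of \<open>k\<close> below.\<close>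
    then have "\<forall>\<^sub>F n in sequentially. (LINT x|lebesgue_on \<Omega>. indicator K x * (norm (wgrad \<Omega> (u (r n)) x - wgrad \<Omega> v x))\<^sup>2) < e / (4 * C)"
      using C(1) \<open>e > 0\<close> by (intro order_tendstoD(2)[of _ 0]) auto
    then obtain N where N: "\<And>n. n \<ge> N \<Longrightarrow>
        (LINT x|lebesgue_on \<Omega>. indicator K x * (norm (wgrad \<Omega> (u (r n)) x - wgrad \<Omega> v x))\<^sup>2) < e / (4 * C)"
      by (auto simp: eventually_sequentially)
    have "(\<integral>\<^sup>+x. ennreal (\<bar>F n x\<bar> - g x) \<partial>lebesgue_on \<Omega>) \<le> ennreal e" if n: "n \<ge> N" for n
    proof -
      define d where "d x = det (wgrad \<Omega> (u (r n)) x)" for x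
      define k where "k x = indicator K x * (norm (wgrad \<Omega> (u (r n)) x - wgrad \<Omega> v x))\<^sup>2" for x
      have [measurable]: "d \<in> borel_measurable (lebesgue_on \<Omega>)" unfolding d_def using deti by auto
      have ki: "integrable (lebesgue_on \<Omega>) k" unfolding k_def by (rule int2)
      note [measurable] = borel_measurable_integrable[OF ki]
      have k0: "k x \<ge> 0" for x by (simp add: k_def)
      have "(\<integral>\<^sup>+x. ennreal (\<bar>F n x\<bar> - g x) \<partial>lebesgue_on \<Omega>)
          \<le> (\<integral>\<^sup>+x. ennreal (2 * C * k x) + ennreal C * ennreal (d x - T) \<partial>lebesgue_on \<Omega>)"
      proof (rule nn_integral_mono_AE)
        show "AE x in lebesgue_on \<Omega>. ennreal (\<bar>F n x\<bar> - g x) \<le> ennreal (2 * C * k x) + ennreal C * ennreal (d x - T)"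
          using det[of "r n"]
        proof eventually_elim
          case (elim x)
          show ?case
          proof (cases "x \<in> K")
            case True
            have "(norm (wgrad \<Omega> (u (r n)) x))\<^sup>2 \<le> 2 * k x + 2 * (norm (wgrad \<Omega> v x))\<^sup>2"
              using True order_trans[OF power_mono[OF norm_triangle_sub[of "wgrad \<Omega> (u (r n)) x" "wgrad \<Omega> v x"], of 2] add_square_le]
              by (simp add: k_def)
            then have "1 + (norm (wgrad \<Omega> (u (r n)) x))\<^sup>2 + \<bar>d x\<bar> \<le> (1 + 2 * (norm (wgrad \<Omega> v x))\<^sup>2 + T) + (2 * k x + (d x - T))"
              using elim by (simp add: d_def)
            from mult_left_mono[OF this, of C] C(1)
            have "C * (1 + (norm (wgrad \<Omega> (u (r n)) x))\<^sup>2 + \<bar>d x\<bar>) \<le> g x + (2 * C * k x + C * (d x - T))"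
              by (simp add: g_def algebra_simps)
            then have "\<bar>F n x\<bar> - g x \<le> 2 * C * k x + C * (d x - T)"
              using C(2)[of "(x, u (r n) x)" "wgrad \<Omega> (u (r n)) x"] by (simp add: F_def d_def)
            then have "ennreal (\<bar>F n x\<bar> - g x) \<le> ennreal (2 * C * k x + C * (d x - T))" by (rule ennreal_leI)
            also have "\<dots> \<le> ennreal (2 * C * k x) + ennreal (C * (d x - T))"
              using C(1) k0[of x] by (intro ennreal_add_le) simp
            also have "ennreal (C * (d x - T)) = ennreal C * ennreal (d x - T)" using C(1) by (simp add: ennreal_mult')
            finally show ?thesis .
          next
            case False
            then have "\<bar>F n x\<bar> - g x \<le> 0" using g0[of x] by (simp add: F_def off)
            then show ?thesis by (simp add: ennreal_neg)
          qed
        qed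
      qed
      also have "\<dots> = (\<integral>\<^sup>+x. ennreal (2 * C * k x) \<partial>lebesgue_on \<Omega>) + ennreal C * (\<integral>\<^sup>+x. ennreal (d x - T) \<partial>lebesgue_on \<Omega>)"
        by (subst nn_integral_add) (auto simp: nn_integral_cmult)
      also have "(\<integral>\<^sup>+x. ennreal (2 * C * k x) \<partial>lebesgue_on \<Omega>) = ennreal (LINT x|lebesgue_on \<Omega>. 2 * C * k x)"
        using ki C(1) k0 by (intro nn_integral_eq_integral) auto
      also have "\<dots> \<le> ennreal (e / 2)"
        using N[OF n] C(1) by (intro ennreal_leI) (simp add: k_def[symmetric] field_simps)
      also have "(\<integral>\<^sup>+x. ennreal (d x - T) \<partial>lebesgue_on \<Omega>) \<le> ennreal (\<epsilon> * E)"
        by (rule nn_integral_excess_le[where N = "\<lambda>x. (norm (wgrad \<Omega> (u (r n)) x))\<^sup>2" and H = H])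
           (use borel_measurable_integrable[OF deti[of "r n"]] det[of "r n"] E(1)[of "r n"] E(2) H(1) T \<open>T \<ge> 0\<close> \<epsilon>(1) in \<open>auto simp: d_def energy_def\<close>)
      finally have "(\<integral>\<^sup>+x. ennreal (\<bar>F n x\<bar> - g x) \<partial>lebesgue_on \<Omega>) \<le> ennreal (e / 2) + ennreal C * ennreal (\<epsilon> * E)"
        by (simp add: add_mono mult_left_mono)
      also have "ennreal C * ennreal (\<epsilon> * E) = ennreal (C * (\<epsilon> * E))" using C(1) \<epsilon>(1) E(2) by (simp add: ennreal_mult)
      also have "\<dots> \<le> ennreal (e / 2)" using \<epsilon>(2) by (rule ennreal_leI)
      also have "ennreal (e / 2) + ennreal (e / 2) = ennreal e" using \<open>e > 0\<close> by (simp flip: ennreal_plus)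
      finally show ?thesis by (simp add: add_left_mono)
    qed
    then show "\<exists>g N. integrable (lebesgue_on \<Omega>) g \<and>
        (\<forall>n\<ge>N. (\<integral>\<^sup>+x. ennreal (\<bar>F n x\<bar> - g x) \<partial>lebesgue_on \<Omega>) \<le> ennreal e)"
      using gi by blast
  qed
  then show ?thesis using r(1) unfolding graph_current_eq F_def F'_def by blast
qed

section \<open>The complement of the support of \<open>\<mu>\<close>, and the conclusion\<close>

lemma integral_eq_0_off_measure_supp:
  assumes \<Omega>: "open \<Omega>" and \<mu>: "radon_measure_on \<Omega> \<mu>"
    and \<eta>: "compact (supp \<eta>)" "supp \<eta> \<subseteq> \<Omega> - measure_supp \<Omega> \<mu>"
  shows "(LINT x|\<mu>. (\<eta> x :: real)) = 0"
proof -
  have sets: "U \<inter> \<Omega> \<in> sets \<mu>" if "open U" for U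
    using \<mu> that by (auto simp: radon_measure_on_def sets_restrict_space)
  \<comment> \<open>Each point of the support of \<open>\<eta>\<close> has a null neighbourhood; by
    compactness finitely many of them cover it, and their union is still null.\<close>
  have "\<exists>U. open U \<and> x \<in> U \<and> emeasure \<mu> (U \<inter> \<Omega>) = 0" if "x \<in> supp \<eta>" for x
  proof -
    have "x \<in> \<Omega>" "x \<notin> measure_supp \<Omega> \<mu>" using that \<eta>(2) by auto
    then show ?thesis by (auto simp: measure_supp_def)
  qed
  then obtain U where U: "\<And>x. x \<in> supp \<eta> \<Longrightarrow> open (U x) \<and> x \<in> U x \<and> emeasure \<mu> (U x \<inter> \<Omega>) = 0"
    by metis
  obtain I where I: "I \<subseteq> supp \<eta>" "finite I" "supp \<eta> \<subseteq> (\<Union>x\<in>I. U x)"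
    using compactE_image[OF \<eta>(1), of "supp \<eta>" U] U by (metis UN_I subsetI)
  have "(\<Union>x\<in>I. U x \<inter> \<Omega>) \<in> null_sets \<mu>"
    using I U sets by (intro null_sets.finite_UN) (auto simp: null_sets_def)
  moreover have "{x \<in> space \<mu>. \<eta> x \<noteq> 0} \<subseteq> (\<Union>x\<in>I. U x \<inter> \<Omega>)"
    using I(3) \<eta>(2) closure_subset[of "{x. \<eta> x \<noteq> 0}"] by (fastforce simp: supp_def)
  ultimately have "AE x in \<mu>. \<eta> x = 0" by (rule AE_I')
  then show ?thesis by (rule integral_eq_zero_AE)
qed

text \<open>A null neighbourhood of one point is a null neighbourhood of all its points.\<close>

lemma open_diff_measure_supp:
  assumes "open \<Omega>"
  shows "open (\<Omega> - measure_supp \<Omega> \<mu>)"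
proof (subst open_subopen, intro ballI)
  fix x assume x: "x \<in> \<Omega> - measure_supp \<Omega> \<mu>"
  then obtain U where U: "open U" "x \<in> U" "emeasure \<mu> (U \<inter> \<Omega>) = 0"
    by (auto simp: measure_supp_def)
  have "U \<inter> \<Omega> \<subseteq> \<Omega> - measure_supp \<Omega> \<mu>"
    using U by (fastforce simp: measure_supp_def)
  then show "\<exists>T. open T \<and> x \<in> T \<and> T \<subseteq> \<Omega> - measure_supp \<Omega> \<mu>"
    using U x assms by (intro exI[of _ "U \<inter> \<Omega>"]) auto
qed

theorem proposition4p5:
  fixes \<Omega> \<Omega>' :: "(real^3) set"
    and g :: "real^3 \<Rightarrow> real^3"
    and M :: real
    and H :: "real \<Rightarrow> real"
    and u :: "nat \<Rightarrow> real^3 \<Rightarrow> real^3"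
    and v :: "real^3 \<Rightarrow> real^3"
    and S :: "((real^3) \<times> (real^3)) form3 \<Rightarrow> real"
    and \<mu> :: "(real^3) measure"
  assumes "smooth_bounded_domain \<Omega>" and "smooth_bounded_domain \<Omega>'"
    and "C1_diffeomorphism g (closure \<Omega>) (closure \<Omega>')"
    and "M > 0"
    and "\<And>t. t > 0 \<Longrightarrow> H t \<ge> 0"
    and "smooth_on H {0<..}" and "convex_on {0<..} H"
    and "filterlim (\<lambda>t. H t / t) at_top at_top"
    and "filterlim H at_top (at_right 0)"
    and "minimizing_sequence (energy \<Omega> H) (admissible_nc \<Omega> g M) u"
    and "weakly_converges_W12 \<Omega> u v"
    and "integrable (lebesgue_on \<Omega>) (\<lambda>x. det (wgrad \<Omega> v x))"
    and "current3 (\<Omega> \<times> UNIV) S"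
    and "current_converges (\<Omega> \<times> UNIV) (\<lambda>n. graph_current \<Omega> (u n))
           (\<lambda>\<omega>. graph_current \<Omega> v \<omega> + S \<omega>)"
    and "radon_measure_on \<Omega> \<mu>"
    and "densities_converge \<Omega> (\<lambda>n x. (norm (wgrad \<Omega> (u n) x))\<^sup>2) (\<lambda>x. (norm (wgrad \<Omega> v x))\<^sup>2) \<mu>"
  shows "current_supp (\<Omega> \<times> UNIV) S \<subseteq> measure_supp \<Omega> \<mu> \<times> UNIV"
proof -
  have \<Omega>: "open \<Omega>" "bounded \<Omega>" using assms(1) by (auto simp: smooth_bounded_domain_def)
  define V where "V = \<Omega> - measure_supp \<Omega> \<mu>"
  have V: "open V" "V \<subseteq> \<Omega>" using open_diff_measure_supp[OF \<Omega>(1)] by (auto simp: V_def)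
  define m where "m = (INF w\<in>admissible_nc \<Omega> g M. energy \<Omega> H w)"
  have m: "m < \<infinity>" "(\<lambda>n. energy \<Omega> H (u n)) \<longlonglongrightarrow> m" and adm: "\<And>n. u n \<in> admissible_nc \<Omega> g M"
    using assms(10) by (auto simp: minimizing_sequence_def m_def)
  \<comment> \<open>A finite bound strictly above the infimum. It holds only from some index N on,
    since early terms may have infinite energy; hence the shift by N below.\<close>
  define E where "E = enn2real (m + 1)"
  have E: "ennreal E = m + 1" "E \<ge> 0" using m(1) by (auto simp: E_def less_top[symmetric])
  have "m < m + 1" using m(1) by (auto simp: less_top[symmetric] ennreal_add_left_cancel_less[of m 0 1, simplified])
  then have "\<forall>\<^sub>F n in sequentially. energy \<Omega> H (u n) < ennreal E" unfolding E by (rule order_tendstoD(2)[OF m(2)])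
  then obtain N where N: "\<And>n. n \<ge> N \<Longrightarrow> energy \<Omega> H (u n) \<le> ennreal E"
    by (auto simp: eventually_sequentially intro: less_imp_le)
  have S0: "S \<omega> = 0" if \<omega>: "\<omega> \<in> test_forms3 (\<Omega> \<times> UNIV)" "form_supp \<omega> \<subseteq> V \<times> UNIV" for \<omega>
  proof -
    have "\<exists>r. strict_mono r \<and> (\<lambda>n. graph_current \<Omega> (u (r n + N)) \<omega>) \<longlonglongrightarrow> graph_current \<Omega> v \<omega>"
    proof (rule graph_current_convergent_subseq[OF \<Omega> _ _ _ _ assms(12) _ E(2) assms(5,8) V _ \<omega>, where u = "\<lambda>n. u (n + N)" and M = M])
      show "weakly_converges_W12 \<Omega> (\<lambda>n. u (n + N)) v"
        using assms(11) unfolding weakly_converges_W12_def by (auto intro: LIMSEQ_ignore_initial_segment)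
      show "energy \<Omega> H (u (n + N)) \<le> ennreal E" for n by (rule N) simp
      show "AE x in lebesgue_on \<Omega>. norm (u (n + N) x) \<le> M" "AE x in lebesgue_on \<Omega>. 0 < det (wgrad \<Omega> (u (n + N)) x)"
        "integrable (lebesgue_on \<Omega>) (\<lambda>x. det (wgrad \<Omega> (u (n + N)) x))" for n
        using adm[of "n + N"] by (auto simp: admissible_nc_def admissible_def)
      fix \<eta> :: "real^3 \<Rightarrow> real"
      assume \<eta>: "continuous_on UNIV \<eta>" "compact (supp \<eta>)" "supp \<eta> \<subseteq> V"
      have "(LINT x|\<mu>. \<eta> x) = 0"
        using integral_eq_0_off_measure_supp[OF \<Omega>(1) assms(15) \<eta>(2)] \<eta>(3) by (simp add: V_def)
      moreover have "supp \<eta> \<subseteq> \<Omega>" using \<eta>(3) V(2) by (rule subset_trans)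
      with assms(16) \<eta>(1,2) have "(\<lambda>n. LINT x|lebesgue_on \<Omega>. \<eta> x * (norm (wgrad \<Omega> (u n) x))\<^sup>2) \<longlonglongrightarrow>
          (LINT x|lebesgue_on \<Omega>. \<eta> x * (norm (wgrad \<Omega> v x))\<^sup>2) + (LINT x|\<mu>. \<eta> x)"
        unfolding densities_converge_def by blast
      ultimately have "(\<lambda>n. LINT x|lebesgue_on \<Omega>. \<eta> x * (norm (wgrad \<Omega> (u n) x))\<^sup>2) \<longlonglongrightarrow>
          (LINT x|lebesgue_on \<Omega>. \<eta> x * (norm (wgrad \<Omega> v x))\<^sup>2)"
        by simp
      then show "(\<lambda>n. LINT x|lebesgue_on \<Omega>. \<eta> x * (norm (wgrad \<Omega> (u (n + N)) x))\<^sup>2) \<longlonglongrightarrow>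
          (LINT x|lebesgue_on \<Omega>. \<eta> x * (norm (wgrad \<Omega> v x))\<^sup>2)"
        by (rule LIMSEQ_ignore_initial_segment)
    qed
    then obtain r where r: "strict_mono r" "(\<lambda>n. graph_current \<Omega> (u (r n + N)) \<omega>) \<longlonglongrightarrow> graph_current \<Omega> v \<omega>" by blast
    have "(\<lambda>n. graph_current \<Omega> (u (n + N)) \<omega>) \<longlonglongrightarrow> graph_current \<Omega> v \<omega> + S \<omega>"
      using assms(14) \<omega>(1) unfolding current_converges_def by (intro LIMSEQ_ignore_initial_segment) auto
    \<comment> \<open>Along the extracted subsequence the limit is the one with S and also the one
      without it, so S vanishes on the form.\<close>
    from LIMSEQ_unique[OF LIMSEQ_subseq_LIMSEQ[OF this r(1), unfolded o_def] r(2)]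
    show ?thesis by simp
  qed
  \<comment> \<open>The product set is itself one of the relatively closed sets intersected in
    \<open>current_supp\<close>, so the inclusion follows at once.\<close>
  have "closedin (top_of_set (\<Omega> \<times> (UNIV :: (real^3) set))) (measure_supp \<Omega> \<mu> \<times> UNIV)"
  proof -
    have eq: "measure_supp \<Omega> \<mu> \<times> UNIV = (\<Omega> \<times> UNIV) \<inter> - (V \<times> (UNIV :: (real^3) set))"
      by (auto simp: V_def measure_supp_def)
    have "closed (- (V \<times> (UNIV :: (real^3) set)))"
      by (intro closed_Compl open_Times V(1) open_UNIV)
    then show ?thesis unfolding eq by (rule closedin_closed_Int)
  qed
  moreover have "S \<omega> = 0" if "\<omega> \<in> test_forms3 (\<Omega> \<times> UNIV)"
      "form_supp \<omega> \<subseteq> (\<Omega> \<times> UNIV) - (measure_supp \<Omega> \<mu> \<times> UNIV)" for \<omega>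
  proof (rule S0[OF that(1)])
    have "(\<Omega> \<times> (UNIV :: (real^3) set)) - (measure_supp \<Omega> \<mu> \<times> UNIV) = V \<times> UNIV"
      unfolding V_def by blast
    then show "form_supp \<omega> \<subseteq> V \<times> UNIV" using that(2) by simp
  qed
  ultimately show ?thesis unfolding current_supp_def by (intro Inter_lower CollectI conjI ballI impI)
qed

end
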